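(* The $2$-functor $\mathsf{ArrAlg}\to\mathsf{Trip}_{\mathsf{cart}}(\mathsf{Set})$ given by $\mathcal A\mapsto P_{\mathcal A}$ and $f\mapsto\Phi_f^+$, where $(\Phi_f^+)_I(\phi)=f\circ\phi$, restricts to a $2$-fully faithful $2$-functor $\mathsf{ArrAlg}_{\mathsf{cd}}\hookrightarrow\mathsf{Trip}_{\mathsf{geom}}(\mathsf{Set})$. Explicitly, for all arrow algebras $\mathcal A$ and $\mathcal B$ it gives an equivalence of preorder categories $$\mathsf{ArrAlg}_{\mathsf{cd}}(\mathcal A,\mathcal B)\simeq\mathsf{Trip}_{\mathsf{geom}}(\mathsf{Set})(P_{\mathcal A},P_{\mathcal B}).$$
   Context: An arrow algebra $\mathcal A=(A,\preccurlyeq,\to,S)$ consists of a poset $(A,\preccurlyeq)$ with all meets $\bigwedge$; a binary operation $\to$ on $A$ (bracketed to the right), antitone in the first and monotone in the second argument; and a subset $S\subseteq A$ (the separator) which is upward closed, closed under modus ponens ($a\to b\in S$ and $a\in S$ imply $b\in S$), and contains the combinators $\mathbf k=\bigwedge_{a,b}a\to b\to a$, $\mathbf s=\bigwedge_{a,b,c}(a\to b\to c)\to(a\to b)\to a\to c$, and $\mathbf a=\bigwedge_{a,(b_i)_{i\in I},(c_i)_{i\in I}}\big(\bigwedge_{i\in I}a\to b_i\to c_i\big)\to a\to\bigwedge_{i\in I}(b_i\to c_i)$. An implicative morphism $f:\mathcal A\to\mathcal B$ is a function $f:A\to B$ such that: (i) $f(a)\in S_B$ for every $a\in S_A$; (ii)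 there is $r\in S_B$ with $r\preccurlyeq f(a\to a')\to f(a)\to f(a')$ for all $a,a'\in A$; (iii) for every $X\subseteq A\times A$, if $\bigwedge_{(a,a')\in X}a\to a'\in S_A$ then $\bigwedge_{(a,a')\in X}f(a)\to f(a')\in S_B$. Write $f\vdash f'$ if $\bigwedge_{a\in A}f(a)\to f'(a)\in S_B$. $\mathsf{ArrAlg}$ is the resulting preorder-enriched category. An implicative morphism $f:\mathcal A\to\mathcal B$ is computationally dense if there is an implicative morphism $h:\mathcal B\to\mathcal A$ with $fh\vdash\mathrm{id}_B$ and $\mathrm{id}_A\vdash hf$; $\mathsf{ArrAlg}_{\mathsf{cd}}$ is the wide subcategory of $\mathsf{ArrAlg}$ on these (with the same order on morphisms). A Heyting prealgebra is a preorder whose poset reflection is a Heyting algebra; $\mathsf{HeytPre}$ is the category of these with monotone maps inducing Heyting algebra morphisms on poset reflections. A tripos is a pseudofunctor $P:\mathsf{Set}^{\mathrm{op}}\to\mathsf{HeytPre}$ such that each $P(f)$ has a left and a right adjoint as monotone maps, satisfying the Beck–Chevalley condition, and which has a generic element $\sigma\in P(\Sigma)$ for some set $\Sigma$ (every $\phi\in P(X)$ is isomorphic to $P(g)(\sigma)$ for some $g:X\to\Sigma$). A transformation $\Phi:P\to Q$ is a family of monotone maps $\Phi_X:P(X)\to Q(X)$, pseudonatural in $X$; $\Phi\le\Psi$ means $\Phi_X\le\Psi_X$ pointwise for all $X$. It is cartesian if each $\Phi_X$ preserves finite meets up to isomorphism, and geometric if it is cartesian and there is a transformation $\Phi_+:Q\to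 P$ with $\Phi_X\dashv(\Phi_+)_X$ for every set $X$. $\mathsf{Trip}_{\mathsf{cart}}(\mathsf{Set})$ and $\mathsf{Trip}_{\mathsf{geom}}(\mathsf{Set})$ are the preorder-enriched categories of triposes with cartesian, respectively geometric, transformations. The arrow tripos $P_{\mathcal A}$ has $P_{\mathcal A}(I)=(A^I,\vdash_I)$ with $\phi\vdash_I\psi$ iff $\bigwedge_{i\in I}\phi(i)\to\psi(i)\in S$, and reindexing by precomposition. A $2$-functor is $2$-fully faithful if it induces equivalences of preorders on hom-preorders. *)

theory Defs
  imports
    "HOL-Algebra.Complete_Lattice"
    "HOL-Library.Equipollence"
begin

section \<open>The category of sets\<close>

text \<open>
  The category Set is the category of small sets of a Grothendieck universe. Such a universe
  consists of a type \<open>'u\<close>, whose subsets play the role of classes, and of a predicate selecting the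
  small subsets, closed under subsets, pairs, small-indexed unions and power sets. Elements of
  small sets need not themselves be sets, so the power set of a small set is only required to be
  represented by a small set up to bijection; products and (taking unions of singletons) images of
  small sets are then small as well. For a model \<open>V\<close> of set theory, take the small subsets of \<open>V\<close> to
  be those of the form \<open>{x. x \<in> v}\<close> with \<open>v\<close> in \<open>V\<close>. As in the usual definition of a Grothendieck
  universe, an infinite small set is not required to exist.

  A morphism from \<open>X\<close> to \<open>Y\<close> is an element of \<open>X \<rightarrow>\<^sub>E Y\<close>, with composition \<^term>\<open>compose X g f\<close>.
\<close>

locale set_universe =
  fixes small :: "'u set \<Rightarrow> bool"
  assumes small_subset: "small X \<Longrightarrow> Y \<subseteq> X \<Longrightarrow> small Y"
    and small_pair: "small {x, y}"
    and small_Union: "small X \<Longrightarrow> (\<And>x. x \<in> X \<Longrightarrow> small (F x)) \<Longrightarrow> small (\<Union>x\<in>X. F x)"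
    and small_Pow: "small X \<Longrightarrow> \<exists>Y. small Y \<and> Y \<approx> Pow X"

lemma set_universe_finite: "set_universe (finite :: nat set \<Rightarrow> bool)"
proof
  fix X :: "nat set"
  assume "finite X"
  then have "{..<card (Pow X)} \<approx> Pow X"
    by (simp add: eqpoll_iff_card)
  then show "\<exists>Y. finite (Y :: nat set) \<and> Y \<approx> Pow X"
    by blast
qed (auto intro: finite_subset)

definition pullback_square ::
  "('u set \<Rightarrow> bool) \<Rightarrow> 'u set \<Rightarrow> 'u set \<Rightarrow> 'u set \<Rightarrow> 'u set \<Rightarrow>
   ('u \<Rightarrow> 'u) \<Rightarrow> ('u \<Rightarrow> 'u) \<Rightarrow> ('u \<Rightarrow> 'u) \<Rightarrow> ('u \<Rightarrow> 'u) \<Rightarrow> bool"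
  \<comment> \<open>the square with sides \<open>p : W \<rightarrow> X\<close>, \<open>q : W \<rightarrow> Z\<close>, \<open>f : X \<rightarrow> Y\<close>, \<open>g : Z \<rightarrow> Y\<close>\<close>
  where
  "pullback_square small W X Z Y p q f g \<longleftrightarrow>
     small W \<and> small X \<and> small Z \<and> small Y \<and>
     p \<in> W \<rightarrow>\<^sub>E X \<and> q \<in> W \<rightarrow>\<^sub>E Z \<and> f \<in> X \<rightarrow>\<^sub>E Y \<and> g \<in> Z \<rightarrow>\<^sub>E Y \<and>
     compose W f p = compose W g q \<and>
     (\<forall>T u v. small T \<and> u \<in> T \<rightarrow>\<^sub>E X \<and> v \<in> T \<rightarrow>\<^sub>E Z \<and> compose T f u = compose T g v \<longrightarrow>
        (\<exists>!t. t \<in> T \<rightarrow>\<^sub>E W \<and> compose T p t = u \<and> compose T q t = v))"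


section \<open>Preorders and Heyting prealgebras\<close>

text \<open>
  A preorder is a \<^locale>\<open>weak_partial_order\<close>: the axioms of that locale force the equality
  \<open>.=\<close> to be, on the carrier, the isomorphism relation \<open>x \<sqsubseteq> y \<and> y \<sqsubseteq> x\<close>.
\<close>

definition preord :: "'a set \<Rightarrow> ('a \<Rightarrow> 'a \<Rightarrow> bool) \<Rightarrow> 'a gorder" where
  "preord X r = \<lparr>carrier = X, eq = (\<lambda>x y. r x y \<and> r y x), le = r\<rparr>"

definition monotone_map :: "'a gorder \<Rightarrow> 'b gorder \<Rightarrow> ('a \<Rightarrow> 'b) \<Rightarrow> bool" where
  "monotone_map L M f \<longleftrightarrow> f \<in> carrier L \<rightarrow> carrier M \<and> isotone L M f"

definition adjoint_maps :: "'a gorder \<Rightarrow> 'b gorder \<Rightarrow> ('a \<Rightarrow> 'b) \<Rightarrow> ('b \<Rightarrow> 'a) \<Rightarrow> bool"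
  \<comment> \<open>\<open>f\<close> is left adjoint to \<open>g\<close>\<close>
  where
  "adjoint_maps L M f g \<longleftrightarrow> monotone_map L M f \<and> monotone_map M L g \<and>
     (\<forall>x\<in>carrier L. \<forall>y\<in>carrier M. f x \<sqsubseteq>\<^bsub>M\<^esub> y \<longleftrightarrow> x \<sqsubseteq>\<^bsub>L\<^esub> g y)"

definition preorder_equivalence :: "'a gorder \<Rightarrow> 'b gorder \<Rightarrow> ('a \<Rightarrow> 'b) \<Rightarrow> bool" where
  "preorder_equivalence L M f \<longleftrightarrow> monotone_map L M f \<and>
     (\<exists>g. monotone_map M L g \<and>
        (\<forall>x\<in>carrier L. g (f x) .=\<^bsub>L\<^esub> x) \<and> (\<forall>y\<in>carrier M. f (g y) .=\<^bsub>M\<^esub> y))"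

definition preserves_finite_meets :: "'a gorder \<Rightarrow> 'b gorder \<Rightarrow> ('a \<Rightarrow> 'b) \<Rightarrow> bool" where
  "preserves_finite_meets L M f \<longleftrightarrow>
     (\<forall>F m. finite F \<and> F \<subseteq> carrier L \<and> is_glb L m F \<longrightarrow> is_glb M (f m) (f ` F))"

definition poset_reflection :: "'a gorder \<Rightarrow> 'a set gorder" where
  "poset_reflection L =
     \<lparr>carrier = classes\<^bsub>L\<^esub>, eq = (=), le = (\<lambda>C D. \<exists>x\<in>C. \<exists>y\<in>D. x \<sqsubseteq>\<^bsub>L\<^esub> y)\<rparr>"

definition reflection_map :: "'a gorder \<Rightarrow> 'b gorder \<Rightarrow> ('a \<Rightarrow> 'b) \<Rightarrow> 'a set \<Rightarrow> 'b set"
  \<comment> \<open>for monotone \<open>f\<close> all the classes in this union coincide\<close>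
  where
  "reflection_map L M f C = (\<Union>x\<in>C. class_of\<^bsub>M\<^esub> (f x))"

locale heyting_algebra = bounded_lattice L for L (structure) +
  assumes implication_exists:
    "x \<in> carrier L \<Longrightarrow> y \<in> carrier L \<Longrightarrow> \<exists>z. greatest L z {w \<in> carrier L. w \<sqinter> x \<sqsubseteq> y}"

definition heyting_imp :: "('a, 'b) gorder_scheme \<Rightarrow> 'a \<Rightarrow> 'a \<Rightarrow> 'a" where
  "heyting_imp L x y = (SOME z. greatest L z {w \<in> carrier L. w \<sqinter>\<^bsub>L\<^esub> x \<sqsubseteq>\<^bsub>L\<^esub> y})"

definition heyting_hom :: "'a gorder \<Rightarrow> 'b gorder \<Rightarrow> ('a \<Rightarrow> 'b) \<Rightarrow> bool" where
  "heyting_hom L M f \<longleftrightarrow>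
     heyting_algebra L \<and> heyting_algebra M \<and> f \<in> carrier L \<rightarrow> carrier M \<and>
     f \<top>\<^bsub>L\<^esub> = \<top>\<^bsub>M\<^esub> \<and> f \<bottom>\<^bsub>L\<^esub> = \<bottom>\<^bsub>M\<^esub> \<and> meet_pres L M f \<and> join_pres L M f \<and>
     (\<forall>x\<in>carrier L. \<forall>y\<in>carrier L. f (heyting_imp L x y) = heyting_imp M (f x) (f y))"

definition heyting_prealgebra :: "'a gorder \<Rightarrow> bool" where
  "heyting_prealgebra L \<longleftrightarrow> weak_partial_order L \<and> heyting_algebra (poset_reflection L)"

definition heytpre_hom :: "'a gorder \<Rightarrow> 'b gorder \<Rightarrow> ('a \<Rightarrow> 'b) \<Rightarrow> bool" where
  "heytpre_hom L M f \<longleftrightarrow> heyting_prealgebra L \<and> heyting_prealgebra M \<and> monotone_map L M f \<and>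
     heyting_hom (poset_reflection L) (poset_reflection M) (reflection_map L M f)"


section \<open>Preorder-enriched categories and 2-functors\<close>

record ('o, 'm) penr_cat =
  Ob :: "'o set"
  Hom :: "'o \<Rightarrow> 'o \<Rightarrow> 'm gorder"
  Id :: "'o \<Rightarrow> 'm"
  Comp :: "'o \<Rightarrow> 'o \<Rightarrow> 'o \<Rightarrow> 'm \<Rightarrow> 'm \<Rightarrow> 'm"
    \<comment> \<open>\<open>Comp C X Y Z g f\<close> is the composite of \<open>f : X \<rightarrow> Y\<close> and \<open>g : Y \<rightarrow> Z\<close>\<close>

locale preorder_enriched_category =
  fixes C :: "('o, 'm) penr_cat"
  assumes hom_preorder: "X \<in> Ob C \<Longrightarrow> Y \<in> Ob C \<Longrightarrow> weak_partial_order (Hom C X Y)"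
    and id_hom: "X \<in> Ob C \<Longrightarrow> Id C X \<in> carrier (Hom C X X)"
    and comp_hom: "\<lbrakk>X \<in> Ob C; Y \<in> Ob C; Z \<in> Ob C;
        f \<in> carrier (Hom C X Y); g \<in> carrier (Hom C Y Z)\<rbrakk>
      \<Longrightarrow> Comp C X Y Z g f \<in> carrier (Hom C X Z)"
    and comp_mono: "\<lbrakk>X \<in> Ob C; Y \<in> Ob C; Z \<in> Ob C;
        f \<in> carrier (Hom C X Y); f' \<in> carrier (Hom C X Y); f \<sqsubseteq>\<^bsub>Hom C X Y\<^esub> f';
        g \<in> carrier (Hom C Y Z); g' \<in> carrier (Hom C Y Z); g \<sqsubseteq>\<^bsub>Hom C Y Z\<^esub> g'\<rbrakk>
      \<Longrightarrow> Comp C X Y Z g f \<sqsubseteq>\<^bsub>Hom C X Z\<^esub> Comp C X Y Z g' f'"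
    and comp_id_left: "\<lbrakk>X \<in> Ob C; Y \<in> Ob C; f \<in> carrier (Hom C X Y)\<rbrakk>
      \<Longrightarrow> Comp C X Y Y (Id C Y) f = f"
    and comp_id_right: "\<lbrakk>X \<in> Ob C; Y \<in> Ob C; f \<in> carrier (Hom C X Y)\<rbrakk>
      \<Longrightarrow> Comp C X X Y f (Id C X) = f"
    and comp_assoc: "\<lbrakk>W \<in> Ob C; X \<in> Ob C; Y \<in> Ob C; Z \<in> Ob C;
        f \<in> carrier (Hom C W X); g \<in> carrier (Hom C X Y); h \<in> carrier (Hom C Y Z)\<rbrakk>
      \<Longrightarrow> Comp C W X Z (Comp C X Y Z h g) f = Comp C W Y Z h (Comp C W X Y g f)"

definition wide_subcat ::
  "('o, 'm) penr_cat \<Rightarrow> ('o \<Rightarrow> 'o \<Rightarrow> 'm \<Rightarrow> bool) \<Rightarrow> ('o, 'm) penr_cat" where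
  "wide_subcat C Q =
     C\<lparr>Hom := \<lambda>X Y. (Hom C X Y)\<lparr>carrier := {f \<in> carrier (Hom C X Y). Q X Y f}\<rparr>\<rparr>"

locale two_functor =
  C: preorder_enriched_category C + D: preorder_enriched_category D
  for C :: "('o, 'm) penr_cat" and D :: "('p, 'n) penr_cat" +
  fixes Fo :: "'o \<Rightarrow> 'p" and Fm :: "'o \<Rightarrow> 'o \<Rightarrow> 'm \<Rightarrow> 'n"
  assumes obj: "X \<in> Ob C \<Longrightarrow> Fo X \<in> Ob D"
    and hom_map: "X \<in> Ob C \<Longrightarrow> Y \<in> Ob C
      \<Longrightarrow> monotone_map (Hom C X Y) (Hom D (Fo X) (Fo Y)) (Fm X Y)"
    and map_id: "X \<in> Ob C \<Longrightarrow> Fm X X (Id C X) = Id D (Fo X)"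
    and map_comp: "\<lbrakk>X \<in> Ob C; Y \<in> Ob C; Z \<in> Ob C;
        f \<in> carrier (Hom C X Y); g \<in> carrier (Hom C Y Z)\<rbrakk>
      \<Longrightarrow> Fm X Z (Comp C X Y Z g f) = Comp D (Fo X) (Fo Y) (Fo Z) (Fm Y Z g) (Fm X Y f)"

definition two_fully_faithful ::
  "('o, 'm) penr_cat \<Rightarrow> ('p, 'n) penr_cat \<Rightarrow> ('o \<Rightarrow> 'p) \<Rightarrow> ('o \<Rightarrow> 'o \<Rightarrow> 'm \<Rightarrow> 'n) \<Rightarrow> bool" where
  "two_fully_faithful C D Fo Fm \<longleftrightarrow>
     (\<forall>X\<in>Ob C. \<forall>Y\<in>Ob C. preorder_equivalence (Hom C X Y) (Hom D (Fo X) (Fo Y)) (Fm X Y))"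


section \<open>Triposes\<close>

record ('u, 'p) indexed_preorder =
  fibre :: "'u set \<Rightarrow> 'p gorder"
  reindex :: "'u set \<Rightarrow> 'u set \<Rightarrow> ('u \<Rightarrow> 'u) \<Rightarrow> 'p \<Rightarrow> 'p"
    \<comment> \<open>for \<open>f : X \<rightarrow> Y\<close>, \<open>reindex P X Y f\<close> is the map from \<open>fibre P Y\<close> to \<open>fibre P X\<close>\<close>

text \<open>As the fibres are preorders, the coherence laws of a pseudofunctor hold automatically.\<close>

locale heyting_pseudofunctor =
  fixes small :: "'u set \<Rightarrow> bool" and P :: "('u, 'p) indexed_preorder"
  assumes fibre_heyting: "small X \<Longrightarrow> heyting_prealgebra (fibre P X)"
    and reindex_hom: "\<lbrakk>small X; small Y; f \<in> X \<rightarrow>\<^sub>E Y\<rbrakk>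
      \<Longrightarrow> heytpre_hom (fibre P Y) (fibre P X) (reindex P X Y f)"
    and reindex_id: "\<lbrakk>small X; \<phi> \<in> carrier (fibre P X)\<rbrakk>
      \<Longrightarrow> reindex P X X (\<lambda>x\<in>X. x) \<phi> .=\<^bsub>fibre P X\<^esub> \<phi>"
    and reindex_comp: "\<lbrakk>small X; small Y; small Z; f \<in> X \<rightarrow>\<^sub>E Y; g \<in> Y \<rightarrow>\<^sub>E Z;
        \<phi> \<in> carrier (fibre P Z)\<rbrakk>
      \<Longrightarrow> reindex P X Z (compose X g f) \<phi> .=\<^bsub>fibre P X\<^esub> reindex P X Y f (reindex P Y Z g \<phi>)"

locale tripos = heyting_pseudofunctor small P
  for small :: "'u set \<Rightarrow> bool" and P :: "('u, 'p) indexed_preorder" +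
  assumes left_adjoint: "\<lbrakk>small X; small Y; f \<in> X \<rightarrow>\<^sub>E Y\<rbrakk>
      \<Longrightarrow> \<exists>l. adjoint_maps (fibre P X) (fibre P Y) l (reindex P X Y f)"
    and right_adjoint: "\<lbrakk>small X; small Y; f \<in> X \<rightarrow>\<^sub>E Y\<rbrakk>
      \<Longrightarrow> \<exists>r. adjoint_maps (fibre P Y) (fibre P X) (reindex P X Y f) r"
    and beck_chevalley_left: "\<lbrakk>pullback_square small W X Z Y p q f g;
        adjoint_maps (fibre P X) (fibre P Y) l (reindex P X Y f);
        adjoint_maps (fibre P W) (fibre P Z) l' (reindex P W Z q);
        \<phi> \<in> carrier (fibre P X)\<rbrakk>
      \<Longrightarrow> l' (reindex P W X p \<phi>) .=\<^bsub>fibre P Z\<^esub> reindex P Z Y g (l \<phi>)"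
    and beck_chevalley_right: "\<lbrakk>pullback_square small W X Z Y p q f g;
        adjoint_maps (fibre P Y) (fibre P X) (reindex P X Y f) r;
        adjoint_maps (fibre P Z) (fibre P W) (reindex P W Z q) r';
        \<phi> \<in> carrier (fibre P X)\<rbrakk>
      \<Longrightarrow> r' (reindex P W X p \<phi>) .=\<^bsub>fibre P Z\<^esub> reindex P Z Y g (r \<phi>)"
    and generic_element: "\<exists>\<Sigma> \<sigma>. small \<Sigma> \<and> \<sigma> \<in> carrier (fibre P \<Sigma>) \<and>
      (\<forall>X \<phi>. small X \<and> \<phi> \<in> carrier (fibre P X) \<longrightarrow>
         (\<exists>g \<in> X \<rightarrow>\<^sub>E \<Sigma>. \<phi> .=\<^bsub>fibre P X\<^esub> reindex P X \<Sigma> g \<sigma>))"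

definition transformation ::
  "('u set \<Rightarrow> bool) \<Rightarrow> ('u, 'p) indexed_preorder \<Rightarrow> ('u, 'q) indexed_preorder \<Rightarrow>
   ('u set \<Rightarrow> 'p \<Rightarrow> 'q) \<Rightarrow> bool" where
  "transformation small P Q \<Phi> \<longleftrightarrow>
     \<Phi> \<in> (\<Pi>\<^sub>E X \<in> Collect small. carrier (fibre P X) \<rightarrow>\<^sub>E carrier (fibre Q X)) \<and>
     (\<forall>X. small X \<longrightarrow> monotone_map (fibre P X) (fibre Q X) (\<Phi> X)) \<and>
     (\<forall>X Y f \<phi>. small X \<and> small Y \<and> f \<in> X \<rightarrow>\<^sub>E Y \<and> \<phi> \<in> carrier (fibre P Y) \<longrightarrow>
        \<Phi> X (reindex P X Y f \<phi>) .=\<^bsub>fibre Q X\<^esub> reindex Q X Y f (\<Phi> Y \<phi>))"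

definition transformation_le ::
  "('u set \<Rightarrow> bool) \<Rightarrow> ('u, 'p) indexed_preorder \<Rightarrow> ('u, 'q) indexed_preorder \<Rightarrow>
   ('u set \<Rightarrow> 'p \<Rightarrow> 'q) \<Rightarrow> ('u set \<Rightarrow> 'p \<Rightarrow> 'q) \<Rightarrow> bool" where
  "transformation_le small P Q \<Phi> \<Psi> \<longleftrightarrow>
     (\<forall>X. small X \<longrightarrow> (\<forall>\<phi>\<in>carrier (fibre P X). \<Phi> X \<phi> \<sqsubseteq>\<^bsub>fibre Q X\<^esub> \<Psi> X \<phi>))"

definition cartesian_transformation ::
  "('u set \<Rightarrow> bool) \<Rightarrow> ('u, 'p) indexed_preorder \<Rightarrow> ('u, 'q) indexed_preorder \<Rightarrow>
   ('u set \<Rightarrow> 'p \<Rightarrow> 'q) \<Rightarrow> bool" where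
  "cartesian_transformation small P Q \<Phi> \<longleftrightarrow> transformation small P Q \<Phi> \<and>
     (\<forall>X. small X \<longrightarrow> preserves_finite_meets (fibre P X) (fibre Q X) (\<Phi> X))"

definition geometric_transformation ::
  "('u set \<Rightarrow> bool) \<Rightarrow> ('u, 'p) indexed_preorder \<Rightarrow> ('u, 'q) indexed_preorder \<Rightarrow>
   ('u set \<Rightarrow> 'p \<Rightarrow> 'q) \<Rightarrow> bool" where
  "geometric_transformation small P Q \<Phi> \<longleftrightarrow> cartesian_transformation small P Q \<Phi> \<and>
     (\<exists>\<Psi>. transformation small Q P \<Psi> \<and>
        (\<forall>X. small X \<longrightarrow> adjoint_maps (fibre P X) (fibre Q X) (\<Phi> X) (\<Psi> X)))"

definition Trip_cart ::
  "('u set \<Rightarrow> bool) \<Rightarrow> (('u, 'p) indexed_preorder, 'u set \<Rightarrow> 'p \<Rightarrow> 'p) penr_cat" where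
  "Trip_cart small =
     \<lparr>Ob = {P. tripos small P},
      Hom = (\<lambda>P Q. preord {\<Phi>. cartesian_transformation small P Q \<Phi>} (transformation_le small P Q)),
      Id = (\<lambda>P. \<lambda>X\<in>Collect small. \<lambda>\<phi>\<in>carrier (fibre P X). \<phi>),
      Comp = (\<lambda>P Q R \<Psi> \<Phi>. \<lambda>X\<in>Collect small. compose (carrier (fibre P X)) (\<Psi> X) (\<Phi> X))\<rparr>"

definition Trip_geom ::
  "('u set \<Rightarrow> bool) \<Rightarrow> (('u, 'p) indexed_preorder, 'u set \<Rightarrow> 'p \<Rightarrow> 'p) penr_cat" where
  "Trip_geom small = wide_subcat (Trip_cart small) (geometric_transformation small)"


section \<open>Arrow algebras\<close>

record 'u arrow_structure = "'u gorder" +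
  arr :: "'u \<Rightarrow> 'u \<Rightarrow> 'u"  (infixr \<open>\<leadsto>\<index>\<close> 60)
  sep :: "'u set"

definition comb_k :: "'u arrow_structure \<Rightarrow> 'u" where
  "comb_k A = \<Sqinter>\<^bsub>A\<^esub> {a \<leadsto>\<^bsub>A\<^esub> b \<leadsto>\<^bsub>A\<^esub> a | a b. a \<in> carrier A \<and> b \<in> carrier A}"

definition comb_s :: "'u arrow_structure \<Rightarrow> 'u" where
  "comb_s A = \<Sqinter>\<^bsub>A\<^esub> {(a \<leadsto>\<^bsub>A\<^esub> b \<leadsto>\<^bsub>A\<^esub> c) \<leadsto>\<^bsub>A\<^esub> (a \<leadsto>\<^bsub>A\<^esub> b) \<leadsto>\<^bsub>A\<^esub> a \<leadsto>\<^bsub>A\<^esub> c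
     | a b c. a \<in> carrier A \<and> b \<in> carrier A \<and> c \<in> carrier A}"

definition comb_a :: "('u set \<Rightarrow> bool) \<Rightarrow> 'u arrow_structure \<Rightarrow> 'u" where
  "comb_a small A = \<Sqinter>\<^bsub>A\<^esub> {(\<Sqinter>\<^bsub>A\<^esub> {a \<leadsto>\<^bsub>A\<^esub> b i \<leadsto>\<^bsub>A\<^esub> c i | i. i \<in> I}) \<leadsto>\<^bsub>A\<^esub> a \<leadsto>\<^bsub>A\<^esub>
        (\<Sqinter>\<^bsub>A\<^esub> {b i \<leadsto>\<^bsub>A\<^esub> c i | i. i \<in> I})
     | a I b c. a \<in> carrier A \<and> small I \<and> b \<in> I \<rightarrow> carrier A \<and> c \<in> I \<rightarrow> carrier A}"

locale arrow_algebra = partial_order A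
  for small :: "'u set \<Rightarrow> bool" and A :: "'u arrow_structure" (structure) +
  assumes carrier_small: "small (carrier A)"
    and meets_exist: "X \<subseteq> carrier A \<Longrightarrow> \<exists>m. is_glb A m X"
    and arr_closed: "\<lbrakk>a \<in> carrier A; b \<in> carrier A\<rbrakk> \<Longrightarrow> a \<leadsto> b \<in> carrier A"
    and arr_mono: "\<lbrakk>a \<in> carrier A; a' \<in> carrier A; b \<in> carrier A; b' \<in> carrier A;
        a' \<sqsubseteq> a; b \<sqsubseteq> b'\<rbrakk> \<Longrightarrow> a \<leadsto> b \<sqsubseteq> a' \<leadsto> b'"
    and sep_subset: "sep A \<subseteq> carrier A"
    and sep_upward: "\<lbrakk>a \<in> sep A; b \<in> carrier A; a \<sqsubseteq> b\<rbrakk> \<Longrightarrow> b \<in> sep A"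
    and sep_mp: "\<lbrakk>a \<in> carrier A; b \<in> carrier A; a \<leadsto> b \<in> sep A; a \<in> sep A\<rbrakk> \<Longrightarrow> b \<in> sep A"
    and sep_k: "comb_k A \<in> sep A"
    and sep_s: "comb_s A \<in> sep A"
    and sep_a: "comb_a small A \<in> sep A"

definition implicative_morphism ::
  "'u arrow_structure \<Rightarrow> 'u arrow_structure \<Rightarrow> ('u \<Rightarrow> 'u) \<Rightarrow> bool" where
  "implicative_morphism A B f \<longleftrightarrow>
     f \<in> carrier A \<rightarrow>\<^sub>E carrier B \<and>
     (\<forall>a\<in>sep A. f a \<in> sep B) \<and>
     (\<exists>r\<in>sep B. \<forall>a\<in>carrier A. \<forall>a'\<in>carrier A. r \<sqsubseteq>\<^bsub>B\<^esub> f (a \<leadsto>\<^bsub>A\<^esub> a') \<leadsto>\<^bsub>B\<^esub> f a \<leadsto>\<^bsub>B\<^esub> f a') \<and>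
     (\<forall>X \<subseteq> carrier A \<times> carrier A.
        \<Sqinter>\<^bsub>A\<^esub> {a \<leadsto>\<^bsub>A\<^esub> a' | a a'. (a, a') \<in> X} \<in> sep A \<longrightarrow>
        \<Sqinter>\<^bsub>B\<^esub> {f a \<leadsto>\<^bsub>B\<^esub> f a' | a a'. (a, a') \<in> X} \<in> sep B)"

definition morphism_le ::
  "'u arrow_structure \<Rightarrow> 'u arrow_structure \<Rightarrow> ('u \<Rightarrow> 'u) \<Rightarrow> ('u \<Rightarrow> 'u) \<Rightarrow> bool" where
  "morphism_le A B f f' \<longleftrightarrow> \<Sqinter>\<^bsub>B\<^esub> {f a \<leadsto>\<^bsub>B\<^esub> f' a | a. a \<in> carrier A} \<in> sep B"

definition ArrAlg :: "('u set \<Rightarrow> bool) \<Rightarrow> ('u arrow_structure, 'u \<Rightarrow> 'u) penr_cat" where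
  "ArrAlg small =
     \<lparr>Ob = {A. arrow_algebra small A},
      Hom = (\<lambda>A B. preord {f. implicative_morphism A B f} (morphism_le A B)),
      Id = (\<lambda>A. \<lambda>a\<in>carrier A. a),
      Comp = (\<lambda>A B C g f. compose (carrier A) g f)\<rparr>"

definition computationally_dense ::
  "'u arrow_structure \<Rightarrow> 'u arrow_structure \<Rightarrow> ('u \<Rightarrow> 'u) \<Rightarrow> bool" where
  "computationally_dense A B f \<longleftrightarrow>
     (\<exists>h. implicative_morphism B A h \<and>
        morphism_le B B (compose (carrier B) f h) (\<lambda>b\<in>carrier B. b) \<and>
        morphism_le A A (\<lambda>a\<in>carrier A. a) (compose (carrier A) h f))"

definition ArrAlg_cd :: "('u set \<Rightarrow> bool) \<Rightarrow> ('u arrow_structure, 'u \<Rightarrow> 'u) penr_cat" where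
  "ArrAlg_cd small = wide_subcat (ArrAlg small) computationally_dense"

definition arrow_tripos :: "'u arrow_structure \<Rightarrow> ('u, 'u \<Rightarrow> 'u) indexed_preorder" where
  "arrow_tripos A =
     \<lparr>fibre = (\<lambda>I. preord (I \<rightarrow>\<^sub>E carrier A)
        (\<lambda>\<phi> \<psi>. \<Sqinter>\<^bsub>A\<^esub> {\<phi> i \<leadsto>\<^bsub>A\<^esub> \<psi> i | i. i \<in> I} \<in> sep A)),
      reindex = (\<lambda>I J f \<phi>. compose I \<phi> f)\<rparr>"

definition postcomp_transformation ::
  "('u set \<Rightarrow> bool) \<Rightarrow> 'u arrow_structure \<Rightarrow> 'u arrow_structure \<Rightarrow> ('u \<Rightarrow> 'u) \<Rightarrow>
   'u set \<Rightarrow> ('u \<Rightarrow> 'u) \<Rightarrow> 'u \<Rightarrow> 'u"  (\<open>\<Phi>\<^sup>+\<close>)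
  where
  "\<Phi>\<^sup>+ small A B f = (\<lambda>I\<in>Collect small. \<lambda>\<phi>\<in>I \<rightarrow>\<^sub>E carrier A. compose I f \<phi>)"

end

theory Submission
  imports Defs
begin

text \<open>
  The logic of an arrow algebra \<open>A\<close> is a logic of uniform truth: a family of elements is true when its
  meet lies in the separator, so that one element of the separator realizes all its members. This is
  much stronger than truth of each member, because a separator need not be closed under meets. The
  combinators \<open>k\<close> and \<open>s\<close> are axioms for families, and the combinator \<open>a\<close> is what makes modus ponens
  valid for families whose conclusion is again a family of implications (\<open>holds_mp\<close>). All
  intuitionistic reasoning can be carried out under this restriction if the connectives and the
  quantifiers are given second-order encodings, which are meets of implications. Therefore \<open>P\<^sub>A\<close> is a
  tripos (\<open>tripos_arrow_tripos\<close>): quantification over the fibres of a function is adjoint to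
  reindexing along it, the Beck--Chevalley condition follows since a pullback of sets has a point over
  each compatible pair of points, and the identity function of \<open>A\<close> is a generic element.

  An implicative morphism \<open>f\<close> preserves uniform implications, and conjunctions up to isomorphism, so
  that postcomposition with \<open>f\<close> is a cartesian transformation. The morphism \<open>h\<close> that witnesses
  computational density of \<open>f\<close> gives its right adjoint.

  Conversely, let \<open>\<Phi>\<close> be a transformation from \<open>P\<^sub>A\<close> to \<open>P\<^sub>B\<close>. An element \<open>\<phi>\<close> of \<open>P\<^sub>A(I)\<close> is the
  reindexing along \<open>\<phi>\<close> of the generic element, so naturality makes \<open>\<Phi>\<close> isomorphic to postcomposition
  with the value \<open>f\<close> of \<open>\<Phi>\<close> at the generic element (\<open>transformation_eq_induced\<close>). If \<open>\<Phi>\<close> is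
  cartesian, then \<open>f\<close> is implicative (\<open>implicative_induced_map\<close>): every set of pairs of elements of
  \<open>A\<close> is represented by a small set, where monotonicity of \<open>\<Phi>\<close> says that \<open>f\<close> preserves uniform
  implications, preservation of the top element says that \<open>f\<close> preserves the separator, and
  preservation of binary meets applied to \<open>(a \<rightarrow> a') \<and> a \<turnstile> a'\<close> gives the remaining condition. If \<open>\<Phi>\<close>
  is geometric, then its right adjoint preserves finite meets, so it comes in the same way from an
  implicative morphism \<open>h\<close>; the unit and the counit at the generic elements are the inequalities
  \<open>id \<turnstile> h f\<close> and \<open>f h \<turnstile> id\<close>. Hence \<open>\<Phi> \<mapsto> f\<close> is inverse to \<open>f \<mapsto> \<Phi>\<^sup>+\<close> up to isomorphism.
\<close>


section \<open>Heyting prealgebras\<close>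

lemma weak_partial_order_preord:
  assumes "\<And>x. x \<in> X \<Longrightarrow> r x x"
    and "\<And>x y z. \<lbrakk>x \<in> X; y \<in> X; z \<in> X; r x y; r y z\<rbrakk> \<Longrightarrow> r x z"
  shows "weak_partial_order (preord X r)"
  (is "weak_partial_order ?L")
proof
  show "x \<sqsubseteq>\<^bsub>?L\<^esub> z \<longleftrightarrow> y \<sqsubseteq>\<^bsub>?L\<^esub> w"
    if "x .=\<^bsub>?L\<^esub> y" "z .=\<^bsub>?L\<^esub> w" "x \<in> carrier ?L" "y \<in> carrier ?L" "z \<in> carrier ?L" "w \<in> carrier ?L"
    for x y z w
    using that unfolding preord_def by simp (meson assms(2))
  show "x \<sqsubseteq>\<^bsub>?L\<^esub> z"
    if "x \<sqsubseteq>\<^bsub>?L\<^esub> y" "y \<sqsubseteq>\<^bsub>?L\<^esub> z" "x \<in> carrier ?L" "y \<in> carrier ?L" "z \<in> carrier ?L" for x y z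
    using that unfolding preord_def by simp (meson assms(2))
  show "x .=\<^bsub>?L\<^esub> z"
    if "x .=\<^bsub>?L\<^esub> y" "y .=\<^bsub>?L\<^esub> z" "x \<in> carrier ?L" "y \<in> carrier ?L" "z \<in> carrier ?L" for x y z
    using that unfolding preord_def by simp (meson assms(2))
qed (simp_all add: preord_def assms(1))

lemma (in weak_partial_order) eq_iff_le:
  "\<lbrakk>x \<in> carrier L; y \<in> carrier L\<rbrakk> \<Longrightarrow> x .= y \<longleftrightarrow> x \<sqsubseteq> y \<and> y \<sqsubseteq> x"
  using local.sym by blast

text \<open>
  Heyting prealgebras are handled through a choice of the operations on the preorder itself, which
  need to be determined only up to isomorphism; the poset reflection turns them into the operations
  of a Heyting algebra.
\<close>

locale heyting_preorder = weak_partial_order L for L :: "'a gorder" (structure) +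
  fixes tp bt :: 'a and mt jn im :: "'a \<Rightarrow> 'a \<Rightarrow> 'a"
  assumes tp_closed [simp]: "tp \<in> carrier L" and bt_closed [simp]: "bt \<in> carrier L"
    and mt_closed [simp]: "\<lbrakk>x \<in> carrier L; y \<in> carrier L\<rbrakk> \<Longrightarrow> mt x y \<in> carrier L"
    and jn_closed [simp]: "\<lbrakk>x \<in> carrier L; y \<in> carrier L\<rbrakk> \<Longrightarrow> jn x y \<in> carrier L"
    and im_closed [simp]: "\<lbrakk>x \<in> carrier L; y \<in> carrier L\<rbrakk> \<Longrightarrow> im x y \<in> carrier L"
    and le_tp [simp]: "x \<in> carrier L \<Longrightarrow> x \<sqsubseteq> tp"
    and bt_le [simp]: "x \<in> carrier L \<Longrightarrow> bt \<sqsubseteq> x"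
    and le_mt_iff: "\<lbrakk>x \<in> carrier L; y \<in> carrier L; z \<in> carrier L\<rbrakk>
      \<Longrightarrow> z \<sqsubseteq> mt x y \<longleftrightarrow> z \<sqsubseteq> x \<and> z \<sqsubseteq> y"
    and jn_le_iff: "\<lbrakk>x \<in> carrier L; y \<in> carrier L; z \<in> carrier L\<rbrakk>
      \<Longrightarrow> jn x y \<sqsubseteq> z \<longleftrightarrow> x \<sqsubseteq> z \<and> y \<sqsubseteq> z"
    and le_im_iff: "\<lbrakk>x \<in> carrier L; y \<in> carrier L; z \<in> carrier L\<rbrakk>
      \<Longrightarrow> z \<sqsubseteq> im x y \<longleftrightarrow> mt z x \<sqsubseteq> y"
begin

abbreviation R :: "'a set gorder" where "R \<equiv> poset_reflection L"

lemma carrier_reflection: "carrier R = (\<lambda>x. class_of x) ` carrier L"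
  unfolding poset_reflection_def eq_classes_def by auto

lemma class_in_reflection [simp]: "x \<in> carrier L \<Longrightarrow> class_of x \<in> carrier R"
  by (simp add: carrier_reflection)

lemma class_eq_iff:
  "\<lbrakk>x \<in> carrier L; y \<in> carrier L\<rbrakk> \<Longrightarrow> class_of x = class_of y \<longleftrightarrow> x \<sqsubseteq> y \<and> y \<sqsubseteq> x"
  unfolding eq_class_of_def using eq_iff_le[of x y] le_trans
  by (auto simp: set_eq_iff) (metis local.sym local.trans local.refl)+

lemma class_le_iff [simp]:
  assumes "x \<in> carrier L" "y \<in> carrier L"
  shows "class_of x \<sqsubseteq>\<^bsub>R\<^esub> class_of y \<longleftrightarrow> x \<sqsubseteq> y"
proof
  assume "class_of x \<sqsubseteq>\<^bsub>R\<^esub> class_of y"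
  then obtain x' y' where "x' \<in> carrier L" "y' \<in> carrier L" "x .= x'" "y .= y'" "x' \<sqsubseteq> y'"
    by (auto simp: poset_reflection_def eq_class_of_def)
  then show "x \<sqsubseteq> y"
    using le_cong assms by blast
next
  assume "x \<sqsubseteq> y"
  then show "class_of x \<sqsubseteq>\<^bsub>R\<^esub> class_of y"
    using assms by (auto simp: poset_reflection_def eq_class_of_def)
qed

lemma partial_order_reflection: "partial_order R"
proof
  have eqR: "(.=\<^bsub>R\<^esub>) = (=)"
    by (simp add: poset_reflection_def)
  then show "(.=\<^bsub>R\<^esub>) = (=)" .
  show "x .=\<^bsub>R\<^esub> y" if "x \<sqsubseteq>\<^bsub>R\<^esub> y" "y \<sqsubseteq>\<^bsub>R\<^esub> x" "x \<in> carrier R" "y \<in> carrier R" for x y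
  proof -
    obtain x' y' where "x' \<in> carrier L" "y' \<in> carrier L" "x = class_of x'" "y = class_of y'"
      using \<open>x \<in> carrier R\<close> \<open>y \<in> carrier R\<close> unfolding carrier_reflection by blast
    then show ?thesis
      using that class_eq_iff[of x' y'] by (simp add: eqR)
  qed
  show "x \<sqsubseteq>\<^bsub>R\<^esub> z" if "x \<sqsubseteq>\<^bsub>R\<^esub> y" "y \<sqsubseteq>\<^bsub>R\<^esub> z" "x \<in> carrier R" "y \<in> carrier R" "z \<in> carrier R"
    for x y z
    using that le_trans by (auto simp: carrier_reflection)
  show "x \<sqsubseteq>\<^bsub>R\<^esub> x" if "x \<in> carrier R" for x
    using that by (auto simp: carrier_reflection)
qed (auto simp: poset_reflection_def)

interpretation R: partial_order R
  by (rule partial_order_reflection)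

lemma glb_class:
  assumes "x \<in> carrier L" "y \<in> carrier L"
  shows "is_glb R (class_of (mt x y)) {class_of x, class_of y}"
proof (rule greatest_LowerI)
  fix z assume "z \<in> Lower R {class_of x, class_of y}"
  then have z: "z \<in> carrier R" "z \<sqsubseteq>\<^bsub>R\<^esub> class_of x" "z \<sqsubseteq>\<^bsub>R\<^esub> class_of y"
    using assms by (auto simp: Lower_def)
  then show "z \<sqsubseteq>\<^bsub>R\<^esub> class_of (mt x y)"
    using assms le_mt_iff by (auto simp: carrier_reflection)
qed (use assms le_mt_iff[OF assms, of "mt x y"] in auto)

lemma lub_class:
  assumes "x \<in> carrier L" "y \<in> carrier L"
  shows "is_lub R (class_of (jn x y)) {class_of x, class_of y}"
proof (rule least_UpperI)
  fix z assume "z \<in> Upper R {class_of x, class_of y}"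
  then have z: "z \<in> carrier R" "class_of x \<sqsubseteq>\<^bsub>R\<^esub> z" "class_of y \<sqsubseteq>\<^bsub>R\<^esub> z"
    using assms by (auto simp: Upper_def)
  then show "class_of (jn x y) \<sqsubseteq>\<^bsub>R\<^esub> z"
    using assms jn_le_iff by (auto simp: carrier_reflection)
qed (use assms jn_le_iff[OF assms, of "jn x y"] in auto)

lemma greatest_class: "greatest R (class_of tp) (carrier R)"
  by (auto simp: greatest_def carrier_reflection)

lemma least_class: "least R (class_of bt) (carrier R)"
  by (auto simp: least_def carrier_reflection)

lemma bounded_lattice_reflection: "bounded_lattice R"
proof
  show "\<exists>s. is_lub R s {x, y}" if "x \<in> carrier R" "y \<in> carrier R" for x y
    using that lub_class by (auto simp: carrier_reflection)
  show "\<exists>s. is_glb R s {x, y}" if "x \<in> carrier R" "y \<in> carrier R" for x y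
    using that glb_class by (auto simp: carrier_reflection)
qed (use greatest_class least_class in blast)+

interpretation R: bounded_lattice R
  by (rule bounded_lattice_reflection)

lemma meet_class:
  "\<lbrakk>x \<in> carrier L; y \<in> carrier L\<rbrakk> \<Longrightarrow> class_of x \<sqinter>\<^bsub>R\<^esub> class_of y = class_of (mt x y)"
  unfolding meet_def inf_def
  by (rule some_equality) (rule glb_class R.greatest_unique[OF _ glb_class], assumption+)+

lemma join_class:
  "\<lbrakk>x \<in> carrier L; y \<in> carrier L\<rbrakk> \<Longrightarrow> class_of x \<squnion>\<^bsub>R\<^esub> class_of y = class_of (jn x y)"
  unfolding join_def sup_def
  by (rule some_equality) (rule lub_class R.least_unique[OF _ lub_class], assumption+)+

lemma top_class: "\<top>\<^bsub>R\<^esub> = class_of tp"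
  by (metis R.top_greatest R.greatest_unique greatest_class)

lemma bottom_class: "\<bottom>\<^bsub>R\<^esub> = class_of bt"
  by (metis R.bottom_least R.least_unique least_class)

lemma greatest_im_class:
  assumes "x \<in> carrier L" "y \<in> carrier L"
  shows "greatest R (class_of (im x y))
    {w \<in> carrier R. w \<sqinter>\<^bsub>R\<^esub> class_of x \<sqsubseteq>\<^bsub>R\<^esub> class_of y}"
  unfolding greatest_def using assms le_im_iff le_im_iff[OF assms, of "im x y"]
  by (auto simp: carrier_reflection meet_class)

lemma heyting_imp_class:
  "\<lbrakk>x \<in> carrier L; y \<in> carrier L\<rbrakk> \<Longrightarrow> heyting_imp R (class_of x) (class_of y) = class_of (im x y)"
  unfolding heyting_imp_def
  by (rule some_equality) (rule greatest_im_class R.greatest_unique[OF _ greatest_im_class], assumption+)+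

lemma heyting_algebra_reflection: "heyting_algebra R"
proof
  show "\<exists>z. greatest R z {w \<in> carrier R. w \<sqinter>\<^bsub>R\<^esub> x \<sqsubseteq>\<^bsub>R\<^esub> y}"
    if "x \<in> carrier R" "y \<in> carrier R" for x y
    using that greatest_im_class by (auto simp: carrier_reflection)
qed

lemma heyting_prealgebra: "heyting_prealgebra L"
  by (simp add: heyting_prealgebra_def heyting_algebra_reflection weak_partial_order_axioms)

end

lemma reflection_map_class:
  assumes "weak_partial_order L" "weak_partial_order M" "monotone_map L M f" "x \<in> carrier L"
  shows "reflection_map L M f (class_of\<^bsub>L\<^esub> x) = class_of\<^bsub>M\<^esub> (f x)"
proof -
  interpret L: weak_partial_order L by fact
  interpret M: weak_partial_order M by fact
  have "class_of\<^bsub>M\<^esub> (f y) = class_of\<^bsub>M\<^esub> (f x)" if "y \<in> class_of\<^bsub>L\<^esub> x" for y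
  proof -
    have y: "y \<in> carrier L" "y .=\<^bsub>L\<^esub> x"
      using that assms(4) by (auto simp: eq_class_of_def intro: L.sym)
    then have f: "f x \<in> carrier M" "f y \<in> carrier M" "f x \<sqsubseteq>\<^bsub>M\<^esub> f y" "f y \<sqsubseteq>\<^bsub>M\<^esub> f x"
      using assms(3,4) L.eq_iff_le[of y x] unfolding monotone_map_def isotone_def by blast+
    have "f x .=\<^bsub>M\<^esub> f y"
      by (rule M.weak_le_antisym[OF f(3,4,1,2)])
    then show ?thesis
      using f(1,2) unfolding eq_class_of_def by (blast intro: M.sym M.trans)
  qed
  moreover have "x \<in> class_of\<^bsub>L\<^esub> x"
    using assms(4) by (auto simp: eq_class_of_def)
  ultimately show ?thesis
    unfolding reflection_map_def by blast
qed

text \<open>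
  On the poset reflections all operations are forced by the order. Hence preservation up to isomorphism
  of any chosen operations on the preorders suffices.
\<close>

lemma heytpre_homI:
  assumes "heyting_preorder L tp bt mt jn im" "heyting_preorder M tp' bt' mt' jn' im'"
    and f: "monotone_map L M f"
    and tp: "f tp .=\<^bsub>M\<^esub> tp'" and bt: "f bt .=\<^bsub>M\<^esub> bt'"
    and mt: "\<And>x y. \<lbrakk>x \<in> carrier L; y \<in> carrier L\<rbrakk> \<Longrightarrow> f (mt x y) .=\<^bsub>M\<^esub> mt' (f x) (f y)"
    and jn: "\<And>x y. \<lbrakk>x \<in> carrier L; y \<in> carrier L\<rbrakk> \<Longrightarrow> f (jn x y) .=\<^bsub>M\<^esub> jn' (f x) (f y)"
    and im: "\<And>x y. \<lbrakk>x \<in> carrier L; y \<in> carrier L\<rbrakk> \<Longrightarrow> f (im x y) .=\<^bsub>M\<^esub> im' (f x) (f y)"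
  shows "heytpre_hom L M f"
proof -
  interpret L: heyting_preorder L tp bt mt jn im by fact
  interpret M: heyting_preorder M tp' bt' mt' jn' im' by fact
  interpret LR: bounded_lattice L.R by (rule L.bounded_lattice_reflection)
  interpret MR: bounded_lattice M.R by (rule M.bounded_lattice_reflection)
  have fc [simp]: "x \<in> carrier L \<Longrightarrow> f x \<in> carrier M" for x
    using f by (auto simp: monotone_map_def)
  have cl: "reflection_map L M f (class_of\<^bsub>L\<^esub> x) = class_of\<^bsub>M\<^esub> (f x)" if "x \<in> carrier L" for x
    by (rule reflection_map_class[OF L.weak_partial_order_axioms M.weak_partial_order_axioms f that])
  have clM: "class_of\<^bsub>M\<^esub> x = class_of\<^bsub>M\<^esub> y" if "x .=\<^bsub>M\<^esub> y" "x \<in> carrier M" "y \<in> carrier M" for x y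
    using that M.class_eq_iff M.eq_iff_le by blast
  have obtain_rep: "\<exists>x'\<in>carrier L. x = class_of\<^bsub>L\<^esub> x'" if "x \<in> carrier L.R" for x
    using that unfolding L.carrier_reflection by blast
  have "heyting_hom L.R M.R (reflection_map L M f)"
    unfolding heyting_hom_def meet_pres_def join_pres_def
  proof (intro conjI ballI)
    fix x y assume "x \<in> carrier L.R" "y \<in> carrier L.R"
    then obtain x' y' where *: "x' \<in> carrier L" "y' \<in> carrier L"
      "x = class_of\<^bsub>L\<^esub> x'" "y = class_of\<^bsub>L\<^esub> y'"
      using obtain_rep by metis
    show "reflection_map L M f (x \<sqinter>\<^bsub>L.R\<^esub> y) = reflection_map L M f x \<sqinter>\<^bsub>M.R\<^esub> reflection_map L M f y"
      using * clM[OF mt] by (simp add: cl L.meet_class M.meet_class)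
    show "reflection_map L M f (x \<squnion>\<^bsub>L.R\<^esub> y) = reflection_map L M f x \<squnion>\<^bsub>M.R\<^esub> reflection_map L M f y"
      using * clM[OF jn] by (simp add: cl L.join_class M.join_class)
    show "reflection_map L M f (heyting_imp L.R x y) =
      heyting_imp M.R (reflection_map L M f x) (reflection_map L M f y)"
      using * clM[OF im] by (simp add: cl L.heyting_imp_class M.heyting_imp_class)
  next
    show "reflection_map L M f \<in> carrier L.R \<rightarrow> carrier M.R"
      using obtain_rep cl by (metis M.class_in_reflection Pi_I fc)
    show "reflection_map L M f \<top>\<^bsub>L.R\<^esub> = \<top>\<^bsub>M.R\<^esub>"
      using clM[OF tp] by (simp add: L.top_class M.top_class cl)
    show "reflection_map L M f \<bottom>\<^bsub>L.R\<^esub> = \<bottom>\<^bsub>M.R\<^esub>"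
      using clM[OF bt] by (simp add: L.bottom_class M.bottom_class cl)
  qed (use LR.lattice_axioms MR.lattice_axioms L.heyting_algebra_reflection
      M.heyting_algebra_reflection in simp_all)
  then show ?thesis
    by (simp add: heytpre_hom_def L.heyting_prealgebra M.heyting_prealgebra f)
qed


section \<open>Uniform truth in an arrow algebra\<close>

context set_universe
begin

text \<open>
  A universe has no pairing of its elements. A pair of elements of \<open>X\<close> is coded as in set theory by
  \<open>{{x}, {x, y}}\<close>, which lies in \<open>Pow (Pow X)\<close>, and power sets are represented by small sets.
\<close>

lemma small_relation_representable:
  assumes X: "small X" and R: "R \<subseteq> X \<times> X"
  shows "\<exists>W e. small (W :: 'u set) \<and> bij_betw e W R"
proof -
  obtain Y f where Y: "small Y" and f: "bij_betw f (Pow X) Y"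
    using small_Pow[OF X] eqpoll_sym unfolding eqpoll_def by blast
  obtain Z g where Z: "small Z" and g: "bij_betw g (Pow Y) Z"
    using small_Pow[OF Y] eqpoll_sym unfolding eqpoll_def by blast
  define pair where "pair = (\<lambda>(x, y). g {f {x}, f {x, y}})"
  (* Both bijections are injective, so a code determines the Kuratowski pair {{x}, {x, y}}. *)
  have "inj_on pair R"
  proof
    fix p q
    assume pq: "p \<in> R" "q \<in> R" and eq: "pair p = pair q"
    obtain x y x' y' where p: "p = (x, y)" "q = (x', y')" by (cases p, cases q) blast
    have in_X: "x \<in> X" "y \<in> X" "x' \<in> X" "y' \<in> X" using pq p R by auto
    then have "{{x}, {x, y}} \<in> Pow (Pow X)" "{{x'}, {x', y'}} \<in> Pow (Pow X)"
      by auto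
    moreover have "f ` {{x}, {x, y}} = f ` {{x'}, {x', y'}}"
    proof (rule inj_onD[OF bij_betw_imp_inj_on[OF g]])
      show "g (f ` {{x}, {x, y}}) = g (f ` {{x'}, {x', y'}})"
        using eq by (simp add: pair_def p)
    qed (use in_X f in \<open>auto simp: bij_betw_def\<close>)
    ultimately have "{{x}, {x, y}} = {{x'}, {x', y'}}"
      using inj_on_image_eq_iff[OF bij_betw_imp_inj_on[OF f]] by (metis PowD)
    then show "p = q"
      by (auto simp: p doubleton_eq_iff)
  qed
  then have "bij_betw pair R (pair ` R)"
    by (simp add: bij_betw_def)
  then have "bij_betw (inv_into R pair) (pair ` R) R"
    by (rule bij_betw_inv_into)
  moreover have "pair p \<in> Z" if "p \<in> R" for p
  proof -
    obtain x y where p: "p = (x, y)" "x \<in> X" "y \<in> X"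
      using \<open>p \<in> R\<close> R by (cases p) blast
    then have "{f {x}, f {x, y}} \<in> Pow Y"
      using bij_betwE[OF f] by auto
    then show ?thesis
      using bij_betwE[OF g] p(1) by (auto simp: pair_def)
  qed
  then have "small (pair ` R)"
    by (intro small_subset[OF Z]) blast
  ultimately show ?thesis
    by blast
qed

end

text \<open>
  Uniform truth of a family. The index type is arbitrary, so that families indexed by pairs are
  available although the universe \<open>'u\<close> has no pairing.
\<close>

definition holds :: "'u arrow_structure \<Rightarrow> 'i set \<Rightarrow> ('i \<Rightarrow> 'u) \<Rightarrow> bool" where
  "holds A J t \<longleftrightarrow> \<Sqinter>\<^bsub>A\<^esub> (t ` J) \<in> sep A"

locale arrow_logic = set_universe small + arrow_algebra small A
  for small :: "'u set \<Rightarrow> bool" and A :: "'u arrow_structure" (structure)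
begin

lemma inf_is_glb: "X \<subseteq> carrier A \<Longrightarrow> is_glb A (\<Sqinter>X) X"
  unfolding inf_def using meets_exist by (rule someI_ex)

lemma inf_closed [simp]: "X \<subseteq> carrier A \<Longrightarrow> \<Sqinter>X \<in> carrier A"
  using inf_is_glb by auto

lemma inf_lower: "\<lbrakk>X \<subseteq> carrier A; x \<in> X\<rbrakk> \<Longrightarrow> \<Sqinter>X \<sqsubseteq> x"
  using greatest_Lower_below[OF inf_is_glb] by blast

lemma inf_greatest:
  "\<lbrakk>X \<subseteq> carrier A; z \<in> carrier A; \<And>x. x \<in> X \<Longrightarrow> z \<sqsubseteq> x\<rbrakk> \<Longrightarrow> z \<sqsubseteq> \<Sqinter>X"
  by (rule greatest_le[OF inf_is_glb]) (auto intro: Lower_memI)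

declare arr_closed [simp]

lemma sep_carrier [simp]: "s \<in> sep A \<Longrightarrow> s \<in> carrier A"
  using sep_subset by blast

lemma holds_if_above_sep:
  assumes "s \<in> sep A" "\<And>j. j \<in> J \<Longrightarrow> t j \<in> carrier A" "\<And>j. j \<in> J \<Longrightarrow> s \<sqsubseteq> t j"
  shows "holds A J t"
  unfolding holds_def
  by (rule sep_upward[OF assms(1)]) (use assms in \<open>auto intro!: inf_closed inf_greatest\<close>)

lemma holds_mono:
  assumes "holds A K u" "\<And>k. k \<in> K \<Longrightarrow> u k \<in> carrier A" "\<And>j. j \<in> J \<Longrightarrow> t j \<in> carrier A"
    and "\<And>j. j \<in> J \<Longrightarrow> \<exists>k\<in>K. u k \<sqsubseteq> t j"
  shows "holds A J t"
proof (rule holds_if_above_sep)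
  show "\<Sqinter>(u ` K) \<in> sep A"
    using assms(1) by (simp add: holds_def)
  fix j assume j: "j \<in> J"
  then obtain k where k: "k \<in> K" "u k \<sqsubseteq> t j"
    using assms(4) by blast
  have "\<Sqinter>(u ` K) \<sqsubseteq> u k"
    using assms(2) k by (intro inf_lower) auto
  then show "\<Sqinter>(u ` K) \<sqsubseteq> t j"
    using k assms(2) assms(3)[OF j] by (meson image_subsetI inf_closed le_trans)
qed (use assms in simp)

lemma holds_reindex:
  assumes "holds A K u" "\<And>k. k \<in> K \<Longrightarrow> u k \<in> carrier A" "\<And>j. j \<in> J \<Longrightarrow> f j \<in> K"
  shows "holds A J (\<lambda>j. u (f j))"
proof (rule holds_mono[OF assms(1)])
  show "\<exists>k\<in>K. u k \<sqsubseteq> u (f j)" if "j \<in> J" for j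
    using assms(2,3) that le_refl by blast
qed (use assms in auto)

lemma holds_sep: "s \<in> sep A \<Longrightarrow> holds A J (\<lambda>_. s)"
  by (rule holds_if_above_sep) auto

lemma holds_member:
  assumes "holds A J t" "\<And>j. j \<in> J \<Longrightarrow> t j \<in> carrier A" "j \<in> J"
  shows "t j \<in> sep A"
  using assms by (metis holds_def image_eqI image_subsetI inf_lower sep_upward)

lemma holds_K:
  assumes "\<And>j. j \<in> J \<Longrightarrow> x j \<in> carrier A" "\<And>j. j \<in> J \<Longrightarrow> y j \<in> carrier A"
  shows "holds A J (\<lambda>j. x j \<leadsto> y j \<leadsto> x j)"
proof (rule holds_if_above_sep[OF sep_k])
  show "comb_k A \<sqsubseteq> x j \<leadsto> y j \<leadsto> x j" if "j \<in> J" for j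
    unfolding comb_k_def by (rule inf_lower) (use assms that in \<open>auto, blast\<close>)
qed (use assms in auto)

lemma holds_S:
  assumes "\<And>j. j \<in> J \<Longrightarrow> x j \<in> carrier A" "\<And>j. j \<in> J \<Longrightarrow> y j \<in> carrier A"
    "\<And>j. j \<in> J \<Longrightarrow> z j \<in> carrier A"
  shows "holds A J (\<lambda>j. (x j \<leadsto> y j \<leadsto> z j) \<leadsto> (x j \<leadsto> y j) \<leadsto> x j \<leadsto> z j)"
proof (rule holds_if_above_sep[OF sep_s])
  show "comb_s A \<sqsubseteq> (x j \<leadsto> y j \<leadsto> z j) \<leadsto> (x j \<leadsto> y j) \<leadsto> x j \<leadsto> z j" if "j \<in> J" for j
    unfolding comb_s_def by (rule inf_lower) (use assms that in \<open>auto, blast\<close>)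
qed (use assms in auto)

text \<open>
  In \<^const>\<open>comb_a\<close> the families are indexed by small subsets of \<open>'u\<close>. This is no restriction: a
  meet of implications depends only on the set of pairs involved, a subset of
  \<open>carrier A \<times> carrier A\<close>, which some small set represents.
\<close>

lemma comb_a_le:
  assumes a: "a \<in> carrier A" and b: "\<And>k. k \<in> K \<Longrightarrow> b k \<in> carrier A"
    and c: "\<And>k. k \<in> K \<Longrightarrow> c k \<in> carrier A"
  shows "comb_a small A \<sqsubseteq>
    \<Sqinter>((\<lambda>k. a \<leadsto> b k \<leadsto> c k) ` K) \<leadsto> a \<leadsto> \<Sqinter>((\<lambda>k. b k \<leadsto> c k) ` K)"
proof -
  let ?R = "(\<lambda>k. (b k, c k)) ` K"
  obtain W e where W: "small W" and e: "bij_betw e W ?R"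
    using small_relation_representable[OF carrier_small, of ?R] b c by blast
  have img: "(\<lambda>k. F (b k) (c k)) ` K = {F (fst (e i)) (snd (e i)) | i. i \<in> W}" for F
  proof -
    have "(\<lambda>k. F (b k) (c k)) ` K = case_prod F ` ?R"
      by (simp add: image_image)
    also have "\<dots> = case_prod F ` e ` W"
      using e by (simp add: bij_betw_def)
    finally show ?thesis
      by (auto simp: image_image case_prod_beta)
  qed
  have e_closed: "fst (e i) \<in> carrier A" "snd (e i) \<in> carrier A" if "i \<in> W" for i
  proof -
    have "e i \<in> ?R"
      using bij_betwE[OF e] that by blast
    then show "fst (e i) \<in> carrier A" "snd (e i) \<in> carrier A"
      using b c by auto
  qed
  show ?thesis
    unfolding comb_a_def img[of "\<lambda>u v. a \<leadsto> u \<leadsto> v"] img[of "\<lambda>u v. u \<leadsto> v"]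
  proof (rule inf_lower)
    show "{\<Sqinter>{a \<leadsto> b i \<leadsto> c i |i. i \<in> I} \<leadsto> a \<leadsto> \<Sqinter>{b i \<leadsto> c i |i. i \<in> I} |a I b c.
      a \<in> carrier A \<and> small I \<and> b \<in> I \<rightarrow> carrier A \<and> c \<in> I \<rightarrow> carrier A} \<subseteq> carrier A"
      by (clarify, intro arr_closed inf_closed) (auto intro!: arr_closed)
  next
    show "\<Sqinter>{a \<leadsto> fst (e i) \<leadsto> snd (e i) |i. i \<in> W} \<leadsto> a \<leadsto> \<Sqinter>{fst (e i) \<leadsto> snd (e i) |i. i \<in> W}
      \<in> {\<Sqinter>{a \<leadsto> b i \<leadsto> c i |i. i \<in> I} \<leadsto> a \<leadsto> \<Sqinter>{b i \<leadsto> c i |i. i \<in> I} |a I b c.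
          a \<in> carrier A \<and> small I \<and> b \<in> I \<rightarrow> carrier A \<and> c \<in> I \<rightarrow> carrier A}"
      unfolding mem_Collect_eq
      by (rule exI[of _ a], rule exI[of _ W], rule exI[of _ "\<lambda>i. fst (e i)"],
          rule exI[of _ "\<lambda>i. snd (e i)"]) (use a W e_closed in auto)
  qed
qed

text \<open>
  Modus ponens for families. The meet \<open>u\<close> of the true premises \<open>x j\<close> lies below each of them, so by
  antitonicity the single element \<open>u\<close> can replace them all; the combinator \<open>a\<close> then moves the meet over
  \<open>j\<close> past the premise \<open>u\<close>. It only does so if the conclusions are implications: in general
  a meet of arbitrary conclusions need not be in the separator.
\<close>

lemma holds_mp:
  assumes f: "holds A J (\<lambda>j. x j \<leadsto> y j \<leadsto> z j)" and x: "holds A J x"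
    and closed: "\<And>j. j \<in> J \<Longrightarrow> x j \<in> carrier A" "\<And>j. j \<in> J \<Longrightarrow> y j \<in> carrier A"
      "\<And>j. j \<in> J \<Longrightarrow> z j \<in> carrier A"
  shows "holds A J (\<lambda>j. y j \<leadsto> z j)"
proof -
  let ?u = "\<Sqinter>(x ` J)" and ?v = "\<Sqinter>((\<lambda>j. \<Sqinter>(x ` J) \<leadsto> y j \<leadsto> z j) ` J)"
    and ?w = "\<Sqinter>((\<lambda>j. y j \<leadsto> z j) ` J)"
  have u: "?u \<in> sep A" "?u \<in> carrier A"
    using x by (auto simp: holds_def)
  have "holds A J (\<lambda>j. ?u \<leadsto> y j \<leadsto> z j)"
  proof (rule holds_mono[OF f])
    fix j assume j: "j \<in> J"
    have "?u \<sqsubseteq> x j"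
      using closed(1) j by (intro inf_lower) auto
    then have "x j \<leadsto> y j \<leadsto> z j \<sqsubseteq> ?u \<leadsto> y j \<leadsto> z j"
      using j u closed by (intro arr_mono) auto
    then show "\<exists>k\<in>J. x k \<leadsto> y k \<leadsto> z k \<sqsubseteq> ?u \<leadsto> y j \<leadsto> z j"
      using j by blast
  qed (use u closed in auto)
  then have v: "?v \<in> sep A"
    by (simp add: holds_def)
  have w: "?w \<in> carrier A"
    using closed by (auto intro!: inf_closed)
  have "?v \<leadsto> ?u \<leadsto> ?w \<in> sep A"
    by (rule sep_upward[OF sep_a]) (use u v w closed in \<open>auto intro!: comb_a_le\<close>)
  then have "?u \<leadsto> ?w \<in> sep A"
    by (rule sep_mp[rotated 2]) (use u v w in auto)
  then have "?w \<in> sep A"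
    by (rule sep_mp[rotated 2]) (use u w in auto)
  then show ?thesis
    by (simp add: holds_def)
qed

text \<open>
  The usual derivation of \<open>s k k\<close>. It goes through for families because every conclusion in it is an
  implication, and the same is true of the derivations of the combinators below.
\<close>

lemma holds_I:
  assumes "\<And>j. j \<in> J \<Longrightarrow> x j \<in> carrier A"
  shows "holds A J (\<lambda>j. x j \<leadsto> x j)"
proof -
  have "holds A J (\<lambda>j. (x j \<leadsto> x j \<leadsto> x j) \<leadsto> x j \<leadsto> x j)"
    by (rule holds_mp[OF holds_S[of J x "\<lambda>j. x j \<leadsto> x j" x] holds_K]) (use assms in auto)
  then show ?thesis
    by (rule holds_mp[OF _ holds_K]) (use assms in auto)
qed

lemma holds_le:
  assumes "\<And>j. j \<in> J \<Longrightarrow> x j \<in> carrier A" "\<And>j. j \<in> J \<Longrightarrow> y j \<in> carrier A"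
    "\<And>j. j \<in> J \<Longrightarrow> x j \<sqsubseteq> y j"
  shows "holds A J (\<lambda>j. x j \<leadsto> y j)"
proof (rule holds_mono[OF holds_I[of J x]])
  show "\<exists>k\<in>J. x k \<leadsto> x k \<sqsubseteq> x j \<leadsto> y j" if "j \<in> J" for j
    using that assms by (intro bexI[of _ j] arr_mono) auto
qed (use assms in auto)

lemma holds_weaken:
  assumes "holds A J (\<lambda>j. x j \<leadsto> y j)" "\<And>j. j \<in> J \<Longrightarrow> g j \<in> carrier A"
    "\<And>j. j \<in> J \<Longrightarrow> x j \<in> carrier A" "\<And>j. j \<in> J \<Longrightarrow> y j \<in> carrier A"
  shows "holds A J (\<lambda>j. g j \<leadsto> x j \<leadsto> y j)"
  by (rule holds_mp[OF holds_K assms(1)]) (use assms in auto)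

lemma holds_mp_under:
  assumes "holds A J (\<lambda>j. g j \<leadsto> x j \<leadsto> y j)" "holds A J (\<lambda>j. g j \<leadsto> x j)"
    "\<And>j. j \<in> J \<Longrightarrow> g j \<in> carrier A" "\<And>j. j \<in> J \<Longrightarrow> x j \<in> carrier A"
    "\<And>j. j \<in> J \<Longrightarrow> y j \<in> carrier A"
  shows "holds A J (\<lambda>j. g j \<leadsto> y j)"
proof -
  have "holds A J (\<lambda>j. (g j \<leadsto> x j) \<leadsto> g j \<leadsto> y j)"
    by (rule holds_mp[OF holds_S assms(1)]) (use assms in auto)
  then show ?thesis
    by (rule holds_mp[OF _ assms(2)]) (use assms in auto)
qed

lemma holds_trans:
  assumes "holds A J (\<lambda>j. x j \<leadsto> y j)" "holds A J (\<lambda>j. y j \<leadsto> z j)"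
    "\<And>j. j \<in> J \<Longrightarrow> x j \<in> carrier A" "\<And>j. j \<in> J \<Longrightarrow> y j \<in> carrier A"
    "\<And>j. j \<in> J \<Longrightarrow> z j \<in> carrier A"
  shows "holds A J (\<lambda>j. x j \<leadsto> z j)"
  by (rule holds_mp_under[OF holds_weaken[OF assms(2)] assms(1)]) (use assms in auto)

lemma holds_B:
  assumes "\<And>j. j \<in> J \<Longrightarrow> x j \<in> carrier A" "\<And>j. j \<in> J \<Longrightarrow> y j \<in> carrier A"
    "\<And>j. j \<in> J \<Longrightarrow> z j \<in> carrier A"
  shows "holds A J (\<lambda>j. (y j \<leadsto> z j) \<leadsto> (x j \<leadsto> y j) \<leadsto> x j \<leadsto> z j)"
  by (rule holds_trans[OF holds_K[of J "\<lambda>j. y j \<leadsto> z j" x] holds_S]) (use assms in auto)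

lemma holds_C:
  assumes "\<And>j. j \<in> J \<Longrightarrow> x j \<in> carrier A" "\<And>j. j \<in> J \<Longrightarrow> y j \<in> carrier A"
    "\<And>j. j \<in> J \<Longrightarrow> z j \<in> carrier A"
  shows "holds A J (\<lambda>j. (x j \<leadsto> y j \<leadsto> z j) \<leadsto> y j \<leadsto> x j \<leadsto> z j)"
proof -
  have "holds A J (\<lambda>j. (x j \<leadsto> y j \<leadsto> z j) \<leadsto> (y j \<leadsto> x j \<leadsto> y j) \<leadsto> y j \<leadsto> x j \<leadsto> z j)"
    by (rule holds_trans[OF holds_S holds_B]) (use assms in auto)
  then show ?thesis
    by (rule holds_mp_under[OF _ holds_weaken[OF holds_K]]) (use assms in auto)
qed

lemma holds_permute:
  assumes "holds A J (\<lambda>j. x j \<leadsto> y j \<leadsto> z j)"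
    "\<And>j. j \<in> J \<Longrightarrow> x j \<in> carrier A" "\<And>j. j \<in> J \<Longrightarrow> y j \<in> carrier A"
    "\<And>j. j \<in> J \<Longrightarrow> z j \<in> carrier A"
  shows "holds A J (\<lambda>j. y j \<leadsto> x j \<leadsto> z j)"
  by (rule holds_mp[OF holds_C assms(1)]) (use assms in auto)

lemma holds_eval:
  assumes "\<And>j. j \<in> J \<Longrightarrow> x j \<in> carrier A" "\<And>j. j \<in> J \<Longrightarrow> y j \<in> carrier A"
  shows "holds A J (\<lambda>j. x j \<leadsto> (x j \<leadsto> y j) \<leadsto> y j)"
  by (rule holds_permute[OF holds_I]) (use assms in auto)

lemma holds_apply:
  assumes "holds A J x" "\<And>j. j \<in> J \<Longrightarrow> x j \<in> carrier A" "\<And>j. j \<in> J \<Longrightarrow> y j \<in> carrier A"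
  shows "holds A J (\<lambda>j. (x j \<leadsto> y j) \<leadsto> y j)"
  by (rule holds_mp[OF holds_eval assms(1)]) (use assms in auto)

lemma holds_trans_under:
  assumes "holds A J (\<lambda>j. g j \<leadsto> x j \<leadsto> y j)" "holds A J (\<lambda>j. y j \<leadsto> z j)"
    "\<And>j. j \<in> J \<Longrightarrow> g j \<in> carrier A" "\<And>j. j \<in> J \<Longrightarrow> x j \<in> carrier A"
    "\<And>j. j \<in> J \<Longrightarrow> y j \<in> carrier A" "\<And>j. j \<in> J \<Longrightarrow> z j \<in> carrier A"
  shows "holds A J (\<lambda>j. g j \<leadsto> x j \<leadsto> z j)"
  by (rule holds_trans[OF assms(1) holds_mp[OF holds_B assms(2)]]) (use assms in auto)

text \<open>
  Introduction of a meet of implications, with the combinator \<open>a\<close> applied at each \<open>j\<close>. Taking the meet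
  inside costs nothing on the side of the premises, since a meet over pairs is below each of the
  iterated meets.
\<close>

lemma holds_Inf_intro:
  assumes "holds A (Sigma J K) (\<lambda>(j, k). g j \<leadsto> x j k \<leadsto> y j k)"
    and "\<And>j. j \<in> J \<Longrightarrow> g j \<in> carrier A" "\<And>j k. \<lbrakk>j \<in> J; k \<in> K j\<rbrakk> \<Longrightarrow> x j k \<in> carrier A"
    "\<And>j k. \<lbrakk>j \<in> J; k \<in> K j\<rbrakk> \<Longrightarrow> y j k \<in> carrier A"
  shows "holds A J (\<lambda>j. g j \<leadsto> \<Sqinter>((\<lambda>k. x j k \<leadsto> y j k) ` K j))"
proof -
  let ?u = "\<lambda>j. \<Sqinter>((\<lambda>k. g j \<leadsto> x j k \<leadsto> y j k) ` K j)"
  let ?w = "\<lambda>j. \<Sqinter>((\<lambda>k. x j k \<leadsto> y j k) ` K j)"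
  have u: "?u j \<in> carrier A" and w: "?w j \<in> carrier A" if "j \<in> J" for j
    using that assms by (auto intro!: inf_closed)
  have h: "holds A J ?u"
  proof (rule holds_if_above_sep)
    let ?s = "\<Sqinter>((\<lambda>(j, k). g j \<leadsto> x j k \<leadsto> y j k) ` Sigma J K)"
    show s: "?s \<in> sep A"
      using assms(1) by (simp add: holds_def)
    show "?s \<sqsubseteq> ?u j" if "j \<in> J" for j
      by (rule inf_greatest) (use that s assms in \<open>auto intro!: inf_lower image_eqI\<close>)
  qed (use u in auto)
  have "holds A J (\<lambda>j. ?u j \<leadsto> g j \<leadsto> ?w j)"
    by (rule holds_if_above_sep[OF sep_a]) (use u w assms in \<open>auto intro!: comb_a_le\<close>)
  then show ?thesis
    by (rule holds_mp[OF _ h]) (use u w assms(2) in auto)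
qed

lemma holds_Inf_elim:
  assumes "holds A J (\<lambda>j. g j \<leadsto> \<Sqinter>(X j))"
    and "\<And>j. j \<in> J \<Longrightarrow> g j \<in> carrier A" "\<And>j. j \<in> J \<Longrightarrow> X j \<subseteq> carrier A"
  shows "holds A (Sigma J X) (\<lambda>(j, x). g j \<leadsto> x)"
proof (rule holds_mono[OF assms(1)])
  fix p assume "p \<in> Sigma J X"
  then obtain j x where p: "p = (j, x)" "j \<in> J" "x \<in> X j" by auto
  have "g j \<leadsto> \<Sqinter>(X j) \<sqsubseteq> g j \<leadsto> x"
    using p assms inf_lower[of "X j" x] by (intro arr_mono) auto
  then show "\<exists>k\<in>J. g k \<leadsto> \<Sqinter>(X k) \<sqsubseteq> (case p of (j, x) \<Rightarrow> g j \<leadsto> x)"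
    using p by auto
qed (use assms in \<open>auto intro!: arr_closed dest: subsetD\<close>)

section \<open>Connectives and quantifiers\<close>

text \<open>
  The meet \<open>\<Sqinter>{a, b}\<close> is not a conjunction, since two families can be true without having a common
  realizer. Conjunction, disjunction and existential quantification are defined by their elimination
  rules instead, with a meet over all conclusions \<open>c\<close>. The meet \<open>\<Sqinter>X\<close> does express universal
  quantification, but only over implications, so \<open>x\<close> is replaced by the equivalent \<open>tt \<leadsto> x\<close>.
  The least and the greatest element serve as \<open>ff\<close> and \<open>tt\<close> because \<open>a \<sqsubseteq> b\<close> implies that
  \<open>a \<leadsto> b\<close> is true.
\<close>

definition tt where "tt = \<Sqinter>{}"
definition ff where "ff = \<Sqinter>(carrier A)"
definition conj (infixr \<open>\<otimes>\<close> 65) where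
  "a \<otimes> b = \<Sqinter>((\<lambda>c. (a \<leadsto> b \<leadsto> c) \<leadsto> c) ` carrier A)"
definition disj (infixr \<open>\<oplus>\<close> 65) where
  "a \<oplus> b = \<Sqinter>((\<lambda>c. (a \<leadsto> c) \<leadsto> (b \<leadsto> c) \<leadsto> c) ` carrier A)"
definition all where "all X = \<Sqinter>((\<lambda>x. tt \<leadsto> x) ` X)"
definition ex where "ex X = \<Sqinter>((\<lambda>c. \<Sqinter>((\<lambda>x. x \<leadsto> c) ` X) \<leadsto> c) ` carrier A)"

lemma tt_closed [simp]: "tt \<in> carrier A"
  and ff_closed [simp]: "ff \<in> carrier A"
  by (simp_all add: tt_def ff_def)

lemma conj_closed [simp]: "\<lbrakk>a \<in> carrier A; b \<in> carrier A\<rbrakk> \<Longrightarrow> a \<otimes> b \<in> carrier A"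
  unfolding conj_def by (rule inf_closed) auto

lemma disj_closed [simp]: "\<lbrakk>a \<in> carrier A; b \<in> carrier A\<rbrakk> \<Longrightarrow> a \<oplus> b \<in> carrier A"
  unfolding disj_def by (rule inf_closed) auto

lemma all_closed [simp]: "X \<subseteq> carrier A \<Longrightarrow> all X \<in> carrier A"
  unfolding all_def by (rule inf_closed) auto

lemma ex_body_closed: "\<lbrakk>X \<subseteq> carrier A; c \<in> carrier A\<rbrakk> \<Longrightarrow> \<Sqinter>((\<lambda>x. x \<leadsto> c) ` X) \<in> carrier A"
  by (rule inf_closed) auto

lemma ex_closed [simp]: "X \<subseteq> carrier A \<Longrightarrow> ex X \<in> carrier A"
  unfolding ex_def by (rule inf_closed) (auto intro!: arr_closed ex_body_closed)

lemma tt_sep [simp]: "tt \<in> sep A"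
  unfolding tt_def by (rule sep_upward[OF sep_k]) (auto intro!: inf_greatest simp: sep_k)

lemma holds_tt:
  "(\<And>j. j \<in> J \<Longrightarrow> x j \<in> carrier A) \<Longrightarrow> holds A J (\<lambda>j. x j \<leadsto> tt)"
  by (rule holds_le) (auto simp: tt_def intro: inf_greatest)

lemma holds_ff:
  "(\<And>j. j \<in> J \<Longrightarrow> x j \<in> carrier A) \<Longrightarrow> holds A J (\<lambda>j. ff \<leadsto> x j)"
  by (rule holds_le) (auto simp: ff_def intro: inf_lower)

lemma conj_le:
  assumes "a \<in> carrier A" "b \<in> carrier A" "c \<in> carrier A"
  shows "a \<otimes> b \<sqsubseteq> (a \<leadsto> b \<leadsto> c) \<leadsto> c"
  unfolding conj_def by (rule inf_lower) (use assms in auto)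

lemma disj_le:
  assumes "a \<in> carrier A" "b \<in> carrier A" "c \<in> carrier A"
  shows "a \<oplus> b \<sqsubseteq> (a \<leadsto> c) \<leadsto> (b \<leadsto> c) \<leadsto> c"
  unfolding disj_def by (rule inf_lower) (use assms in auto)

lemma ex_le:
  assumes "X \<subseteq> carrier A" "c \<in> carrier A"
  shows "ex X \<sqsubseteq> \<Sqinter>((\<lambda>x. x \<leadsto> c) ` X) \<leadsto> c"
  unfolding ex_def
  by (rule inf_lower) (use assms in \<open>auto intro!: arr_closed ex_body_closed\<close>)

lemma holds_fst:
  assumes "\<And>j. j \<in> J \<Longrightarrow> a j \<in> carrier A" "\<And>j. j \<in> J \<Longrightarrow> b j \<in> carrier A"
  shows "holds A J (\<lambda>j. a j \<otimes> b j \<leadsto> a j)"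
proof (rule holds_trans)
  show "holds A J (\<lambda>j. a j \<otimes> b j \<leadsto> (a j \<leadsto> b j \<leadsto> a j) \<leadsto> a j)"
    by (rule holds_le) (use assms conj_le in auto)
  show "holds A J (\<lambda>j. ((a j \<leadsto> b j \<leadsto> a j) \<leadsto> a j) \<leadsto> a j)"
    by (rule holds_apply[OF holds_K]) (use assms in auto)
qed (use assms in auto)

lemma holds_snd:
  assumes "\<And>j. j \<in> J \<Longrightarrow> a j \<in> carrier A" "\<And>j. j \<in> J \<Longrightarrow> b j \<in> carrier A"
  shows "holds A J (\<lambda>j. a j \<otimes> b j \<leadsto> b j)"
proof (rule holds_trans)
  show "holds A J (\<lambda>j. a j \<otimes> b j \<leadsto> (a j \<leadsto> b j \<leadsto> b j) \<leadsto> b j)"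
    by (rule holds_le) (use assms conj_le in auto)
  show "holds A J (\<lambda>j. ((a j \<leadsto> b j \<leadsto> b j) \<leadsto> b j) \<leadsto> b j)"
    by (rule holds_apply[OF holds_weaken[OF holds_I]]) (use assms in auto)
qed (use assms in auto)

text \<open>
  The meet over \<open>c\<close> in the definition of \<open>a \<otimes> b\<close> stands under the two premises \<open>a\<close> and \<open>b\<close>. It passes
  \<open>a\<close> by the introduction rule for meets, and \<open>b\<close> because the combinator \<open>a\<close> is itself a true
  implication. For the family over pairs \<open>(j, c)\<close> the statement is a permutation of
  \<open>(a \<leadsto> b \<leadsto> c) \<leadsto> a \<leadsto> b \<leadsto> c\<close>.
\<close>

lemma holds_pair:
  assumes a: "\<And>j. j \<in> J \<Longrightarrow> a j \<in> carrier A" and b: "\<And>j. j \<in> J \<Longrightarrow> b j \<in> carrier A"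
  shows "holds A J (\<lambda>j. a j \<leadsto> b j \<leadsto> a j \<otimes> b j)"
proof -
  let ?P = "Sigma J (\<lambda>_. carrier A)"
  let ?f = "\<lambda>p. a (fst p) \<leadsto> b (fst p) \<leadsto> snd p"
  let ?m = "\<lambda>j. \<Sqinter>((\<lambda>c. b j \<leadsto> (a j \<leadsto> b j \<leadsto> c) \<leadsto> c) ` carrier A)"
  have m: "?m j \<in> carrier A" if "j \<in> J" for j
    using that assms by (auto intro!: inf_closed)
  have "holds A ?P (\<lambda>p. ?f p \<leadsto> a (fst p) \<leadsto> b (fst p) \<leadsto> snd p)"
    by (rule holds_I) (use assms in auto)
  then have "holds A ?P (\<lambda>p. a (fst p) \<leadsto> ?f p \<leadsto> b (fst p) \<leadsto> snd p)"
    by (rule holds_permute) (use assms in auto)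
  then have "holds A ?P (\<lambda>p. a (fst p) \<leadsto> b (fst p) \<leadsto> ?f p \<leadsto> snd p)"
    by (rule holds_trans[OF _ holds_C]) (use assms in auto)
  then have "holds A ?P (\<lambda>(j, c). a j \<leadsto> b j \<leadsto> (a j \<leadsto> b j \<leadsto> c) \<leadsto> c)"
    by (simp add: case_prod_unfold)
  then have "holds A J (\<lambda>j. a j \<leadsto> ?m j)"
    by (rule holds_Inf_intro) (use assms in auto)
  moreover have "holds A J (\<lambda>j. ?m j \<leadsto> b j \<leadsto> a j \<otimes> b j)"
    unfolding conj_def
    by (rule holds_if_above_sep[OF sep_a])
      (use m assms in \<open>auto intro!: comb_a_le arr_closed inf_closed\<close>)
  ultimately show ?thesis
    by (rule holds_trans) (simp_all only: m assms arr_closed conj_closed)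
qed

lemma holds_conj_iff:
  assumes "\<And>j. j \<in> J \<Longrightarrow> a j \<in> carrier A" "\<And>j. j \<in> J \<Longrightarrow> b j \<in> carrier A"
    "\<And>j. j \<in> J \<Longrightarrow> g j \<in> carrier A"
  shows "holds A J (\<lambda>j. g j \<leadsto> a j \<otimes> b j) \<longleftrightarrow>
    holds A J (\<lambda>j. g j \<leadsto> a j) \<and> holds A J (\<lambda>j. g j \<leadsto> b j)" (is "?L \<longleftrightarrow> ?A \<and> ?B")
proof (intro iffI conjI)
  assume L: ?L
  show ?A by (rule holds_trans[OF L holds_fst[of J a b]]) (use assms in auto)
  show ?B by (rule holds_trans[OF L holds_snd[of J a b]]) (use assms in auto)
next
  assume AB: "?A \<and> ?B"
  have "holds A J (\<lambda>j. g j \<leadsto> b j \<leadsto> a j \<otimes> b j)"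
    by (rule holds_trans[OF conjunct1[OF AB] holds_pair]) (use assms in auto)
  then show ?L
    by (rule holds_mp_under[OF _ conjunct2[OF AB]]) (use assms in auto)
qed

lemma holds_arr_iff:
  assumes "\<And>j. j \<in> J \<Longrightarrow> a j \<in> carrier A" "\<And>j. j \<in> J \<Longrightarrow> b j \<in> carrier A"
    "\<And>j. j \<in> J \<Longrightarrow> c j \<in> carrier A"
  shows "holds A J (\<lambda>j. a j \<leadsto> b j \<leadsto> c j) \<longleftrightarrow> holds A J (\<lambda>j. a j \<otimes> b j \<leadsto> c j)"
    (is "?L \<longleftrightarrow> ?R")
proof
  assume L: ?L
  have "holds A J (\<lambda>j. a j \<otimes> b j \<leadsto> b j \<leadsto> c j)"
    by (rule holds_trans[OF holds_fst[of J a b] L]) (use assms(1-3) in auto)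
  then show ?R
    by (rule holds_mp_under[OF _ holds_snd[of J a b]]) (use assms(1-3) in auto)
next
  assume R: ?R
  show ?L
    by (rule holds_trans_under[OF holds_pair[of J a b] R]) (use assms(1-3) in auto)
qed

lemma holds_disj_iff:
  assumes "\<And>j. j \<in> J \<Longrightarrow> a j \<in> carrier A" "\<And>j. j \<in> J \<Longrightarrow> b j \<in> carrier A"
    "\<And>j. j \<in> J \<Longrightarrow> y j \<in> carrier A"
  shows "holds A J (\<lambda>j. a j \<oplus> b j \<leadsto> y j) \<longleftrightarrow>
    holds A J (\<lambda>j. a j \<leadsto> y j) \<and> holds A J (\<lambda>j. b j \<leadsto> y j)" (is "?L \<longleftrightarrow> ?A \<and> ?B")
proof (intro iffI conjI)
  let ?P = "Sigma J (\<lambda>_. carrier A)"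
  have inl: "holds A J (\<lambda>j. a j \<leadsto> a j \<oplus> b j)"
    unfolding disj_def
  proof (rule holds_Inf_intro)
    have "holds A ?P (\<lambda>p. a (fst p) \<leadsto> (a (fst p) \<leadsto> snd p) \<leadsto> (b (fst p) \<leadsto> snd p) \<leadsto> snd p)"
      by (rule holds_trans_under[OF holds_eval holds_K]) (use assms in auto)
    then show "holds A ?P (\<lambda>(j, c). a j \<leadsto> (a j \<leadsto> c) \<leadsto> (b j \<leadsto> c) \<leadsto> c)"
      by (simp add: case_prod_unfold)
  qed (use assms in auto)
  have inr: "holds A J (\<lambda>j. b j \<leadsto> a j \<oplus> b j)"
    unfolding disj_def
  proof (rule holds_Inf_intro)
    have "holds A ?P (\<lambda>p. b (fst p) \<leadsto> (a (fst p) \<leadsto> snd p) \<leadsto> (b (fst p) \<leadsto> snd p) \<leadsto> snd p)"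
      by (rule holds_trans[OF holds_eval holds_K]) (use assms in auto)
    then show "holds A ?P (\<lambda>(j, c). b j \<leadsto> (a j \<leadsto> c) \<leadsto> (b j \<leadsto> c) \<leadsto> c)"
      by (simp add: case_prod_unfold)
  qed (use assms in auto)
  assume ?L
  show ?A by (rule holds_trans[OF inl \<open>?L\<close>]) (use assms in auto)
  show ?B by (rule holds_trans[OF inr \<open>?L\<close>]) (use assms in auto)
next
  assume "?A \<and> ?B"
  then have ?A ?B by auto
  have "holds A J (\<lambda>j. a j \<oplus> b j \<leadsto> (a j \<leadsto> y j) \<leadsto> (b j \<leadsto> y j) \<leadsto> y j)"
    by (rule holds_le) (use assms disj_le in auto)
  then have "holds A J (\<lambda>j. a j \<oplus> b j \<leadsto> (b j \<leadsto> y j) \<leadsto> y j)"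
    by (rule holds_trans[OF _ holds_apply[OF \<open>?A\<close>]]) (use assms in auto)
  then show ?L
    by (rule holds_trans[OF _ holds_apply[OF \<open>?B\<close>]]) (use assms in auto)
qed

text \<open>
  Universal quantification over \<open>X j\<close> amounts to enlarging the index set from \<open>J\<close> to the pairs of \<open>j\<close>
  and an element of \<open>X j\<close>. In this form it gives the right adjoint to reindexing.
\<close>

lemma holds_all_iff:
  assumes g: "\<And>j. j \<in> J \<Longrightarrow> g j \<in> carrier A" and X: "\<And>j. j \<in> J \<Longrightarrow> X j \<subseteq> carrier A"
  shows "holds A J (\<lambda>j. g j \<leadsto> all (X j)) \<longleftrightarrow> holds A (Sigma J X) (\<lambda>(j, x). g j \<leadsto> x)"
    (is "?L \<longleftrightarrow> ?R")
proof
  have closed: "g (fst p) \<in> carrier A" "snd p \<in> carrier A" if "p \<in> Sigma J X" for p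
    using that g X by fastforce+
  {
    assume ?L
    have "holds A (Sigma J X) (\<lambda>p. g (fst p) \<leadsto> tt \<leadsto> snd p)"
    proof (rule holds_mono[OF holds_Inf_elim[OF \<open>?L\<close>[unfolded all_def]]])
      show "\<exists>q\<in>Sigma J (\<lambda>j. (\<lambda>x. tt \<leadsto> x) ` X j).
          (case q of (j, x) \<Rightarrow> g j \<leadsto> x) \<sqsubseteq> g (fst p) \<leadsto> tt \<leadsto> snd p"
        if "p \<in> Sigma J X" for p
        by (rule bexI[of _ "(fst p, tt \<leadsto> snd p)"]) (use that closed[OF that] in auto)
    qed (use g X closed in auto)
    then have "holds A (Sigma J X) (\<lambda>p. tt \<leadsto> g (fst p) \<leadsto> snd p)"
      by (rule holds_permute) (use closed in auto)
    then have "holds A (Sigma J X) (\<lambda>p. g (fst p) \<leadsto> snd p)"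
      by (rule holds_mp[OF _ holds_sep]) (use closed in auto)
    then show ?R
      by (simp add: case_prod_unfold)
  next
    assume ?R
    then have "holds A (Sigma J X) (\<lambda>p. g (fst p) \<leadsto> snd p)"
      by (simp add: case_prod_unfold)
    then have "holds A (Sigma J X) (\<lambda>p. g (fst p) \<leadsto> tt \<leadsto> snd p)"
      by (intro holds_permute[OF holds_weaken]) (use closed in auto)
    then have "holds A (Sigma J X) (\<lambda>(j, x). g j \<leadsto> tt \<leadsto> x)"
      by (simp add: case_prod_unfold)
    then show ?L
      unfolding all_def by (rule holds_Inf_intro) (use g X in auto)
  }
qed

text \<open>
  The dual rule, which gives the left adjoint to reindexing. The meet of the true family over pairs is
  below the premise \<open>\<Sqinter>(x \<leadsto> y j)\<close> of the instance \<open>c = y j\<close> of the encoding, so this premise can be discharged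
  for all \<open>j\<close> at once.
\<close>

lemma holds_ex_iff:
  assumes X: "\<And>j. j \<in> J \<Longrightarrow> X j \<subseteq> carrier A" and y: "\<And>j. j \<in> J \<Longrightarrow> y j \<in> carrier A"
  shows "holds A J (\<lambda>j. ex (X j) \<leadsto> y j) \<longleftrightarrow> holds A (Sigma J X) (\<lambda>(j, x). x \<leadsto> y j)"
    (is "?L \<longleftrightarrow> ?R")
proof
  have closed: "y (fst p) \<in> carrier A" "snd p \<in> carrier A" "X (fst p) \<subseteq> carrier A"
    if "p \<in> Sigma J X" for p
    using that y X by fastforce+
  {
    assume ?L
    let ?Q = "Sigma (Sigma J X) (\<lambda>_. carrier A)"
    let ?b = "\<lambda>p c. \<Sqinter>((\<lambda>x. x \<leadsto> c) ` X (fst p))"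
    have "holds A (Sigma J X) (\<lambda>p. snd p \<leadsto> ex (X (fst p)))"
      unfolding ex_def
    proof (rule holds_Inf_intro)
      have bq: "?b (fst q) (snd q) \<in> carrier A" if "q \<in> ?Q" for q
        using that closed[of "fst q"] by (intro ex_body_closed) auto
      have "holds A ?Q (\<lambda>q. ?b (fst q) (snd q) \<leadsto> snd (fst q) \<leadsto> snd q)"
      proof (rule holds_le[OF bq])
        fix q assume q: "q \<in> ?Q"
        show "?b (fst q) (snd q) \<sqsubseteq> snd (fst q) \<leadsto> snd q"
          by (rule inf_lower) (use q closed[of "fst q"] in \<open>auto intro!: arr_closed\<close>)
      qed (use closed in auto)
      then have "holds A ?Q (\<lambda>q. snd (fst q) \<leadsto> ?b (fst q) (snd q) \<leadsto> snd q)"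
        by (rule holds_permute) (use closed bq in auto)
      then show "holds A ?Q (\<lambda>(p, c). snd p \<leadsto> ?b p c \<leadsto> c)"
        by (simp add: case_prod_unfold)
    qed (use closed ex_body_closed in auto)
    moreover have "holds A (Sigma J X) (\<lambda>p. ex (X (fst p)) \<leadsto> y (fst p))"
      by (rule holds_reindex[OF \<open>?L\<close>]) (use X y in auto)
    ultimately have "holds A (Sigma J X) (\<lambda>p. snd p \<leadsto> y (fst p))"
      by (rule holds_trans) (use closed in auto)
    then show ?R
      by (simp add: case_prod_unfold)
  next
    assume ?R
    let ?b = "\<lambda>j. \<Sqinter>((\<lambda>x. x \<leadsto> y j) ` X j)"
    have b: "?b j \<in> carrier A" if "j \<in> J" for j
      using that X y ex_body_closed by blast
    have "holds A J ?b"
    proof (rule holds_if_above_sep)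
      let ?s = "\<Sqinter>((\<lambda>(j, x). x \<leadsto> y j) ` Sigma J X)"
      show s: "?s \<in> sep A"
        using \<open>?R\<close> by (simp add: holds_def)
      show "?s \<sqsubseteq> ?b j" if "j \<in> J" for j
      proof (rule inf_greatest)
        fix z assume "z \<in> (\<lambda>x. x \<leadsto> y j) ` X j"
        then obtain x where x: "x \<in> X j" "z = x \<leadsto> y j" by blast
        show "?s \<sqsubseteq> z"
        proof (rule inf_lower)
          show "z \<in> (\<lambda>(j, x). x \<leadsto> y j) ` Sigma J X"
            using x that by (intro image_eqI[of _ _ "(j, x)"]) auto
        qed (use X y in \<open>fastforce intro!: arr_closed\<close>)
      qed (use s X[OF that] y[OF that] in auto)
    qed (use b in auto)
    then have app: "holds A J (\<lambda>j. (?b j \<leadsto> y j) \<leadsto> y j)"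
      by (rule holds_apply) (use b y in auto)
    have "holds A J (\<lambda>j. ex (X j) \<leadsto> ?b j \<leadsto> y j)"
      by (rule holds_le)
        (use X y b ex_le in auto)
    then show ?L
      by (rule holds_trans[OF _ app]) (use X y b in auto)
  }
qed

end


section \<open>The arrow tripos\<close>

lemma holds_cong [cong]:
  "\<lbrakk>J = K; \<And>j. j \<in> K \<Longrightarrow> t j = u j\<rbrakk> \<Longrightarrow> holds A J t = holds A K u"
  by (simp add: holds_def cong: image_cong)

lemma holds_image_cong: "t ` J = u ` K \<Longrightarrow> holds A J t \<longleftrightarrow> holds A K u"
  by (simp add: holds_def)

lemma carrier_arrow_fibre [simp]: "carrier (fibre (arrow_tripos A) I) = I \<rightarrow>\<^sub>E carrier A"
  by (simp add: arrow_tripos_def preord_def)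

lemma le_arrow_fibre:
  "\<phi> \<sqsubseteq>\<^bsub>fibre (arrow_tripos A) I\<^esub> \<psi> \<longleftrightarrow> holds A I (\<lambda>i. \<phi> i \<leadsto>\<^bsub>A\<^esub> \<psi> i)"
  by (simp add: arrow_tripos_def preord_def holds_def setcompr_eq_image)

lemma reindex_arrow_tripos [simp]: "reindex (arrow_tripos A) I J f \<phi> = compose I \<phi> f"
  by (simp add: arrow_tripos_def)

lemma compose_in_fibre [simp]:
  "\<lbrakk>\<phi> \<in> J \<rightarrow>\<^sub>E X; f \<in> I \<rightarrow>\<^sub>E J\<rbrakk> \<Longrightarrow> compose I \<phi> f \<in> I \<rightarrow>\<^sub>E X"
  by (auto simp: compose_def)

lemma compose_PiE_Id [simp]: "\<phi> \<in> I \<rightarrow>\<^sub>E X \<Longrightarrow> compose I \<phi> (\<lambda>i\<in>I. i) = \<phi>"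
  by (rule compose_Id) (auto simp: PiE_def)

lemma Id_compose_PiE [simp]: "\<phi> \<in> I \<rightarrow>\<^sub>E X \<Longrightarrow> compose I (\<lambda>x\<in>X. x) \<phi> = \<phi>"
  by (rule Id_compose) (auto simp: PiE_def)

text \<open>
  For maps between preorders the adjunction alone implies that both of them are monotone.
\<close>

lemma adjoint_mapsI:
  assumes "weak_partial_order L" "weak_partial_order M"
    and f: "f \<in> carrier L \<rightarrow> carrier M" and g: "g \<in> carrier M \<rightarrow> carrier L"
    and adj: "\<And>x y. \<lbrakk>x \<in> carrier L; y \<in> carrier M\<rbrakk> \<Longrightarrow> f x \<sqsubseteq>\<^bsub>M\<^esub> y \<longleftrightarrow> x \<sqsubseteq>\<^bsub>L\<^esub> g y"
  shows "adjoint_maps L M f g"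
proof -
  interpret L: weak_partial_order L by fact
  interpret M: weak_partial_order M by fact
  have "f x \<sqsubseteq>\<^bsub>M\<^esub> f y" if "x \<in> carrier L" "y \<in> carrier L" "x \<sqsubseteq>\<^bsub>L\<^esub> y" for x y
  proof -
    have "f y \<in> carrier M" "g (f y) \<in> carrier L"
      using f g that by auto
    then have "y \<sqsubseteq>\<^bsub>L\<^esub> g (f y)"
      using adj[of y "f y"] that by blast
    then have "x \<sqsubseteq>\<^bsub>L\<^esub> g (f y)"
      by (rule L.le_trans[OF that(3)]) fact+
    then show ?thesis
      using adj[of x "f y"] that \<open>f y \<in> carrier M\<close> by blast
  qed
  moreover have "g x \<sqsubseteq>\<^bsub>L\<^esub> g y" if "x \<in> carrier M" "y \<in> carrier M" "x \<sqsubseteq>\<^bsub>M\<^esub> y" for x y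
  proof -
    have "g x \<in> carrier L" "f (g x) \<in> carrier M"
      using f g that by auto
    then have "f (g x) \<sqsubseteq>\<^bsub>M\<^esub> x"
      using adj[of "g x" x] that by blast
    then have "f (g x) \<sqsubseteq>\<^bsub>M\<^esub> y"
      by (rule M.le_trans[OF _ that(3)]) fact+
    then show ?thesis
      using adj[of "g x" y] that \<open>g x \<in> carrier L\<close> by blast
  qed
  ultimately show ?thesis
    unfolding adjoint_maps_def monotone_map_def isotone_def using assms by blast
qed

lemma pullback_square_commutes:
  assumes "pullback_square small W X Z Y p q f g" "w \<in> W"
  shows "f (p w) = g (q w)"
  using assms unfolding pullback_square_def by (metis compose_eq)

context arrow_logic
begin

definition "exists_along I J f \<phi> = (\<lambda>j\<in>J. ex (\<phi> ` {i \<in> I. f i = j}))"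
definition "forall_along I J f \<phi> = (\<lambda>j\<in>J. all (\<phi> ` {i \<in> I. f i = j}))"

lemma weak_partial_order_fibre: "weak_partial_order (fibre (arrow_tripos A) I)"
proof -
  have "weak_partial_order (preord (I \<rightarrow>\<^sub>E carrier A) (\<lambda>\<phi> \<psi>. holds A I (\<lambda>i. \<phi> i \<leadsto> \<psi> i)))"
  proof (rule weak_partial_order_preord)
    show "holds A I (\<lambda>i. \<phi> i \<leadsto> \<phi> i)" if "\<phi> \<in> I \<rightarrow>\<^sub>E carrier A" for \<phi>
      by (rule holds_I) (use that in auto)
    show "holds A I (\<lambda>i. \<phi> i \<leadsto> \<chi> i)"
      if "\<phi> \<in> I \<rightarrow>\<^sub>E carrier A" "\<psi> \<in> I \<rightarrow>\<^sub>E carrier A" "\<chi> \<in> I \<rightarrow>\<^sub>E carrier A"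
        "holds A I (\<lambda>i. \<phi> i \<leadsto> \<psi> i)" "holds A I (\<lambda>i. \<psi> i \<leadsto> \<chi> i)" for \<phi> \<psi> \<chi>
      by (rule holds_trans[OF that(4,5)]) (use that in auto)
  qed
  then show ?thesis
    by (simp add: arrow_tripos_def holds_def setcompr_eq_image)
qed

lemma eq_arrow_fibre:
  "\<phi> .=\<^bsub>fibre (arrow_tripos A) I\<^esub> \<psi> \<longleftrightarrow>
    \<phi> \<sqsubseteq>\<^bsub>fibre (arrow_tripos A) I\<^esub> \<psi> \<and> \<psi> \<sqsubseteq>\<^bsub>fibre (arrow_tripos A) I\<^esub> \<phi>"
  by (simp add: arrow_tripos_def preord_def)

lemma heyting_preorder_fibre:
  "heyting_preorder (fibre (arrow_tripos A) I) (\<lambda>i\<in>I. tt) (\<lambda>i\<in>I. ff)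
     (\<lambda>\<phi> \<psi>. \<lambda>i\<in>I. \<phi> i \<otimes> \<psi> i) (\<lambda>\<phi> \<psi>. \<lambda>i\<in>I. \<phi> i \<oplus> \<psi> i) (\<lambda>\<phi> \<psi>. \<lambda>i\<in>I. \<phi> i \<leadsto> \<psi> i)"
proof (rule heyting_preorder.intro[OF weak_partial_order_fibre], unfold_locales)
  fix \<phi> \<psi> \<chi>
  assume "\<phi> \<in> carrier (fibre (arrow_tripos A) I)" "\<psi> \<in> carrier (fibre (arrow_tripos A) I)"
    "\<chi> \<in> carrier (fibre (arrow_tripos A) I)"
  then have *: "\<And>i. i \<in> I \<Longrightarrow> \<phi> i \<in> carrier A" "\<And>i. i \<in> I \<Longrightarrow> \<psi> i \<in> carrier A"
    "\<And>i. i \<in> I \<Longrightarrow> \<chi> i \<in> carrier A"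
    by auto
  show "\<chi> \<sqsubseteq>\<^bsub>fibre (arrow_tripos A) I\<^esub> (\<lambda>i\<in>I. \<phi> i \<otimes> \<psi> i) \<longleftrightarrow>
    \<chi> \<sqsubseteq>\<^bsub>fibre (arrow_tripos A) I\<^esub> \<phi> \<and> \<chi> \<sqsubseteq>\<^bsub>fibre (arrow_tripos A) I\<^esub> \<psi>"
    using holds_conj_iff[of I \<phi> \<psi> \<chi>] * by (simp add: le_arrow_fibre)
  show "(\<lambda>i\<in>I. \<phi> i \<oplus> \<psi> i) \<sqsubseteq>\<^bsub>fibre (arrow_tripos A) I\<^esub> \<chi> \<longleftrightarrow>
    \<phi> \<sqsubseteq>\<^bsub>fibre (arrow_tripos A) I\<^esub> \<chi> \<and> \<psi> \<sqsubseteq>\<^bsub>fibre (arrow_tripos A) I\<^esub> \<chi>"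
    using holds_disj_iff[of I \<phi> \<psi> \<chi>] * by (simp add: le_arrow_fibre)
  show "\<chi> \<sqsubseteq>\<^bsub>fibre (arrow_tripos A) I\<^esub> (\<lambda>i\<in>I. \<phi> i \<leadsto> \<psi> i) \<longleftrightarrow>
    (\<lambda>i\<in>I. \<chi> i \<otimes> \<phi> i) \<sqsubseteq>\<^bsub>fibre (arrow_tripos A) I\<^esub> \<psi>"
    using holds_arr_iff[of I \<chi> \<phi> \<psi>] * by (simp add: le_arrow_fibre)
next
  fix \<phi> assume "\<phi> \<in> carrier (fibre (arrow_tripos A) I)"
  then have *: "\<And>i. i \<in> I \<Longrightarrow> \<phi> i \<in> carrier A"
    by auto
  show "\<phi> \<sqsubseteq>\<^bsub>fibre (arrow_tripos A) I\<^esub> (\<lambda>i\<in>I. tt)" "(\<lambda>i\<in>I. ff) \<sqsubseteq>\<^bsub>fibre (arrow_tripos A) I\<^esub> \<phi>"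
    using holds_tt[of I \<phi>] holds_ff[of I \<phi>] * by (simp_all add: le_arrow_fibre)
qed (auto intro!: arr_closed conj_closed disj_closed)

lemma monotone_reindex:
  assumes f: "f \<in> I \<rightarrow>\<^sub>E J"
  shows "monotone_map (fibre (arrow_tripos A) J) (fibre (arrow_tripos A) I)
    (reindex (arrow_tripos A) I J f)"
  unfolding monotone_map_def isotone_def
proof (intro conjI ballI impI weak_partial_order_fibre)
  fix \<phi> \<psi> assume *: "\<phi> \<in> carrier (fibre (arrow_tripos A) J)" "\<psi> \<in> carrier (fibre (arrow_tripos A) J)"
    and "\<phi> \<sqsubseteq>\<^bsub>fibre (arrow_tripos A) J\<^esub> \<psi>"
  then have le: "holds A J (\<lambda>j. \<phi> j \<leadsto> \<psi> j)"
    by (simp add: le_arrow_fibre)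
  have "holds A I (\<lambda>i. \<phi> (f i) \<leadsto> \<psi> (f i))"
    by (rule holds_reindex[OF le]) (use f * in \<open>auto intro!: arr_closed\<close>)
  then show "reindex (arrow_tripos A) I J f \<phi> \<sqsubseteq>\<^bsub>fibre (arrow_tripos A) I\<^esub>
      reindex (arrow_tripos A) I J f \<psi>"
    by (simp add: le_arrow_fibre compose_eq)
qed (use f in auto)

lemma reindex_heytpre_hom:
  assumes f: "f \<in> I \<rightarrow>\<^sub>E J"
  shows "heytpre_hom (fibre (arrow_tripos A) J) (fibre (arrow_tripos A) I)
    (reindex (arrow_tripos A) I J f)"
proof -
  interpret FI: weak_partial_order "fibre (arrow_tripos A) I"
    by (rule weak_partial_order_fibre)
  have eq: "\<phi> .=\<^bsub>fibre (arrow_tripos A) I\<^esub> \<psi>" if "\<phi> = \<psi>" "\<psi> \<in> I \<rightarrow>\<^sub>E carrier A" for \<phi> \<psi>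
    using that FI.refl[of \<psi>] by simp
  have f': "f i \<in> J" if "i \<in> I" for i
    using f that by auto
  show ?thesis
    by (rule heytpre_homI[OF heyting_preorder_fibre heyting_preorder_fibre monotone_reindex[OF f]];
        rule eq) (use f' in \<open>auto simp: compose_def PiE_mem intro!: arr_closed conj_closed disj_closed\<close>)
qed

lemma exists_along_in_fibre:
  "\<phi> \<in> I \<rightarrow>\<^sub>E carrier A \<Longrightarrow> exists_along I J f \<phi> \<in> J \<rightarrow>\<^sub>E carrier A"
  unfolding exists_along_def by (auto intro!: ex_closed)

lemma forall_along_in_fibre:
  "\<phi> \<in> I \<rightarrow>\<^sub>E carrier A \<Longrightarrow> forall_along I J f \<phi> \<in> J \<rightarrow>\<^sub>E carrier A"
  unfolding forall_along_def by (auto intro!: all_closed)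

lemma adjoint_exists_along:
  assumes f: "f \<in> I \<rightarrow>\<^sub>E J"
  shows "adjoint_maps (fibre (arrow_tripos A) I) (fibre (arrow_tripos A) J)
    (exists_along I J f) (reindex (arrow_tripos A) I J f)"
proof (rule adjoint_mapsI[OF weak_partial_order_fibre weak_partial_order_fibre])
  fix \<phi> \<psi> assume "\<phi> \<in> carrier (fibre (arrow_tripos A) I)" "\<psi> \<in> carrier (fibre (arrow_tripos A) J)"
  then have *: "\<And>i. i \<in> I \<Longrightarrow> \<phi> i \<in> carrier A" "\<And>j. j \<in> J \<Longrightarrow> \<psi> j \<in> carrier A"
    by auto
  let ?X = "\<lambda>j. \<phi> ` {i \<in> I. f i = j}"
  have "exists_along I J f \<phi> \<sqsubseteq>\<^bsub>fibre (arrow_tripos A) J\<^esub> \<psi> \<longleftrightarrow>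
      holds A J (\<lambda>j. ex (?X j) \<leadsto> \<psi> j)"
    by (simp add: le_arrow_fibre exists_along_def)
  also have "\<dots> \<longleftrightarrow> holds A (Sigma J ?X) (\<lambda>(j, x). x \<leadsto> \<psi> j)"
    by (rule holds_ex_iff) (use * in auto)
  also have "\<dots> \<longleftrightarrow> holds A I (\<lambda>i. \<phi> i \<leadsto> \<psi> (f i))"
    by (rule holds_image_cong) (use f in force)
  also have "\<dots> \<longleftrightarrow> \<phi> \<sqsubseteq>\<^bsub>fibre (arrow_tripos A) I\<^esub> reindex (arrow_tripos A) I J f \<psi>"
    by (simp add: le_arrow_fibre compose_eq)
  finally show "exists_along I J f \<phi> \<sqsubseteq>\<^bsub>fibre (arrow_tripos A) J\<^esub> \<psi> \<longleftrightarrow>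
    \<phi> \<sqsubseteq>\<^bsub>fibre (arrow_tripos A) I\<^esub> reindex (arrow_tripos A) I J f \<psi>" .
qed (simp_all add: Pi_iff f exists_along_in_fibre)

lemma adjoint_forall_along:
  assumes f: "f \<in> I \<rightarrow>\<^sub>E J"
  shows "adjoint_maps (fibre (arrow_tripos A) J) (fibre (arrow_tripos A) I)
    (reindex (arrow_tripos A) I J f) (forall_along I J f)"
proof (rule adjoint_mapsI[OF weak_partial_order_fibre weak_partial_order_fibre])
  fix \<psi> \<phi> assume "\<psi> \<in> carrier (fibre (arrow_tripos A) J)" "\<phi> \<in> carrier (fibre (arrow_tripos A) I)"
  then have *: "\<And>i. i \<in> I \<Longrightarrow> \<phi> i \<in> carrier A" "\<And>j. j \<in> J \<Longrightarrow> \<psi> j \<in> carrier A"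
    by auto
  let ?X = "\<lambda>j. \<phi> ` {i \<in> I. f i = j}"
  have "\<psi> \<sqsubseteq>\<^bsub>fibre (arrow_tripos A) J\<^esub> forall_along I J f \<phi> \<longleftrightarrow>
      holds A J (\<lambda>j. \<psi> j \<leadsto> all (?X j))"
    by (simp add: le_arrow_fibre forall_along_def)
  also have "\<dots> \<longleftrightarrow> holds A (Sigma J ?X) (\<lambda>(j, x). \<psi> j \<leadsto> x)"
    by (rule holds_all_iff) (use * in auto)
  also have "\<dots> \<longleftrightarrow> holds A I (\<lambda>i. \<psi> (f i) \<leadsto> \<phi> i)"
    by (rule holds_image_cong) (use f in force)
  also have "\<dots> \<longleftrightarrow> reindex (arrow_tripos A) I J f \<psi> \<sqsubseteq>\<^bsub>fibre (arrow_tripos A) I\<^esub> \<phi>"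
    by (simp add: le_arrow_fibre compose_eq)
  finally show "reindex (arrow_tripos A) I J f \<psi> \<sqsubseteq>\<^bsub>fibre (arrow_tripos A) I\<^esub> \<phi> \<longleftrightarrow>
    \<psi> \<sqsubseteq>\<^bsub>fibre (arrow_tripos A) J\<^esub> forall_along I J f \<phi>" by simp
qed (simp_all add: Pi_iff f forall_along_in_fibre)

text \<open>
  The universal property tested on a one-element set. It has to be an element of the universe that is
  used as the only point; \<open>x\<close> itself serves.
\<close>

lemma pullback_square_surjective:
  assumes sq: "pullback_square small W X Z Y p q f g"
    and "x \<in> X" "z \<in> Z" "f x = g z"
  shows "\<exists>w\<in>W. p w = x \<and> q w = z"
proof -
  let ?u = "\<lambda>_\<in>{x}. x" and ?v = "\<lambda>_\<in>{x}. z"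
  have "small {x}"
    using small_pair[of x x] by simp
  moreover have "?u \<in> {x} \<rightarrow>\<^sub>E X" "?v \<in> {x} \<rightarrow>\<^sub>E Z" "compose {x} f ?u = compose {x} g ?v"
    using assms(2-4) by (auto simp: compose_def)
  moreover have "\<forall>T u v. small T \<and> u \<in> T \<rightarrow>\<^sub>E X \<and> v \<in> T \<rightarrow>\<^sub>E Z \<and> compose T f u = compose T g v \<longrightarrow>
      (\<exists>!t. t \<in> T \<rightarrow>\<^sub>E W \<and> compose T p t = u \<and> compose T q t = v)"
    using sq unfolding pullback_square_def by simp
  ultimately have "\<exists>!t. t \<in> {x} \<rightarrow>\<^sub>E W \<and> compose {x} p t = ?u \<and> compose {x} q t = ?v"
    by (elim allE[of _ "{x}"] allE[of _ ?u] allE[of _ ?v]) simp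
  then obtain t where t: "t \<in> {x} \<rightarrow>\<^sub>E W" "compose {x} p t = ?u" "compose {x} q t = ?v"
    by (elim ex1E conjE)
  then have "p (t x) = x" "q (t x) = z"
    by (metis compose_eq restrict_apply' singletonI)+
  then show ?thesis
    using t(1) by blast
qed

text \<open>
  Both inequalities are checked against arbitrary adjoints. That \<open>l' (p\<^sup>* \<phi>) \<turnstile> g\<^sup>* (l \<phi>)\<close> holds for any
  commuting square, by the unit of \<open>l\<close>. For the converse, \<open>l\<close> is compared with existential
  quantification along \<open>f\<close>; what is left is an implication for each \<open>x\<close> and \<open>z\<close> with \<open>f x = g z\<close>,
  and such a pair is the image of some \<open>w\<close>, where the unit of \<open>l'\<close> gives it.
\<close>

lemma beck_chevalley_exists:
  assumes sq: "pullback_square small W X Z Y p q f g"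
    and l: "adjoint_maps (fibre (arrow_tripos A) X) (fibre (arrow_tripos A) Y) l
      (reindex (arrow_tripos A) X Y f)"
    and l': "adjoint_maps (fibre (arrow_tripos A) W) (fibre (arrow_tripos A) Z) l'
      (reindex (arrow_tripos A) W Z q)"
    and \<phi>: "\<phi> \<in> carrier (fibre (arrow_tripos A) X)"
  shows "l' (reindex (arrow_tripos A) W X p \<phi>) .=\<^bsub>fibre (arrow_tripos A) Z\<^esub>
    reindex (arrow_tripos A) Z Y g (l \<phi>)"
proof -
  have maps: "p \<in> W \<rightarrow>\<^sub>E X" "q \<in> W \<rightarrow>\<^sub>E Z" "f \<in> X \<rightarrow>\<^sub>E Y" "g \<in> Z \<rightarrow>\<^sub>E Y"
    using sq unfolding pullback_square_def by simp_all
  have adj: "holds A Y (\<lambda>y. l \<phi> y \<leadsto> \<psi> y) \<longleftrightarrow> holds A X (\<lambda>x. \<phi> x \<leadsto> \<psi> (f x))"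
    if "\<psi> \<in> Y \<rightarrow>\<^sub>E carrier A" for \<psi>
    using l \<phi> that by (simp add: adjoint_maps_def le_arrow_fibre compose_eq)
  define \<phi>' where "\<phi>' = compose W \<phi> p"
  have \<phi>': "\<phi>' \<in> W \<rightarrow>\<^sub>E carrier A"
    using \<phi> maps by (simp add: \<phi>'_def)
  have adj': "holds A Z (\<lambda>z. l' \<phi>' z \<leadsto> \<psi> z) \<longleftrightarrow> holds A W (\<lambda>w. \<phi> (p w) \<leadsto> \<psi> (q w))"
    if "\<psi> \<in> Z \<rightarrow>\<^sub>E carrier A" for \<psi>
    using l' \<phi>' that by (simp add: adjoint_maps_def le_arrow_fibre compose_eq \<phi>'_def)
  have l\<phi>: "l \<phi> \<in> Y \<rightarrow>\<^sub>E carrier A" and l'\<phi>': "l' \<phi>' \<in> Z \<rightarrow>\<^sub>E carrier A"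
    using l l' \<phi> \<phi>' by (auto simp: adjoint_maps_def monotone_map_def)
  have closed: "\<And>x. x \<in> X \<Longrightarrow> \<phi> x \<in> carrier A" "\<And>y. y \<in> Y \<Longrightarrow> l \<phi> y \<in> carrier A"
      "\<And>z. z \<in> Z \<Longrightarrow> l' \<phi>' z \<in> carrier A" "\<And>w. w \<in> W \<Longrightarrow> p w \<in> X" "\<And>w. w \<in> W \<Longrightarrow> q w \<in> Z"
      "\<And>x. x \<in> X \<Longrightarrow> f x \<in> Y" "\<And>z. z \<in> Z \<Longrightarrow> g z \<in> Y"
    using \<phi> l\<phi> l'\<phi>' maps by auto
  have "holds A X (\<lambda>x. \<phi> x \<leadsto> l \<phi> (f x))"
    using adj[OF l\<phi>] holds_I[of Y "l \<phi>"] closed by simp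
  then have "holds A W (\<lambda>w. \<phi> (p w) \<leadsto> l \<phi> (f (p w)))"
    by (rule holds_reindex) (use closed in auto)
  then have "holds A W (\<lambda>w. \<phi> (p w) \<leadsto> compose Z (l \<phi>) g (q w))"
    using closed pullback_square_commutes[OF sq] by (simp add: compose_eq)
  then have le: "holds A Z (\<lambda>z. l' \<phi>' z \<leadsto> compose Z (l \<phi>) g z)"
    using adj'[of "compose Z (l \<phi>) g"] l\<phi> maps by simp
  let ?X = "\<lambda>y. \<phi> ` {x \<in> X. f x = y}"
  have "holds A W (\<lambda>w. \<phi> (p w) \<leadsto> l' \<phi>' (q w))"
    using adj'[OF l'\<phi>'] holds_I[of Z "l' \<phi>'"] closed by simp
  then have "holds A (Sigma Z (\<lambda>z. ?X (g z))) (\<lambda>(z, a). a \<leadsto> l' \<phi>' z)"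
  proof (rule holds_mono)
    fix k assume "k \<in> Sigma Z (\<lambda>z. ?X (g z))"
    then obtain z x where k: "k = (z, \<phi> x)" "z \<in> Z" "x \<in> X" "f x = g z"
      by auto
    then obtain w where "w \<in> W" "p w = x" "q w = z"
      using pullback_square_surjective[OF sq] by blast
    then show "\<exists>w\<in>W. \<phi> (p w) \<leadsto> l' \<phi>' (q w) \<sqsubseteq> (case k of (z, a) \<Rightarrow> a \<leadsto> l' \<phi>' z)"
      using k closed by (intro bexI[of _ w]) auto
  qed (use closed in auto)
  then have ex_le: "holds A Z (\<lambda>z. ex (?X (g z)) \<leadsto> l' \<phi>' z)"
    by (subst holds_ex_iff) (use closed in auto)
  have "holds A Z (\<lambda>z. l \<phi> (g z) \<leadsto> ex (?X (g z)))"
  proof -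
    have in_fibre: "exists_along X Y f \<phi> \<in> carrier (fibre (arrow_tripos A) Y)"
      using exists_along_in_fibre \<phi> by simp
    then have "exists_along X Y f \<phi> \<sqsubseteq>\<^bsub>fibre (arrow_tripos A) Y\<^esub> exists_along X Y f \<phi>"
      by (rule weak_partial_order.le_refl[OF weak_partial_order_fibre])
    then have "\<phi> \<sqsubseteq>\<^bsub>fibre (arrow_tripos A) X\<^esub> reindex (arrow_tripos A) X Y f (exists_along X Y f \<phi>)"
      using adjoint_exists_along[OF maps(3)] \<phi> in_fibre unfolding adjoint_maps_def by blast
    then have "holds A X (\<lambda>x. \<phi> x \<leadsto> exists_along X Y f \<phi> (f x))"
      by (simp add: le_arrow_fibre compose_eq)
    then have "holds A Y (\<lambda>y. l \<phi> y \<leadsto> exists_along X Y f \<phi> y)"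
      using adj[of "exists_along X Y f \<phi>"] in_fibre by simp
    then have "holds A Z (\<lambda>z. l \<phi> (g z) \<leadsto> exists_along X Y f \<phi> (g z))"
      by (rule holds_reindex) (use closed exists_along_in_fibre[of \<phi> X Y f] \<phi> in \<open>auto intro!: arr_closed\<close>)
    then show ?thesis
      using closed by (simp add: exists_along_def)
  qed
  then have ge: "holds A Z (\<lambda>z. l \<phi> (g z) \<leadsto> l' \<phi>' z)"
    by (rule holds_trans[OF _ ex_le]) (use closed in \<open>auto intro!: ex_closed\<close>)
  have "l' \<phi>' \<sqsubseteq>\<^bsub>fibre (arrow_tripos A) Z\<^esub> compose Z (l \<phi>) g"
    "compose Z (l \<phi>) g \<sqsubseteq>\<^bsub>fibre (arrow_tripos A) Z\<^esub> l' \<phi>'"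
    using le ge unfolding le_arrow_fibre by (simp_all add: compose_eq)
  then show ?thesis
    unfolding eq_arrow_fibre reindex_arrow_tripos \<phi>'_def by (rule conjI)
qed

text \<open>
  The dual argument: counits replace units, and universal quantification replaces existential
  quantification.
\<close>

lemma beck_chevalley_forall:
  assumes sq: "pullback_square small W X Z Y p q f g"
    and r: "adjoint_maps (fibre (arrow_tripos A) Y) (fibre (arrow_tripos A) X)
      (reindex (arrow_tripos A) X Y f) r"
    and r': "adjoint_maps (fibre (arrow_tripos A) Z) (fibre (arrow_tripos A) W)
      (reindex (arrow_tripos A) W Z q) r'"
    and \<phi>: "\<phi> \<in> carrier (fibre (arrow_tripos A) X)"
  shows "r' (reindex (arrow_tripos A) W X p \<phi>) .=\<^bsub>fibre (arrow_tripos A) Z\<^esub>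
    reindex (arrow_tripos A) Z Y g (r \<phi>)"
proof -
  have maps: "p \<in> W \<rightarrow>\<^sub>E X" "q \<in> W \<rightarrow>\<^sub>E Z" "f \<in> X \<rightarrow>\<^sub>E Y" "g \<in> Z \<rightarrow>\<^sub>E Y"
    using sq unfolding pullback_square_def by simp_all
  have adj: "holds A Y (\<lambda>y. \<psi> y \<leadsto> r \<phi> y) \<longleftrightarrow> holds A X (\<lambda>x. \<psi> (f x) \<leadsto> \<phi> x)"
    if "\<psi> \<in> Y \<rightarrow>\<^sub>E carrier A" for \<psi>
    using r \<phi> that by (simp add: adjoint_maps_def le_arrow_fibre compose_eq)
  define \<phi>' where "\<phi>' = compose W \<phi> p"
  have \<phi>': "\<phi>' \<in> W \<rightarrow>\<^sub>E carrier A"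
    using \<phi> maps by (simp add: \<phi>'_def)
  have adj': "holds A Z (\<lambda>z. \<psi> z \<leadsto> r' \<phi>' z) \<longleftrightarrow> holds A W (\<lambda>w. \<psi> (q w) \<leadsto> \<phi> (p w))"
    if "\<psi> \<in> Z \<rightarrow>\<^sub>E carrier A" for \<psi>
  proof -
    have "holds A Z (\<lambda>z. \<psi> z \<leadsto> r' \<phi>' z) \<longleftrightarrow> holds A W (\<lambda>w. \<psi> (q w) \<leadsto> \<phi>' w)"
      using r' \<phi>' that by (simp add: adjoint_maps_def le_arrow_fibre compose_eq)
    then show ?thesis
      by (simp add: \<phi>'_def compose_eq)
  qed
  have r\<phi>: "r \<phi> \<in> Y \<rightarrow>\<^sub>E carrier A" and r'\<phi>': "r' \<phi>' \<in> Z \<rightarrow>\<^sub>E carrier A"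
    using r r' \<phi> \<phi>' by (auto simp: adjoint_maps_def monotone_map_def)
  have closed: "\<And>x. x \<in> X \<Longrightarrow> \<phi> x \<in> carrier A" "\<And>y. y \<in> Y \<Longrightarrow> r \<phi> y \<in> carrier A"
      "\<And>z. z \<in> Z \<Longrightarrow> r' \<phi>' z \<in> carrier A" "\<And>w. w \<in> W \<Longrightarrow> p w \<in> X" "\<And>w. w \<in> W \<Longrightarrow> q w \<in> Z"
      "\<And>x. x \<in> X \<Longrightarrow> f x \<in> Y" "\<And>z. z \<in> Z \<Longrightarrow> g z \<in> Y"
    using \<phi> r\<phi> r'\<phi>' maps by auto
  have "holds A X (\<lambda>x. r \<phi> (f x) \<leadsto> \<phi> x)"
    using adj[OF r\<phi>] holds_I[of Y "r \<phi>"] closed by simp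
  then have "holds A W (\<lambda>w. r \<phi> (f (p w)) \<leadsto> \<phi> (p w))"
    by (rule holds_reindex) (use closed in auto)
  then have "holds A W (\<lambda>w. compose Z (r \<phi>) g (q w) \<leadsto> \<phi> (p w))"
    using closed pullback_square_commutes[OF sq] by (simp add: compose_eq)
  then have le: "holds A Z (\<lambda>z. compose Z (r \<phi>) g z \<leadsto> r' \<phi>' z)"
    using adj'[of "compose Z (r \<phi>) g"] r\<phi> maps by simp
  let ?X = "\<lambda>y. \<phi> ` {x \<in> X. f x = y}"
  have "holds A W (\<lambda>w. r' \<phi>' (q w) \<leadsto> \<phi> (p w))"
    using adj'[OF r'\<phi>'] holds_I[of Z "r' \<phi>'"] closed by simp
  then have "holds A (Sigma Z (\<lambda>z. ?X (g z))) (\<lambda>(z, a). r' \<phi>' z \<leadsto> a)"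
  proof (rule holds_mono)
    fix k assume "k \<in> Sigma Z (\<lambda>z. ?X (g z))"
    then obtain z x where k: "k = (z, \<phi> x)" "z \<in> Z" "x \<in> X" "f x = g z"
      by auto
    then obtain w where "w \<in> W" "p w = x" "q w = z"
      using pullback_square_surjective[OF sq] by blast
    then show "\<exists>w\<in>W. r' \<phi>' (q w) \<leadsto> \<phi> (p w) \<sqsubseteq> (case k of (z, a) \<Rightarrow> r' \<phi>' z \<leadsto> a)"
      using k closed by (intro bexI[of _ w]) auto
  qed (use closed in auto)
  then have "holds A Z (\<lambda>z. r' \<phi>' z \<leadsto> all (?X (g z)))"
    by (subst holds_all_iff) (use closed in auto)
  moreover have "holds A Z (\<lambda>z. all (?X (g z)) \<leadsto> r \<phi> (g z))"
  proof -
    have in_fibre: "forall_along X Y f \<phi> \<in> carrier (fibre (arrow_tripos A) Y)"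
      using forall_along_in_fibre \<phi> by simp
    then have "forall_along X Y f \<phi> \<sqsubseteq>\<^bsub>fibre (arrow_tripos A) Y\<^esub> forall_along X Y f \<phi>"
      by (rule weak_partial_order.le_refl[OF weak_partial_order_fibre])
    then have "reindex (arrow_tripos A) X Y f (forall_along X Y f \<phi>) \<sqsubseteq>\<^bsub>fibre (arrow_tripos A) X\<^esub> \<phi>"
      using adjoint_forall_along[OF maps(3)] \<phi> in_fibre unfolding adjoint_maps_def by blast
    then have "holds A X (\<lambda>x. forall_along X Y f \<phi> (f x) \<leadsto> \<phi> x)"
      by (simp add: le_arrow_fibre compose_eq)
    then have "holds A Y (\<lambda>y. forall_along X Y f \<phi> y \<leadsto> r \<phi> y)"
      using adj[of "forall_along X Y f \<phi>"] in_fibre by simp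
    then have "holds A Z (\<lambda>z. forall_along X Y f \<phi> (g z) \<leadsto> r \<phi> (g z))"
      by (rule holds_reindex) (use closed forall_along_in_fibre[of \<phi> X Y f] \<phi> in \<open>auto intro!: arr_closed\<close>)
    then show ?thesis
      using closed by (simp add: forall_along_def)
  qed
  ultimately have ge: "holds A Z (\<lambda>z. r' \<phi>' z \<leadsto> r \<phi> (g z))"
    by (rule holds_trans) (use closed in \<open>auto intro!: all_closed\<close>)
  have "r' \<phi>' \<sqsubseteq>\<^bsub>fibre (arrow_tripos A) Z\<^esub> compose Z (r \<phi>) g"
    "compose Z (r \<phi>) g \<sqsubseteq>\<^bsub>fibre (arrow_tripos A) Z\<^esub> r' \<phi>'"
    using le ge unfolding le_arrow_fibre by (simp_all add: compose_eq)
  then show ?thesis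
    unfolding eq_arrow_fibre reindex_arrow_tripos \<phi>'_def by (rule conjI)
qed

theorem tripos_arrow_tripos: "tripos small (arrow_tripos A)"
proof
  show "heyting_prealgebra (fibre (arrow_tripos A) X)" if "small X" for X
    by (rule heyting_preorder.heyting_prealgebra[OF heyting_preorder_fibre])
  show "heytpre_hom (fibre (arrow_tripos A) Y) (fibre (arrow_tripos A) X)
      (reindex (arrow_tripos A) X Y f)" if "small X" "small Y" "f \<in> X \<rightarrow>\<^sub>E Y" for X Y f
    by (rule reindex_heytpre_hom) fact
  have refl: "\<phi> .=\<^bsub>fibre (arrow_tripos A) X\<^esub> \<phi>" if "\<phi> \<in> X \<rightarrow>\<^sub>E carrier A" for X \<phi>
    using weak_partial_order.le_refl[OF weak_partial_order_fibre[of X]] that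
    by (simp add: eq_arrow_fibre)
  show "reindex (arrow_tripos A) X X (\<lambda>x\<in>X. x) \<phi> .=\<^bsub>fibre (arrow_tripos A) X\<^esub> \<phi>"
    if "\<phi> \<in> carrier (fibre (arrow_tripos A) X)" for X \<phi>
    using that refl[of \<phi> X] by simp
  show "reindex (arrow_tripos A) X Z (compose X g f) \<phi> .=\<^bsub>fibre (arrow_tripos A) X\<^esub>
      reindex (arrow_tripos A) X Y f (reindex (arrow_tripos A) Y Z g \<phi>)"
    if "f \<in> X \<rightarrow>\<^sub>E Y" "g \<in> Y \<rightarrow>\<^sub>E Z" "\<phi> \<in> carrier (fibre (arrow_tripos A) Z)" for X Y Z f g \<phi>
  proof -
    have "compose X \<phi> (compose X g f) = compose X (compose Y \<phi> g) f"
      using compose_assoc[of f X Y \<phi> g] that by (auto simp: PiE_def)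
    then show ?thesis
      using refl[of "compose X (compose Y \<phi> g) f" X] that
        compose_in_fibre[of "compose Y \<phi> g" Y "carrier A" f X] by simp
  qed
  show "\<exists>l. adjoint_maps (fibre (arrow_tripos A) X) (fibre (arrow_tripos A) Y) l
      (reindex (arrow_tripos A) X Y f)" if "f \<in> X \<rightarrow>\<^sub>E Y" for X Y f
    using adjoint_exists_along[OF that] by blast
  show "\<exists>r. adjoint_maps (fibre (arrow_tripos A) Y) (fibre (arrow_tripos A) X)
      (reindex (arrow_tripos A) X Y f) r" if "f \<in> X \<rightarrow>\<^sub>E Y" for X Y f
    using adjoint_forall_along[OF that] by blast
  show "\<exists>\<Sigma> \<sigma>. small \<Sigma> \<and> \<sigma> \<in> carrier (fibre (arrow_tripos A) \<Sigma>) \<and>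
      (\<forall>X \<phi>. small X \<and> \<phi> \<in> carrier (fibre (arrow_tripos A) X) \<longrightarrow>
        (\<exists>g\<in>X \<rightarrow>\<^sub>E \<Sigma>. \<phi> .=\<^bsub>fibre (arrow_tripos A) X\<^esub> reindex (arrow_tripos A) X \<Sigma> g \<sigma>))"
  proof (rule exI[of _ "carrier A"], rule exI[of _ "\<lambda>a\<in>carrier A. a"], intro conjI allI impI)
    fix X \<phi> assume "small X \<and> \<phi> \<in> carrier (fibre (arrow_tripos A) X)"
    then have \<phi>: "\<phi> \<in> X \<rightarrow>\<^sub>E carrier A" by simp
    then show "\<exists>g\<in>X \<rightarrow>\<^sub>E carrier A. \<phi> .=\<^bsub>fibre (arrow_tripos A) X\<^esub>
        reindex (arrow_tripos A) X (carrier A) g (\<lambda>a\<in>carrier A. a)"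
      using \<phi> refl[OF \<phi>] by (intro bexI[of _ \<phi>]) simp_all
  qed (use carrier_small in auto)
  (* Forward reasoning: in the conclusion the adjoint is a variable head, which resolution against
     the goal would have to guess. *)
qed (frule (3) beck_chevalley_exists, assumption, frule (3) beck_chevalley_forall, assumption)

end


section \<open>Finite meets and adjoints\<close>

lemma monotone_mapD:
  assumes "monotone_map L M f"
  shows "x \<in> carrier L \<Longrightarrow> f x \<in> carrier M"
    and "\<lbrakk>x \<in> carrier L; y \<in> carrier L; x \<sqsubseteq>\<^bsub>L\<^esub> y\<rbrakk> \<Longrightarrow> f x \<sqsubseteq>\<^bsub>M\<^esub> f y"
    and "weak_partial_order L" and "weak_partial_order M"
  using assms by (auto simp: monotone_map_def isotone_def)

text \<open>
  It is enough to find, for each finite \<open>F\<close>, some lower bound \<open>n\<close> of \<open>F\<close> whose image is above every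
  lower bound of the image of \<open>F\<close>: a greatest lower bound \<open>m\<close> is above \<open>n\<close>, and \<open>f\<close> is monotone. Such
  an \<open>n\<close> is built by iterating \<open>mt\<close>, starting from \<open>tp\<close>.
\<close>

lemma preserves_finite_meetsI:
  assumes f: "monotone_map L M f"
    and tp: "tp \<in> carrier L" "\<And>y. y \<in> carrier M \<Longrightarrow> y \<sqsubseteq>\<^bsub>M\<^esub> f tp"
    and mt: "\<And>x x'. \<lbrakk>x \<in> carrier L; x' \<in> carrier L\<rbrakk> \<Longrightarrow> mt x x' \<in> carrier L"
      "\<And>x x'. \<lbrakk>x \<in> carrier L; x' \<in> carrier L\<rbrakk> \<Longrightarrow> mt x x' \<sqsubseteq>\<^bsub>L\<^esub> x \<and> mt x x' \<sqsubseteq>\<^bsub>L\<^esub> x'"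
      "\<And>x x' y. \<lbrakk>x \<in> carrier L; x' \<in> carrier L; y \<in> carrier M; y \<sqsubseteq>\<^bsub>M\<^esub> f x; y \<sqsubseteq>\<^bsub>M\<^esub> f x'\<rbrakk>
        \<Longrightarrow> y \<sqsubseteq>\<^bsub>M\<^esub> f (mt x x')"
  shows "preserves_finite_meets L M f"
  unfolding preserves_finite_meets_def
proof (intro allI impI, elim conjE)
  interpret L: weak_partial_order L by (rule monotone_mapD(3)[OF f])
  interpret M: weak_partial_order M by (rule monotone_mapD(4)[OF f])
  note fc = monotone_mapD(1)[OF f] and fm = monotone_mapD(2)[OF f]
  fix F m
  assume F: "finite F" "F \<subseteq> carrier L" and m: "is_glb L m F"
  have "\<exists>n\<in>carrier L. (\<forall>x\<in>F. n \<sqsubseteq>\<^bsub>L\<^esub> x) \<and>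
      (\<forall>y\<in>carrier M. (\<forall>x\<in>F. y \<sqsubseteq>\<^bsub>M\<^esub> f x) \<longrightarrow> y \<sqsubseteq>\<^bsub>M\<^esub> f n)"
    using F
  proof (induction rule: finite_induct)
    case empty
    then show ?case using tp by blast
  next
    case (insert x F)
    then obtain n where n: "n \<in> carrier L" "\<And>x. x \<in> F \<Longrightarrow> n \<sqsubseteq>\<^bsub>L\<^esub> x"
        "\<And>y. \<lbrakk>y \<in> carrier M; \<And>x. x \<in> F \<Longrightarrow> y \<sqsubseteq>\<^bsub>M\<^esub> f x\<rbrakk> \<Longrightarrow> y \<sqsubseteq>\<^bsub>M\<^esub> f n"
      by auto
    have x: "x \<in> carrier L" and F: "F \<subseteq> carrier L"
      using insert.prems by auto
    show ?case
    proof (intro bexI[of _ "mt x n"] conjI ballI impI)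
      fix z assume z: "z \<in> insert x F"
      show "mt x n \<sqsubseteq>\<^bsub>L\<^esub> z"
      proof (cases "z = x")
        case True
        then show ?thesis using mt(2)[OF x n(1)] by simp
      next
        case False
        then have "n \<sqsubseteq>\<^bsub>L\<^esub> z" "z \<in> carrier L"
          using z n(2) F by auto
        then show ?thesis
          using mt(2)[OF x n(1)] L.le_trans[of "mt x n" n z] mt(1)[OF x n(1)] n(1) by blast
      qed
    next
      fix y assume "y \<in> carrier M" "\<forall>z\<in>insert x F. y \<sqsubseteq>\<^bsub>M\<^esub> f z"
      then show "y \<sqsubseteq>\<^bsub>M\<^esub> f (mt x n)"
        by (intro mt(3) x n) auto
    qed (use mt(1) x n in auto)
  qed
  then obtain n where n: "n \<in> carrier L" "\<forall>x\<in>F. n \<sqsubseteq>\<^bsub>L\<^esub> x"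
      "\<forall>y\<in>carrier M. (\<forall>x\<in>F. y \<sqsubseteq>\<^bsub>M\<^esub> f x) \<longrightarrow> y \<sqsubseteq>\<^bsub>M\<^esub> f n"
    by blast
  have mc: "m \<in> carrier L"
    using m by simp
  have "n \<in> Lower L F"
    using n by (auto intro: Lower_memI)
  then have "n \<sqsubseteq>\<^bsub>L\<^esub> m"
    using m by (rule greatest_le[rotated])
  then have nm: "f n \<sqsubseteq>\<^bsub>M\<^esub> f m"
    by (rule fm[OF n(1) mc])
  show "is_glb M (f m) (f ` F)"
  proof (rule greatest_LowerI)
    fix z assume "z \<in> f ` F"
    then show "f m \<sqsubseteq>\<^bsub>M\<^esub> z"
      using greatest_Lower_below[OF m _ F(2)] F(2) fm[OF mc] by blast
  next
    fix y assume "y \<in> Lower M (f ` F)"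
    moreover have "f ` F \<subseteq> carrier M"
      using F(2) fc by blast
    ultimately have y: "y \<in> carrier M" "\<forall>x\<in>F. y \<sqsubseteq>\<^bsub>M\<^esub> f x"
      by (auto simp: Lower_def)
    then have "y \<sqsubseteq>\<^bsub>M\<^esub> f n"
      using n(3) by blast
    then show "y \<sqsubseteq>\<^bsub>M\<^esub> f m"
      by (rule M.le_trans[OF _ nm y(1) fc[OF n(1)] fc[OF mc]])
  qed (use F fc mc in auto)
qed

lemma preserves_finite_meetsD:
  "\<lbrakk>preserves_finite_meets L M f; finite F; F \<subseteq> carrier L; is_glb L m F\<rbrakk>
    \<Longrightarrow> is_glb M (f m) (f ` F)"
  unfolding preserves_finite_meets_def by simp

lemma preserves_finite_meets_compose:
  assumes "preserves_finite_meets L M f" "preserves_finite_meets M N g"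
    "f \<in> carrier L \<rightarrow> carrier M" "\<And>x. x \<in> carrier L \<Longrightarrow> k x = g (f x)"
  shows "preserves_finite_meets L N k"
  unfolding preserves_finite_meets_def
proof (intro allI impI, elim conjE)
  fix F m assume F: "finite F" "F \<subseteq> carrier L" and m: "is_glb L m F"
  then have "is_glb M (f m) (f ` F)"
    using assms(1) by (simp add: preserves_finite_meets_def)
  moreover have "f ` F \<subseteq> carrier M"
    using F assms(3) by auto
  ultimately have "is_glb N (g (f m)) (g ` f ` F)"
    using assms(2) F(1) by (simp add: preserves_finite_meets_def)
  moreover have "k m = g (f m)" "k ` F = g ` f ` F"
    using assms(4) m F(2) by (auto simp: image_image intro!: image_cong)
  ultimately show "is_glb N (k m) (k ` F)"
    by simp
qed

lemma right_adjoint_preserves_finite_meets: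
  assumes "adjoint_maps L M f g"
  shows "preserves_finite_meets M L g"
  unfolding preserves_finite_meets_def
proof (intro allI impI, elim conjE)
  have f: "monotone_map L M f" and g: "monotone_map M L g"
    and adj: "\<And>x y. \<lbrakk>x \<in> carrier L; y \<in> carrier M\<rbrakk> \<Longrightarrow> f x \<sqsubseteq>\<^bsub>M\<^esub> y \<longleftrightarrow> x \<sqsubseteq>\<^bsub>L\<^esub> g y"
    using assms by (auto simp: adjoint_maps_def)
  fix F m assume F: "finite F" "F \<subseteq> carrier M" and m: "is_glb M m F"
  have mc: "m \<in> carrier M"
    using m by simp
  show "is_glb L (g m) (g ` F)"
  proof (rule greatest_LowerI)
    fix z assume "z \<in> g ` F"
    then show "g m \<sqsubseteq>\<^bsub>L\<^esub> z"
      using greatest_Lower_below[OF m _ F(2)] F(2) monotone_mapD(2)[OF g mc] by blast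
  next
    fix y assume "y \<in> Lower L (g ` F)"
    then have y: "y \<in> carrier L" "\<And>x. x \<in> F \<Longrightarrow> y \<sqsubseteq>\<^bsub>L\<^esub> g x"
      using monotone_mapD(1)[OF g] F(2) by (auto simp: Lower_def)
    then have "f y \<in> Lower M F"
      using adj F(2) monotone_mapD(1)[OF f] by (intro Lower_memI) auto
    then have "f y \<sqsubseteq>\<^bsub>M\<^esub> m"
      by (rule greatest_le[OF m])
    then show "y \<sqsubseteq>\<^bsub>L\<^esub> g m"
      using adj[OF y(1) mc] by simp
  qed (use F monotone_mapD(1)[OF g] mc in auto)
qed

lemma monotone_map_cong:
  assumes "monotone_map L M f" "\<And>x. x \<in> carrier L \<Longrightarrow> k x = f x"
  shows "monotone_map L M k"
  using assms by (auto simp: monotone_map_def isotone_def Pi_iff)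

lemma adjoint_maps_cong:
  assumes "adjoint_maps L M f g" "\<And>x. x \<in> carrier L \<Longrightarrow> f' x = f x"
    "\<And>y. y \<in> carrier M \<Longrightarrow> g' y = g y"
  shows "adjoint_maps L M f' g'"
  using assms monotone_map_cong[of L M f f'] monotone_map_cong[of M L g g']
  by (simp add: adjoint_maps_def)

lemma monotone_map_compose:
  assumes "monotone_map L M f" "monotone_map M N g"
  shows "monotone_map L N (\<lambda>x. g (f x))"
  using monotone_mapD[OF assms(1)] monotone_mapD[OF assms(2)]
  by (simp add: monotone_map_def isotone_def)

lemma adjoint_maps_compose:
  assumes "adjoint_maps L M f g" "adjoint_maps M N f' g'"
  shows "adjoint_maps L N (\<lambda>x. f' (f x)) (\<lambda>y. g (g' y))"
  using assms monotone_mapD(1)[of L M f] monotone_mapD(1)[of N M g']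
    monotone_map_compose[of L M f N f'] monotone_map_compose[of N M g' L g]
  by (simp add: adjoint_maps_def)

lemma adjoint_maps_id:
  assumes "weak_partial_order L"
  shows "adjoint_maps L L (\<lambda>x. x) (\<lambda>x. x)"
  using assms by (simp add: adjoint_maps_def monotone_map_def isotone_def)


section \<open>Wide subcategories\<close>

lemma wide_subcat_simps [simp]:
  "Ob (wide_subcat C Q) = Ob C"
  "carrier (Hom (wide_subcat C Q) X Y) = {f \<in> carrier (Hom C X Y). Q X Y f}"
  "f \<sqsubseteq>\<^bsub>Hom (wide_subcat C Q) X Y\<^esub> g \<longleftrightarrow> f \<sqsubseteq>\<^bsub>Hom C X Y\<^esub> g"
  "f .=\<^bsub>Hom (wide_subcat C Q) X Y\<^esub> g \<longleftrightarrow> f .=\<^bsub>Hom C X Y\<^esub> g"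
  "Id (wide_subcat C Q) = Id C"
  "Comp (wide_subcat C Q) = Comp C"
  by (simp_all add: wide_subcat_def)

lemma preorder_enriched_wide_subcat:
  assumes "preorder_enriched_category C"
    and "\<And>X. X \<in> Ob C \<Longrightarrow> Q X X (Id C X)"
    and "\<And>X Y Z f g. \<lbrakk>X \<in> Ob C; Y \<in> Ob C; Z \<in> Ob C; f \<in> carrier (Hom C X Y);
        g \<in> carrier (Hom C Y Z); Q X Y f; Q Y Z g\<rbrakk> \<Longrightarrow> Q X Z (Comp C X Y Z g f)"
  shows "preorder_enriched_category (wide_subcat C Q)"
proof -
  interpret C: preorder_enriched_category C by fact
  show ?thesis
  proof (rule preorder_enriched_category.intro)
    show "weak_partial_order (Hom (wide_subcat C Q) X Y)"
      if "X \<in> Ob (wide_subcat C Q)" "Y \<in> Ob (wide_subcat C Q)" for X Y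
      using weak_partial_order_subset[OF C.hom_preorder, of X Y] that
      by (simp add: wide_subcat_def)
  qed (use assms(2,3) C.id_hom C.comp_hom C.comp_mono C.comp_id_left C.comp_id_right
      C.comp_assoc in simp_all)
qed

lemma two_functor_wide_subcat:
  assumes "two_functor C D Fo Fm"
    and "preorder_enriched_category (wide_subcat C Q)"
    and "preorder_enriched_category (wide_subcat D R)"
    and "\<And>X Y f. \<lbrakk>X \<in> Ob C; Y \<in> Ob C; f \<in> carrier (Hom C X Y); Q X Y f\<rbrakk>
      \<Longrightarrow> R (Fo X) (Fo Y) (Fm X Y f)"
  shows "two_functor (wide_subcat C Q) (wide_subcat D R) Fo Fm"
proof -
  interpret F: two_functor C D Fo Fm by fact
  interpret C': preorder_enriched_category "wide_subcat C Q" by fact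
  interpret D': preorder_enriched_category "wide_subcat D R" by fact
  show ?thesis
  proof (intro two_functor.intro two_functor_axioms.intro assms(2,3))
    show "monotone_map (Hom (wide_subcat C Q) X Y) (Hom (wide_subcat D R) (Fo X) (Fo Y)) (Fm X Y)"
      if "X \<in> Ob (wide_subcat C Q)" "Y \<in> Ob (wide_subcat C Q)" for X Y
    proof -
      have X: "X \<in> Ob C" "Y \<in> Ob C"
        using that by simp_all
      have "weak_partial_order (Hom (wide_subcat C Q) X Y)"
        using C'.hom_preorder that by blast
      moreover have "weak_partial_order (Hom (wide_subcat D R) (Fo X) (Fo Y))"
        using D'.hom_preorder[of "Fo X" "Fo Y"] F.obj X by simp
      ultimately show ?thesis
        using monotone_mapD(1,2)[OF F.hom_map[OF X]] assms(4)[OF X]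
        by (simp add: monotone_map_def isotone_def Pi_iff)
    qed
  qed (use F.obj F.map_id F.map_comp in simp_all)
qed


section \<open>The category of triposes\<close>

context heyting_pseudofunctor
begin

lemma fibre_preorder: "small X \<Longrightarrow> weak_partial_order (fibre P X)"
  using fibre_heyting by (simp add: heyting_prealgebra_def)

lemma fibre_refl: "\<lbrakk>small X; \<phi> \<in> carrier (fibre P X)\<rbrakk> \<Longrightarrow> \<phi> \<sqsubseteq>\<^bsub>fibre P X\<^esub> \<phi>"
  using weak_partial_order.le_refl[OF fibre_preorder] by blast

lemma fibre_trans:
  "\<lbrakk>small X; \<phi> \<in> carrier (fibre P X); \<psi> \<in> carrier (fibre P X); \<chi> \<in> carrier (fibre P X);
    \<phi> \<sqsubseteq>\<^bsub>fibre P X\<^esub> \<psi>; \<psi> \<sqsubseteq>\<^bsub>fibre P X\<^esub> \<chi>\<rbrakk> \<Longrightarrow> \<phi> \<sqsubseteq>\<^bsub>fibre P X\<^esub> \<chi>"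
  using weak_partial_order.le_trans[OF fibre_preorder] by blast

lemma fibre_eq_iff:
  "\<lbrakk>small X; \<phi> \<in> carrier (fibre P X); \<psi> \<in> carrier (fibre P X)\<rbrakk>
    \<Longrightarrow> \<phi> .=\<^bsub>fibre P X\<^esub> \<psi> \<longleftrightarrow> \<phi> \<sqsubseteq>\<^bsub>fibre P X\<^esub> \<psi> \<and> \<psi> \<sqsubseteq>\<^bsub>fibre P X\<^esub> \<phi>"
  using weak_partial_order.eq_iff_le[OF fibre_preorder] by blast

lemma fibre_eq_trans:
  "\<lbrakk>small X; \<phi> \<in> carrier (fibre P X); \<psi> \<in> carrier (fibre P X); \<chi> \<in> carrier (fibre P X);
    \<phi> .=\<^bsub>fibre P X\<^esub> \<psi>; \<psi> .=\<^bsub>fibre P X\<^esub> \<chi>\<rbrakk> \<Longrightarrow> \<phi> .=\<^bsub>fibre P X\<^esub> \<chi>"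
  using fibre_trans fibre_eq_iff by meson

lemma reindex_closed:
  "\<lbrakk>small X; small Y; f \<in> X \<rightarrow>\<^sub>E Y; \<phi> \<in> carrier (fibre P Y)\<rbrakk>
    \<Longrightarrow> reindex P X Y f \<phi> \<in> carrier (fibre P X)"
  using reindex_hom by (meson heytpre_hom_def monotone_mapD(1))

end

lemma transformationD:
  assumes "transformation small P Q \<Phi>" "small X"
  shows "\<Phi> X \<in> carrier (fibre P X) \<rightarrow>\<^sub>E carrier (fibre Q X)"
    and "monotone_map (fibre P X) (fibre Q X) (\<Phi> X)"
    and "\<lbrakk>small Y; f \<in> X \<rightarrow>\<^sub>E Y; \<phi> \<in> carrier (fibre P Y)\<rbrakk>
      \<Longrightarrow> \<Phi> X (reindex P X Y f \<phi>) .=\<^bsub>fibre Q X\<^esub> reindex Q X Y f (\<Phi> Y \<phi>)"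
  using assms by (auto simp: transformation_def)

lemma transformation_closed:
  "\<lbrakk>transformation small P Q \<Phi>; small X; \<phi> \<in> carrier (fibre P X)\<rbrakk>
    \<Longrightarrow> \<Phi> X \<phi> \<in> carrier (fibre Q X)"
  using transformationD(1) by fastforce

abbreviation id_transformation where
  "id_transformation small P \<equiv> \<lambda>X\<in>Collect small. \<lambda>\<phi>\<in>carrier (fibre P X). \<phi>"

abbreviation comp_transformation where
  "comp_transformation small P \<Psi> \<Phi> \<equiv>
    \<lambda>X\<in>Collect small. compose (carrier (fibre P X)) (\<Psi> X) (\<Phi> X)"

lemma transformation_id:
  assumes "tripos small P"
  shows "transformation small P P (id_transformation small P)"
proof -
  interpret P: tripos small P by fact
  show ?thesis
    unfolding transformation_def
  proof (intro conjI allI impI)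
    fix X assume X: "small X"
    show "monotone_map (fibre P X) (fibre P X) (id_transformation small P X)"
      using X P.fibre_preorder[OF X] by (simp add: monotone_map_def isotone_def)
  next
    fix X Y f \<phi>
    assume "small X \<and> small Y \<and> f \<in> X \<rightarrow>\<^sub>E Y \<and> \<phi> \<in> carrier (fibre P Y)"
    then show "id_transformation small P X (reindex P X Y f \<phi>) .=\<^bsub>fibre P X\<^esub>
        reindex P X Y f (id_transformation small P Y \<phi>)"
      using P.reindex_closed[of X Y f \<phi>] P.fibre_eq_iff[of X] P.fibre_refl[of X] by simp
  qed auto
qed

text \<open>
  Naturality holds only up to isomorphism, which the monotone map \<open>\<Psi> X\<close> preserves.
\<close>

lemma transformation_comp:
  assumes "tripos small P" "tripos small Q" "tripos small R"
    and \<Phi>: "transformation small P Q \<Phi>" and \<Psi>: "transformation small Q R \<Psi>"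
  shows "transformation small P R (comp_transformation small P \<Psi> \<Phi>)"
proof -
  interpret P: tripos small P by fact
  interpret Q: tripos small Q by fact
  interpret R: tripos small R by fact
  note closed = transformation_closed[OF \<Phi>] transformation_closed[OF \<Psi>]
  show ?thesis
    unfolding transformation_def
  proof (intro conjI allI impI)
    show "comp_transformation small P \<Psi> \<Phi> \<in>
        (\<Pi>\<^sub>E X\<in>Collect small. carrier (fibre P X) \<rightarrow>\<^sub>E carrier (fibre R X))"
      using compose_in_fibre[OF transformationD(1)[OF \<Psi>] transformationD(1)[OF \<Phi>]]
      by (simp add: restrict_PiE_iff)
  next
    fix X assume X: "small X"
    show "monotone_map (fibre P X) (fibre R X) (comp_transformation small P \<Psi> \<Phi> X)"
      by (rule monotone_map_cong[OF monotone_map_compose[OF transformationD(2)[OF \<Phi> X]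
            transformationD(2)[OF \<Psi> X]]]) (simp add: X compose_eq)
  next
    fix X Y f \<phi>
    assume "small X \<and> small Y \<and> f \<in> X \<rightarrow>\<^sub>E Y \<and> \<phi> \<in> carrier (fibre P Y)"
    then have *: "small X" "small Y" "f \<in> X \<rightarrow>\<^sub>E Y" "\<phi> \<in> carrier (fibre P Y)"
      by auto
    note rcP = P.reindex_closed[OF *] 
    note rcQ = Q.reindex_closed[OF *(1-3) closed(1)[OF *(2,4)]]
    note rcR = R.reindex_closed[OF *(1-3) closed(2)[OF *(2) closed(1)[OF *(2,4)]]]
    have "\<Phi> X (reindex P X Y f \<phi>) .=\<^bsub>fibre Q X\<^esub> reindex Q X Y f (\<Phi> Y \<phi>)"
      by (rule transformationD(3)[OF \<Phi>]) fact+
    then have "\<Psi> X (\<Phi> X (reindex P X Y f \<phi>)) .=\<^bsub>fibre R X\<^esub> \<Psi> X (reindex Q X Y f (\<Phi> Y \<phi>))"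
      unfolding Q.fibre_eq_iff[OF *(1) closed(1)[OF *(1) rcP] rcQ]
        R.fibre_eq_iff[OF *(1) closed(2)[OF *(1) closed(1)[OF *(1) rcP]] closed(2)[OF *(1) rcQ]]
      using monotone_mapD(2)[OF transformationD(2)[OF \<Psi> *(1)]] closed(1)[OF *(1) rcP] rcQ
      by simp
    moreover have "\<Psi> X (reindex Q X Y f (\<Phi> Y \<phi>)) .=\<^bsub>fibre R X\<^esub>
        reindex R X Y f (\<Psi> Y (\<Phi> Y \<phi>))"
      by (rule transformationD(3)[OF \<Psi> *(1-3)]) (rule closed *)+
    ultimately have "\<Psi> X (\<Phi> X (reindex P X Y f \<phi>)) .=\<^bsub>fibre R X\<^esub>
        reindex R X Y f (\<Psi> Y (\<Phi> Y \<phi>))"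
      by (rule R.fibre_eq_trans[OF *(1) closed(2)[OF *(1) closed(1)[OF *(1) rcP]]
            closed(2)[OF *(1) rcQ] rcR])
    then show "comp_transformation small P \<Psi> \<Phi> X (reindex P X Y f \<phi>) .=\<^bsub>fibre R X\<^esub>
        reindex R X Y f (comp_transformation small P \<Psi> \<Phi> Y \<phi>)"
      using * rcP by (simp add: compose_eq)
  qed
qed

lemma cartesian_transformationD:
  assumes "cartesian_transformation small P Q \<Phi>"
  shows "transformation small P Q \<Phi>"
    and "small X \<Longrightarrow> preserves_finite_meets (fibre P X) (fibre Q X) (\<Phi> X)"
  using assms by (simp_all add: cartesian_transformation_def)

lemma cartesian_id:
  assumes "tripos small P"
  shows "cartesian_transformation small P P (id_transformation small P)"
proof -
  have "preserves_finite_meets (fibre P X) (fibre P X) (id_transformation small P X)"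
    if "small X" for X
    unfolding preserves_finite_meets_def
  proof (intro allI impI, elim conjE)
    fix F m assume "F \<subseteq> carrier (fibre P X)" and m: "is_glb (fibre P X) m F"
    then have "id_transformation small P X ` F = F" "m \<in> carrier (fibre P X)"
      using that by (auto simp: subset_iff image_iff)
    then show "is_glb (fibre P X) (id_transformation small P X m) (id_transformation small P X ` F)"
      using that m by simp
  qed
  then show ?thesis
    using transformation_id[OF assms] by (simp add: cartesian_transformation_def)
qed

lemma cartesian_comp:
  assumes "tripos small P" "tripos small Q" "tripos small R"
    and \<Phi>: "cartesian_transformation small P Q \<Phi>" and \<Psi>: "cartesian_transformation small Q R \<Psi>"
  shows "cartesian_transformation small P R (comp_transformation small P \<Psi> \<Phi>)"
proof -
  have "preserves_finite_meets (fibre P X) (fibre R X) (comp_transformation small P \<Psi> \<Phi> X)"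
    if X: "small X" for X
  proof (rule preserves_finite_meets_compose)
    show "preserves_finite_meets (fibre P X) (fibre Q X) (\<Phi> X)"
      "preserves_finite_meets (fibre Q X) (fibre R X) (\<Psi> X)"
      using \<Phi> \<Psi> X by (auto simp: cartesian_transformation_def)
    show "\<Phi> X \<in> carrier (fibre P X) \<rightarrow> carrier (fibre Q X)"
      using \<Phi> X transformation_closed[of small P Q \<Phi>]
      by (simp add: cartesian_transformation_def Pi_iff)
  qed (simp add: X compose_eq)
  then show ?thesis
    using transformation_comp[OF assms(1-3)] \<Phi> \<Psi> by (simp add: cartesian_transformation_def)
qed

lemma geometric_id:
  assumes "tripos small P"
  shows "geometric_transformation small P P (id_transformation small P)"
proof -
  interpret P: tripos small P by fact
  have "adjoint_maps (fibre P X) (fibre P X) (id_transformation small P X)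
      (id_transformation small P X)" if "small X" for X
    by (rule adjoint_maps_cong[OF adjoint_maps_id[OF P.fibre_preorder[OF that]]])
      (use that in simp_all)
  then show ?thesis
    using cartesian_id[OF assms] transformation_id[OF assms]
    unfolding geometric_transformation_def by blast
qed

lemma geometric_comp:
  assumes "tripos small P" "tripos small Q" "tripos small R"
    and \<Phi>: "geometric_transformation small P Q \<Phi>" and \<Psi>: "geometric_transformation small Q R \<Psi>"
  shows "geometric_transformation small P R (comp_transformation small P \<Psi> \<Phi>)"
proof -
  obtain \<Phi>' where \<Phi>': "transformation small Q P \<Phi>'"
      "\<And>X. small X \<Longrightarrow> adjoint_maps (fibre P X) (fibre Q X) (\<Phi> X) (\<Phi>' X)"
    using \<Phi> by (auto simp: geometric_transformation_def)
  obtain \<Psi>' where \<Psi>': "transformation small R Q \<Psi>'"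
      "\<And>X. small X \<Longrightarrow> adjoint_maps (fibre Q X) (fibre R X) (\<Psi> X) (\<Psi>' X)"
    using \<Psi> by (auto simp: geometric_transformation_def)
  have "adjoint_maps (fibre P X) (fibre R X) (comp_transformation small P \<Psi> \<Phi> X)
      (comp_transformation small R \<Phi>' \<Psi>' X)" if X: "small X" for X
    by (rule adjoint_maps_cong[OF adjoint_maps_compose[OF \<Phi>'(2)[OF X] \<Psi>'(2)[OF X]]])
      (simp_all add: X compose_eq)
  moreover have "cartesian_transformation small P R (comp_transformation small P \<Psi> \<Phi>)"
    using cartesian_comp[OF assms(1-3)] \<Phi> \<Psi> by (simp add: geometric_transformation_def)
  moreover have "transformation small R P (comp_transformation small R \<Phi>' \<Psi>')"
    by (rule transformation_comp[OF assms(3,2,1) \<Psi>'(1) \<Phi>'(1)])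
  ultimately show ?thesis
    unfolding geometric_transformation_def by blast
qed

lemma Trip_cart_simps [simp]:
  "Ob (Trip_cart small) = {P. tripos small P}"
  "carrier (Hom (Trip_cart small) P Q) = {\<Phi>. cartesian_transformation small P Q \<Phi>}"
  "\<Phi> \<sqsubseteq>\<^bsub>Hom (Trip_cart small) P Q\<^esub> \<Psi> \<longleftrightarrow> transformation_le small P Q \<Phi> \<Psi>"
  "\<Phi> .=\<^bsub>Hom (Trip_cart small) P Q\<^esub> \<Psi> \<longleftrightarrow>
    transformation_le small P Q \<Phi> \<Psi> \<and> transformation_le small P Q \<Psi> \<Phi>"
  "Id (Trip_cart small) P = id_transformation small P"
  "Comp (Trip_cart small) P Q R \<Psi> \<Phi> = comp_transformation small P \<Psi> \<Phi>"
  by (simp_all add: Trip_cart_def preord_def)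

lemma transformation_extensional:
  assumes "transformation small P Q \<Phi>"
  shows "\<Phi> \<in> extensional (Collect small)" "small X \<Longrightarrow> \<Phi> X \<in> extensional (carrier (fibre P X))"
  using assms by (auto simp: transformation_def PiE_def Pi_iff)

text \<open>
  The unit and associativity laws hold on the nose, since transformations are extensional in both of
  their arguments.
\<close>

lemma preorder_enriched_Trip_cart:
  fixes small :: "'a set \<Rightarrow> bool"
  shows "preorder_enriched_category
    (Trip_cart small :: (('a, 'b) indexed_preorder, 'a set \<Rightarrow> 'b \<Rightarrow> 'b) penr_cat)"
proof (rule preorder_enriched_category.intro)
  fix P Q :: "('a, 'b) indexed_preorder" assume "P \<in> Ob (Trip_cart small)" "Q \<in> Ob (Trip_cart small)"
  then interpret P: tripos small P + Q: tripos small Q by simp_all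
  show "weak_partial_order (Hom (Trip_cart small) P Q)"
    unfolding Trip_cart_def penr_cat.simps
  proof (rule weak_partial_order_preord; unfold mem_Collect_eq)
    show "transformation_le small P Q \<Phi> \<Phi>" if "cartesian_transformation small P Q \<Phi>" for \<Phi>
      unfolding transformation_le_def
    proof (intro allI impI ballI)
      fix X \<phi> assume X: "small X" "\<phi> \<in> carrier (fibre P X)"
      have t: "transformation small P Q \<Phi>"
        using that by (simp add: cartesian_transformation_def)
      show "\<Phi> X \<phi> \<sqsubseteq>\<^bsub>fibre Q X\<^esub> \<Phi> X \<phi>"
        by (rule Q.fibre_refl[OF X(1) transformation_closed[OF t X]])
    qed
    show "transformation_le small P Q \<Phi> \<Xi>"
      if "cartesian_transformation small P Q \<Phi>" "cartesian_transformation small P Q \<Psi>"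
        "cartesian_transformation small P Q \<Xi>"
        "transformation_le small P Q \<Phi> \<Psi>" "transformation_le small P Q \<Psi> \<Xi>" for \<Phi> \<Psi> \<Xi>
      unfolding transformation_le_def
    proof (intro allI impI ballI)
      fix X \<phi> assume X: "small X" "\<phi> \<in> carrier (fibre P X)"
      show "\<Phi> X \<phi> \<sqsubseteq>\<^bsub>fibre Q X\<^esub> \<Xi> X \<phi>"
      proof (rule Q.fibre_trans[of X _ "\<Psi> X \<phi>"])
        show "\<Phi> X \<phi> \<in> carrier (fibre Q X)" "\<Psi> X \<phi> \<in> carrier (fibre Q X)"
          "\<Xi> X \<phi> \<in> carrier (fibre Q X)"
          using X that(1-3) transformation_closed[of small P Q]
          by (simp_all add: cartesian_transformation_def)
        show "\<Phi> X \<phi> \<sqsubseteq>\<^bsub>fibre Q X\<^esub> \<Psi> X \<phi>" "\<Psi> X \<phi> \<sqsubseteq>\<^bsub>fibre Q X\<^esub> \<Xi> X \<phi>"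
          using X that(4,5) by (auto simp: transformation_le_def)
      qed (fact X)
    qed
  qed
next
  fix P :: "('a, 'b) indexed_preorder" assume "P \<in> Ob (Trip_cart small)"
  then show "Id (Trip_cart small) P \<in> carrier (Hom (Trip_cart small) P P)"
    using cartesian_id by simp
next
  fix P Q R :: "('a, 'b) indexed_preorder" and \<Phi> \<Psi>
  assume "P \<in> Ob (Trip_cart small)" "Q \<in> Ob (Trip_cart small)" "R \<in> Ob (Trip_cart small)"
    "\<Phi> \<in> carrier (Hom (Trip_cart small) P Q)" "\<Psi> \<in> carrier (Hom (Trip_cart small) Q R)"
  then show "Comp (Trip_cart small) P Q R \<Psi> \<Phi> \<in> carrier (Hom (Trip_cart small) P R)"
    using cartesian_comp[of small P Q R \<Phi> \<Psi>] by simp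
next
  fix P Q R :: "('a, 'b) indexed_preorder" and \<Phi> \<Phi>' \<Psi> \<Psi>'
  assume *: "P \<in> Ob (Trip_cart small)" "Q \<in> Ob (Trip_cart small)" "R \<in> Ob (Trip_cart small)"
    "\<Phi> \<in> carrier (Hom (Trip_cart small) P Q)" "\<Phi>' \<in> carrier (Hom (Trip_cart small) P Q)"
    "\<Phi> \<sqsubseteq>\<^bsub>Hom (Trip_cart small) P Q\<^esub> \<Phi>'"
    "\<Psi> \<in> carrier (Hom (Trip_cart small) Q R)" "\<Psi>' \<in> carrier (Hom (Trip_cart small) Q R)"
    "\<Psi> \<sqsubseteq>\<^bsub>Hom (Trip_cart small) Q R\<^esub> \<Psi>'"
  then interpret P: tripos small P + Q: tripos small Q + R: tripos small R by simp_all
  have t: "transformation small P Q \<Phi>" "transformation small P Q \<Phi>'"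
    "transformation small Q R \<Psi>" "transformation small Q R \<Psi>'"
    and le: "transformation_le small P Q \<Phi> \<Phi>'" "transformation_le small Q R \<Psi> \<Psi>'"
    using * by (simp_all add: cartesian_transformation_def)
  have "transformation_le small P R (comp_transformation small P \<Psi> \<Phi>)
      (comp_transformation small P \<Psi>' \<Phi>')"
    unfolding transformation_le_def
  proof (intro allI impI ballI)
    fix X \<phi> assume X: "small X" "\<phi> \<in> carrier (fibre P X)"
    have c: "\<Phi> X \<phi> \<in> carrier (fibre Q X)" "\<Phi>' X \<phi> \<in> carrier (fibre Q X)"
      by (rule transformation_closed[OF t(1) X] transformation_closed[OF t(2) X])+
    have "\<Psi> X (\<Phi> X \<phi>) \<sqsubseteq>\<^bsub>fibre R X\<^esub> \<Psi> X (\<Phi>' X \<phi>)"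
      using monotone_mapD(2)[OF transformationD(2)[OF t(3) X(1)] c] le(1) X
      by (simp add: transformation_le_def)
    moreover have "\<Psi> X (\<Phi>' X \<phi>) \<sqsubseteq>\<^bsub>fibre R X\<^esub> \<Psi>' X (\<Phi>' X \<phi>)"
      using le(2) X c by (simp add: transformation_le_def)
    ultimately have "\<Psi> X (\<Phi> X \<phi>) \<sqsubseteq>\<^bsub>fibre R X\<^esub> \<Psi>' X (\<Phi>' X \<phi>)"
      by (rule R.fibre_trans[OF X(1) transformation_closed[OF t(3) X(1) c(1)]
            transformation_closed[OF t(3) X(1) c(2)] transformation_closed[OF t(4) X(1) c(2)]])
    then show "comp_transformation small P \<Psi> \<Phi> X \<phi> \<sqsubseteq>\<^bsub>fibre R X\<^esub>
        comp_transformation small P \<Psi>' \<Phi>' X \<phi>"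
      using X by (simp add: compose_eq)
  qed
  then show "Comp (Trip_cart small) P Q R \<Psi> \<Phi> \<sqsubseteq>\<^bsub>Hom (Trip_cart small) P R\<^esub>
      Comp (Trip_cart small) P Q R \<Psi>' \<Phi>'"
    by simp
next
  fix P Q :: "('a, 'b) indexed_preorder" and \<Phi> assume "\<Phi> \<in> carrier (Hom (Trip_cart small) P Q)"
  then have t: "transformation small P Q \<Phi>"
    by (simp add: cartesian_transformation_def)
  note ext = transformation_extensional[OF t]
  have "comp_transformation small P (id_transformation small Q) \<Phi> = \<Phi>"
  proof (rule extensionalityI[OF restrict_extensional ext(1)])
    fix X assume "X \<in> Collect small"
    then show "comp_transformation small P (id_transformation small Q) \<Phi> X = \<Phi> X"
      using Id_compose_PiE[OF transformationD(1)[OF t]] by simp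
  qed
  then show "Comp (Trip_cart small) P Q Q (Id (Trip_cart small) Q) \<Phi> = \<Phi>"
    by simp
  have "comp_transformation small P \<Phi> (id_transformation small P) = \<Phi>"
  proof (rule extensionalityI[OF restrict_extensional ext(1)])
    fix X assume "X \<in> Collect small"
    then show "comp_transformation small P \<Phi> (id_transformation small P) X = \<Phi> X"
      using compose_PiE_Id[OF transformationD(1)[OF t]] by simp
  qed
  then show "Comp (Trip_cart small) P P Q \<Phi> (Id (Trip_cart small) P) = \<Phi>"
    by simp
next
  fix P Q R S :: "('a, 'b) indexed_preorder" and \<Phi> \<Psi> \<Xi> :: "'a set \<Rightarrow> 'b \<Rightarrow> 'b"
  assume *: "\<Phi> \<in> carrier (Hom (Trip_cart small) P Q)"
  then have "transformation small P Q \<Phi>"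
    by (simp add: cartesian_transformation_def)
  then have "\<Phi> X \<phi> \<in> carrier (fibre Q X)" if "small X" "\<phi> \<in> carrier (fibre P X)" for X \<phi>
    using that by (rule transformation_closed)
  then have "comp_transformation small P (comp_transformation small Q \<Xi> \<Psi>) \<Phi> =
      comp_transformation small P \<Xi> (comp_transformation small P \<Psi> \<Phi>)"
    by (auto simp: fun_eq_iff compose_def restrict_def)
  then show "Comp (Trip_cart small) P Q S (Comp (Trip_cart small) Q R S \<Xi> \<Psi>) \<Phi> =
      Comp (Trip_cart small) P R S \<Xi> (Comp (Trip_cart small) P Q R \<Psi> \<Phi>)"
    by simp
qed

lemma preorder_enriched_Trip_geom: "preorder_enriched_category (Trip_geom small)"
  unfolding Trip_geom_def
  by (rule preorder_enriched_wide_subcat[OF preorder_enriched_Trip_cart])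
    (simp_all add: geometric_id geometric_comp)

section \<open>Implicative morphisms\<close>

text \<open>
  The third condition on an implicative morphism speaks of sets of pairs. A set of pairs indexes the
  family of its own implications, to which the calculus of uniform truth applies.
\<close>

lemma holds_pairs_iff:
  "\<Sqinter>\<^bsub>A\<^esub> {f a \<leadsto>\<^bsub>A\<^esub> g a' | a a'. (a, a') \<in> X} \<in> sep A \<longleftrightarrow>
    holds A X (\<lambda>p. f (fst p) \<leadsto>\<^bsub>A\<^esub> g (snd p))"
proof -
  have "{f a \<leadsto>\<^bsub>A\<^esub> g a' | a a'. (a, a') \<in> X} = (\<lambda>p. f (fst p) \<leadsto>\<^bsub>A\<^esub> g (snd p)) ` X"
    by force
  then show ?thesis
    by (simp add: holds_def)
qed

lemma morphism_le_iff:
  "morphism_le A B f g \<longleftrightarrow> holds B (carrier A) (\<lambda>a. f a \<leadsto>\<^bsub>B\<^esub> g a)"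
  by (simp add: morphism_le_def holds_def setcompr_eq_image)

lemma fst_closed: "p \<in> X \<times> Y \<Longrightarrow> fst p \<in> X"
  and snd_closed: "p \<in> X \<times> Y \<Longrightarrow> snd p \<in> Y"
  by auto

lemma arrow_logicI: "\<lbrakk>set_universe small; arrow_algebra small A\<rbrakk> \<Longrightarrow> arrow_logic small A"
  by (simp add: arrow_logic_def)

locale arrow_logic_pair = A: arrow_logic small A + B: arrow_logic small B
  for small :: "'u set \<Rightarrow> bool" and A B :: "'u arrow_structure"
begin

lemma implicative_morphismI:
  assumes f: "f \<in> carrier A \<rightarrow>\<^sub>E carrier B"
    and sep: "\<And>a. a \<in> sep A \<Longrightarrow> f a \<in> sep B"
    and arr: "holds B (carrier A \<times> carrier A)
      (\<lambda>p. f (fst p \<leadsto>\<^bsub>A\<^esub> snd p) \<leadsto>\<^bsub>B\<^esub> f (fst p) \<leadsto>\<^bsub>B\<^esub> f (snd p))"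
    and holds: "\<And>X. \<lbrakk>X \<subseteq> carrier A \<times> carrier A; holds A X (\<lambda>p. fst p \<leadsto>\<^bsub>A\<^esub> snd p)\<rbrakk>
      \<Longrightarrow> holds B X (\<lambda>p. f (fst p) \<leadsto>\<^bsub>B\<^esub> f (snd p))"
  shows "implicative_morphism A B f"
  unfolding implicative_morphism_def
proof (intro conjI allI impI ballI f sep)
  let ?t = "\<lambda>p. f (fst p \<leadsto>\<^bsub>A\<^esub> snd p) \<leadsto>\<^bsub>B\<^esub> f (fst p) \<leadsto>\<^bsub>B\<^esub> f (snd p)"
  have closed: "?t ` (carrier A \<times> carrier A) \<subseteq> carrier B"
    using f by (auto intro!: B.arr_closed A.arr_closed)
  show "\<exists>r\<in>sep B. \<forall>a\<in>carrier A. \<forall>a'\<in>carrier A. r \<sqsubseteq>\<^bsub>B\<^esub> f (a \<leadsto>\<^bsub>A\<^esub> a') \<leadsto>\<^bsub>B\<^esub> f a \<leadsto>\<^bsub>B\<^esub> f a'"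
  proof (intro bexI ballI)
    show "\<Sqinter>\<^bsub>B\<^esub> (?t ` (carrier A \<times> carrier A)) \<in> sep B"
      using arr by (simp add: holds_def)
    show "\<Sqinter>\<^bsub>B\<^esub> (?t ` (carrier A \<times> carrier A)) \<sqsubseteq>\<^bsub>B\<^esub> f (a \<leadsto>\<^bsub>A\<^esub> a') \<leadsto>\<^bsub>B\<^esub> f a \<leadsto>\<^bsub>B\<^esub> f a'"
      if "a \<in> carrier A" "a' \<in> carrier A" for a a'
      using that by (intro B.inf_lower[OF closed] image_eqI[of _ _ "(a, a')"]) auto
  qed
next
  fix X assume X: "X \<subseteq> carrier A \<times> carrier A" "\<Sqinter>\<^bsub>A\<^esub> {a \<leadsto>\<^bsub>A\<^esub> a' | a a'. (a, a') \<in> X} \<in> sep A"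
  have "holds A X (\<lambda>p. fst p \<leadsto>\<^bsub>A\<^esub> snd p)"
    using X(2) holds_pairs_iff[of A "\<lambda>a. a" "\<lambda>a. a" X] by simp
  then show "\<Sqinter>\<^bsub>B\<^esub> {f a \<leadsto>\<^bsub>B\<^esub> f a' | a a'. (a, a') \<in> X} \<in> sep B"
    unfolding holds_pairs_iff by (rule holds[OF X(1)])
qed

end

locale implicative = arrow_logic_pair small A B
  for small :: "'u set \<Rightarrow> bool" and A B :: "'u arrow_structure" +
  fixes f :: "'u \<Rightarrow> 'u"
  assumes morphism: "implicative_morphism A B f"
begin

lemma in_PiE: "f \<in> carrier A \<rightarrow>\<^sub>E carrier B"
  using morphism by (simp add: implicative_morphism_def)

lemma map_closed [simp]: "a \<in> carrier A \<Longrightarrow> f a \<in> carrier B"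
  using in_PiE by auto

lemma map_sep: "a \<in> sep A \<Longrightarrow> f a \<in> sep B"
  using morphism by (simp add: implicative_morphism_def)

text \<open>
  A meet of implications depends only on the set of pairs of premise and conclusion, so the condition on
  sets of pairs covers families with any index set.
\<close>

lemma map_holds:
  assumes h: "holds A J (\<lambda>j. x j \<leadsto>\<^bsub>A\<^esub> y j)"
    and closed: "\<And>j. j \<in> J \<Longrightarrow> x j \<in> carrier A" "\<And>j. j \<in> J \<Longrightarrow> y j \<in> carrier A"
  shows "holds B J (\<lambda>j. f (x j) \<leadsto>\<^bsub>B\<^esub> f (y j))"
proof -
  let ?X = "(\<lambda>j. (x j, y j)) ` J"
  have X: "?X \<subseteq> carrier A \<times> carrier A"
    using closed by auto
  have "holds A ?X (\<lambda>p. fst p \<leadsto>\<^bsub>A\<^esub> snd p)"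
    using h by (subst holds_image_cong[of _ _ "\<lambda>j. x j \<leadsto>\<^bsub>A\<^esub> y j" J]) (auto simp: image_image)
  then have "\<Sqinter>\<^bsub>A\<^esub> {a \<leadsto>\<^bsub>A\<^esub> a' | a a'. (a, a') \<in> ?X} \<in> sep A"
    using holds_pairs_iff[of A "\<lambda>a. a" "\<lambda>a. a" ?X] by simp
  then have "\<Sqinter>\<^bsub>B\<^esub> {f a \<leadsto>\<^bsub>B\<^esub> f a' | a a'. (a, a') \<in> ?X} \<in> sep B"
    using morphism X unfolding implicative_morphism_def by (elim conjE allE[of _ ?X] impE)
  then have "holds B ?X (\<lambda>p. f (fst p) \<leadsto>\<^bsub>B\<^esub> f (snd p))"
    by (simp only: holds_pairs_iff)
  then show ?thesis
    by (subst (asm) holds_image_cong[of _ _ "\<lambda>j. f (x j) \<leadsto>\<^bsub>B\<^esub> f (y j)" J])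
      (auto simp: image_image)
qed

lemma map_arr:
  assumes "\<And>j. j \<in> J \<Longrightarrow> x j \<in> carrier A" "\<And>j. j \<in> J \<Longrightarrow> y j \<in> carrier A"
  shows "holds B J (\<lambda>j. f (x j \<leadsto>\<^bsub>A\<^esub> y j) \<leadsto>\<^bsub>B\<^esub> f (x j) \<leadsto>\<^bsub>B\<^esub> f (y j))"
proof -
  have "\<exists>r\<in>sep B. \<forall>a\<in>carrier A. \<forall>a'\<in>carrier A. r \<sqsubseteq>\<^bsub>B\<^esub> f (a \<leadsto>\<^bsub>A\<^esub> a') \<leadsto>\<^bsub>B\<^esub> f a \<leadsto>\<^bsub>B\<^esub> f a'"
    using morphism unfolding implicative_morphism_def by (elim conjE)
  then obtain r where r: "r \<in> sep B"
      "\<forall>a\<in>carrier A. \<forall>a'\<in>carrier A. r \<sqsubseteq>\<^bsub>B\<^esub> f (a \<leadsto>\<^bsub>A\<^esub> a') \<leadsto>\<^bsub>B\<^esub> f a \<leadsto>\<^bsub>B\<^esub> f a'"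
    by (elim bexE)
  show ?thesis
  proof (rule B.holds_if_above_sep[OF r(1)])
    show "r \<sqsubseteq>\<^bsub>B\<^esub> f (x j \<leadsto>\<^bsub>A\<^esub> y j) \<leadsto>\<^bsub>B\<^esub> f (x j) \<leadsto>\<^bsub>B\<^esub> f (y j)" if "j \<in> J" for j
      using r(2) assms[OF that] by (elim ballE) auto
  qed (simp add: assms)
qed

lemma map_holds2:
  assumes h: "holds A J (\<lambda>j. x j \<leadsto>\<^bsub>A\<^esub> y j \<leadsto>\<^bsub>A\<^esub> z j)"
    and closed: "\<And>j. j \<in> J \<Longrightarrow> x j \<in> carrier A" "\<And>j. j \<in> J \<Longrightarrow> y j \<in> carrier A"
      "\<And>j. j \<in> J \<Longrightarrow> z j \<in> carrier A"
  shows "holds B J (\<lambda>j. f (x j) \<leadsto>\<^bsub>B\<^esub> f (y j) \<leadsto>\<^bsub>B\<^esub> f (z j))"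
proof -
  have "holds B J (\<lambda>j. f (x j) \<leadsto>\<^bsub>B\<^esub> f (y j \<leadsto>\<^bsub>A\<^esub> z j))"
    by (rule map_holds[OF h]) (use closed in simp_all)
  then show ?thesis
    by (rule B.holds_trans[OF _ map_arr]) (use closed in simp_all)
qed

lemma map_conj:
  assumes "\<And>j. j \<in> J \<Longrightarrow> x j \<in> carrier A" "\<And>j. j \<in> J \<Longrightarrow> y j \<in> carrier A"
  shows "holds B J (\<lambda>j. B.conj (f (x j)) (f (y j)) \<leadsto>\<^bsub>B\<^esub> f (A.conj (x j) (y j)))"
proof -
  have "holds B J (\<lambda>j. f (x j) \<leadsto>\<^bsub>B\<^esub> f (y j) \<leadsto>\<^bsub>B\<^esub> f (A.conj (x j) (y j)))"
    by (rule map_holds2[OF A.holds_pair]) (use assms in simp_all)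
  then show ?thesis
    by (subst (asm) B.holds_arr_iff) (use assms in simp_all)
qed

end

lemma implicative_id:
  assumes "arrow_logic small A"
  shows "implicative_morphism A A (\<lambda>a\<in>carrier A. a)"
proof -
  interpret A: arrow_logic small A by fact
  interpret arrow_logic_pair small A A by unfold_locales
  show ?thesis
  proof (rule implicative_morphismI)
    have "holds A (carrier A \<times> carrier A)
        (\<lambda>p. (fst p \<leadsto>\<^bsub>A\<^esub> snd p) \<leadsto>\<^bsub>A\<^esub> fst p \<leadsto>\<^bsub>A\<^esub> snd p)"
      by (rule A.holds_I) auto
    then show "holds A (carrier A \<times> carrier A)
        (\<lambda>p. (\<lambda>a\<in>carrier A. a) (fst p \<leadsto>\<^bsub>A\<^esub> snd p) \<leadsto>\<^bsub>A\<^esub>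
          (\<lambda>a\<in>carrier A. a) (fst p) \<leadsto>\<^bsub>A\<^esub> (\<lambda>a\<in>carrier A. a) (snd p))"
      by (simp add: fst_closed snd_closed)
  next
    fix X assume X: "X \<subseteq> carrier A \<times> carrier A" "holds A X (\<lambda>p. fst p \<leadsto>\<^bsub>A\<^esub> snd p)"
    have "fst p \<in> carrier A" "snd p \<in> carrier A" if "p \<in> X" for p
      using that X(1) by auto
    then show "holds A X (\<lambda>p. (\<lambda>a\<in>carrier A. a) (fst p) \<leadsto>\<^bsub>A\<^esub> (\<lambda>a\<in>carrier A. a) (snd p))"
      using X(2) by simp
  qed auto
qed

lemma implicative_comp:
  assumes "implicative small A B f" "implicative small B C g"
  shows "implicative_morphism A C (compose (carrier A) g f)"
proof -
  interpret f: implicative small A B f by fact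
  interpret g: implicative small B C g by fact
  interpret arrow_logic_pair small A C by unfold_locales
  show ?thesis
  proof (rule implicative_morphismI)
    show "compose (carrier A) g f \<in> carrier A \<rightarrow>\<^sub>E carrier C"
      by (rule compose_in_fibre[OF g.in_PiE f.in_PiE])
    show "compose (carrier A) g f a \<in> sep C" if "a \<in> sep A" for a
      using that by (simp add: compose_eq f.map_sep g.map_sep)
    let ?P = "carrier A \<times> carrier A"
    have "holds C ?P (\<lambda>p. g (f (fst p \<leadsto>\<^bsub>A\<^esub> snd p)) \<leadsto>\<^bsub>C\<^esub> g (f (fst p)) \<leadsto>\<^bsub>C\<^esub> g (f (snd p)))"
      by (rule g.map_holds2[OF f.map_arr]) auto
    then show "holds C ?P (\<lambda>p. compose (carrier A) g f (fst p \<leadsto>\<^bsub>A\<^esub> snd p) \<leadsto>\<^bsub>C\<^esub>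
        compose (carrier A) g f (fst p) \<leadsto>\<^bsub>C\<^esub> compose (carrier A) g f (snd p))"
      by (simp add: fst_closed snd_closed compose_eq)
  next
    fix X assume X: "X \<subseteq> carrier A \<times> carrier A" "holds A X (\<lambda>p. fst p \<leadsto>\<^bsub>A\<^esub> snd p)"
    then have c: "fst p \<in> carrier A" "snd p \<in> carrier A" if "p \<in> X" for p
      using that by auto
    have "holds C X (\<lambda>p. g (f (fst p)) \<leadsto>\<^bsub>C\<^esub> g (f (snd p)))"
      by (rule g.map_holds[OF f.map_holds[OF X(2)]]) (use c in simp_all)
    then show "holds C X (\<lambda>p. compose (carrier A) g f (fst p) \<leadsto>\<^bsub>C\<^esub>
        compose (carrier A) g f (snd p))"
      using c by (simp add: compose_eq)
  qed
qed

lemma ArrAlg_simps [simp]: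
  "Ob (ArrAlg small) = {A. arrow_algebra small A}"
  "carrier (Hom (ArrAlg small) A B) = {f. implicative_morphism A B f}"
  "f \<sqsubseteq>\<^bsub>Hom (ArrAlg small) A B\<^esub> g \<longleftrightarrow> morphism_le A B f g"
  "f .=\<^bsub>Hom (ArrAlg small) A B\<^esub> g \<longleftrightarrow> morphism_le A B f g \<and> morphism_le A B g f"
  "Id (ArrAlg small) A = (\<lambda>a\<in>carrier A. a)"
  "Comp (ArrAlg small) A B C g f = compose (carrier A) g f"
  by (simp_all add: ArrAlg_def preord_def)

context set_universe
begin

lemma implicativeI:
  "\<lbrakk>arrow_algebra small A; arrow_algebra small B; implicative_morphism A B f\<rbrakk>
    \<Longrightarrow> implicative small A B f"
  using set_universe_axioms
  by (simp add: implicative_def implicative_axioms_def arrow_logic_pair_def arrow_logic_def)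

lemma morphism_le_trans:
  assumes "arrow_algebra small B" "morphism_le A B f g" "morphism_le A B g h"
    and "f \<in> carrier A \<rightarrow> carrier B" "g \<in> carrier A \<rightarrow> carrier B" "h \<in> carrier A \<rightarrow> carrier B"
  shows "morphism_le A B f h"
proof -
  interpret B: arrow_logic small B
    by (rule arrow_logicI[OF set_universe_axioms assms(1)])
  show ?thesis
    unfolding morphism_le_iff
    by (rule B.holds_trans[OF assms(2,3)[unfolded morphism_le_iff]]) (use assms(4-6) in auto)
qed

lemma morphism_le_comp:
  assumes "implicative small A B f" "implicative small A B f'"
    "implicative small B C g" "implicative small B C g'"
    and "morphism_le A B f f'" "morphism_le B C g g'"
  shows "morphism_le A C (compose (carrier A) g f) (compose (carrier A) g' f')"
proof -
  interpret f: implicative small A B f by fact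
  interpret f': implicative small A B f' by fact
  interpret g: implicative small B C g by fact
  interpret g': implicative small B C g' by fact
  have "holds C (carrier A) (\<lambda>a. g (f a) \<leadsto>\<^bsub>C\<^esub> g (f' a))"
    by (rule g.map_holds[OF assms(5)[unfolded morphism_le_iff]]) simp_all
  moreover have "holds C (carrier A) (\<lambda>a. g (f' a) \<leadsto>\<^bsub>C\<^esub> g' (f' a))"
    by (rule g.B.holds_reindex[OF assms(6)[unfolded morphism_le_iff]]) simp_all
  ultimately have "holds C (carrier A) (\<lambda>a. g (f a) \<leadsto>\<^bsub>C\<^esub> g' (f' a))"
    by (rule g.B.holds_trans) simp_all
  then show ?thesis
    by (simp add: morphism_le_iff compose_eq)
qed

lemma preorder_enriched_ArrAlg: "preorder_enriched_category (ArrAlg small)"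
proof (rule preorder_enriched_category.intro)
  fix A B :: "'u arrow_structure"
  assume "A \<in> Ob (ArrAlg small)" "B \<in> Ob (ArrAlg small)"
  then have AB: "arrow_algebra small A" "arrow_algebra small B" by simp_all
  interpret B: arrow_logic small B
    by (rule arrow_logicI[OF set_universe_axioms AB(2)])
  show "weak_partial_order (Hom (ArrAlg small) A B)"
    unfolding ArrAlg_def penr_cat.simps
  proof (rule weak_partial_order_preord; unfold mem_Collect_eq)
    fix f assume "implicative_morphism A B f"
    then interpret f: implicative small A B f
      by (rule implicativeI[OF AB])
    show "morphism_le A B f f"
      unfolding morphism_le_iff by (rule B.holds_I) simp
  next
    fix f g h assume *: "implicative_morphism A B f" "implicative_morphism A B g"
      "implicative_morphism A B h" "morphism_le A B f g" "morphism_le A B g h"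
    show "morphism_le A B f h"
      by (rule morphism_le_trans[OF AB(2) *(4,5)])
        (use *(1-3) in \<open>auto simp: implicative_morphism_def\<close>)
  qed
next
  fix A assume "A \<in> Ob (ArrAlg small)"
  then show "Id (ArrAlg small) A \<in> carrier (Hom (ArrAlg small) A A)"
    using implicative_id[OF arrow_logicI[OF set_universe_axioms, of A]] by simp
next
  fix A B C f g
  assume "A \<in> Ob (ArrAlg small)" "B \<in> Ob (ArrAlg small)" "C \<in> Ob (ArrAlg small)"
    "f \<in> carrier (Hom (ArrAlg small) A B)" "g \<in> carrier (Hom (ArrAlg small) B C)"
  then show "Comp (ArrAlg small) A B C g f \<in> carrier (Hom (ArrAlg small) A C)"
    using implicative_comp[OF implicativeI implicativeI, of A B f C g] by simp
next
  fix A B C f f' g g'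
  assume "A \<in> Ob (ArrAlg small)" "B \<in> Ob (ArrAlg small)" "C \<in> Ob (ArrAlg small)"
    "f \<in> carrier (Hom (ArrAlg small) A B)" "f' \<in> carrier (Hom (ArrAlg small) A B)"
    "f \<sqsubseteq>\<^bsub>Hom (ArrAlg small) A B\<^esub> f'"
    "g \<in> carrier (Hom (ArrAlg small) B C)" "g' \<in> carrier (Hom (ArrAlg small) B C)"
    "g \<sqsubseteq>\<^bsub>Hom (ArrAlg small) B C\<^esub> g'"
  then show "Comp (ArrAlg small) A B C g f \<sqsubseteq>\<^bsub>Hom (ArrAlg small) A C\<^esub>
      Comp (ArrAlg small) A B C g' f'"
    using morphism_le_comp[OF implicativeI implicativeI implicativeI implicativeI, of A B f f' C g g']
    by simp
next
  fix A B f assume "f \<in> carrier (Hom (ArrAlg small) A B)"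
  then have f: "f \<in> carrier A \<rightarrow>\<^sub>E carrier B"
    by (simp add: implicative_morphism_def)
  show "Comp (ArrAlg small) A B B (Id (ArrAlg small) B) f = f"
    using Id_compose_PiE[OF f] by simp
  show "Comp (ArrAlg small) A A B f (Id (ArrAlg small) A) = f"
    using compose_PiE_Id[OF f] by simp
next
  fix A B C D f g h assume "f \<in> carrier (Hom (ArrAlg small) A B)"
  then have "f \<in> carrier A \<rightarrow>\<^sub>E carrier B"
    by (simp add: implicative_morphism_def)
  then show "Comp (ArrAlg small) A B D (Comp (ArrAlg small) B C D h g) f =
      Comp (ArrAlg small) A C D h (Comp (ArrAlg small) A B C g f)"
    by (auto simp: fun_eq_iff compose_def restrict_def)
qed

lemma morphism_le_refl:
  assumes "arrow_algebra small B" "f \<in> carrier A \<rightarrow> carrier B"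
  shows "morphism_le A B f f"
proof -
  interpret B: arrow_logic small B
    by (rule arrow_logicI[OF set_universe_axioms assms(1)])
  show ?thesis
    unfolding morphism_le_iff by (rule B.holds_I) (use assms(2) in auto)
qed

lemma computationally_dense_id:
  assumes "arrow_algebra small A"
  shows "computationally_dense A A (\<lambda>a\<in>carrier A. a)"
proof -
  have "(\<lambda>a\<in>carrier A. a) \<in> carrier A \<rightarrow>\<^sub>E carrier A"
    by auto
  then show ?thesis
    unfolding computationally_dense_def
    using implicative_id[OF arrow_logicI[OF set_universe_axioms assms]]
      morphism_le_refl[OF assms, of "\<lambda>a\<in>carrier A. a" A]
    by (intro exI[of _ "\<lambda>a\<in>carrier A. a"]) simp
qed

text \<open>
  Adjunctions compose: if \<open>h\<close> is right adjoint to \<open>f\<close> and \<open>k\<close> to \<open>g\<close>, then \<open>h k\<close> is right adjoint to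
  \<open>g f\<close>.
\<close>

lemma computationally_dense_comp:
  assumes f: "implicative small A B f" "computationally_dense A B f"
    and g: "implicative small B C g" "computationally_dense B C g"
  shows "computationally_dense A C (compose (carrier A) g f)"
proof -
  interpret f: implicative small A B f by fact
  interpret g: implicative small B C g by fact
  obtain h where h: "implicative_morphism B A h"
      "morphism_le B B (compose (carrier B) f h) (\<lambda>b\<in>carrier B. b)"
      "morphism_le A A (\<lambda>a\<in>carrier A. a) (compose (carrier A) h f)"
    using f(2) by (auto simp: computationally_dense_def)
  obtain k where k: "implicative_morphism C B k"
      "morphism_le C C (compose (carrier C) g k) (\<lambda>c\<in>carrier C. c)"
      "morphism_le B B (\<lambda>b\<in>carrier B. b) (compose (carrier B) k g)"
    using g(2) by (auto simp: computationally_dense_def)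
  interpret h: implicative small B A h
    by (rule implicativeI[OF f.B.arrow_algebra_axioms f.A.arrow_algebra_axioms h(1)])
  interpret k: implicative small C B k
    by (rule implicativeI[OF g.B.arrow_algebra_axioms f.B.arrow_algebra_axioms k(1)])
  have fh: "holds B (carrier B) (\<lambda>b. f (h b) \<leadsto>\<^bsub>B\<^esub> b)"
    and hf: "holds A (carrier A) (\<lambda>a. a \<leadsto>\<^bsub>A\<^esub> h (f a))"
    using h(2,3) by (simp_all add: morphism_le_iff compose_eq)
  have gk: "holds C (carrier C) (\<lambda>c. g (k c) \<leadsto>\<^bsub>C\<^esub> c)"
    and kg: "holds B (carrier B) (\<lambda>b. b \<leadsto>\<^bsub>B\<^esub> k (g b))"
    using k(2,3) by (simp_all add: morphism_le_iff compose_eq)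
  have "holds B (carrier C) (\<lambda>c. f (h (k c)) \<leadsto>\<^bsub>B\<^esub> k c)"
    by (rule f.B.holds_reindex[OF fh]) simp_all
  then have "holds C (carrier C) (\<lambda>c. g (f (h (k c))) \<leadsto>\<^bsub>C\<^esub> g (k c))"
    by (rule g.map_holds) simp_all
  then have le1: "holds C (carrier C) (\<lambda>c. g (f (h (k c))) \<leadsto>\<^bsub>C\<^esub> c)"
    by (rule g.B.holds_trans[OF _ gk]) simp_all
  have "holds B (carrier A) (\<lambda>a. f a \<leadsto>\<^bsub>B\<^esub> k (g (f a)))"
    by (rule f.B.holds_reindex[OF kg]) simp_all
  then have "holds A (carrier A) (\<lambda>a. h (f a) \<leadsto>\<^bsub>A\<^esub> h (k (g (f a))))"
    by (rule h.map_holds) simp_all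
  then have le2: "holds A (carrier A) (\<lambda>a. a \<leadsto>\<^bsub>A\<^esub> h (k (g (f a))))"
    by (rule f.A.holds_trans[OF hf]) simp_all
  show ?thesis
    unfolding computationally_dense_def
  proof (intro exI conjI)
    show "implicative_morphism C A (compose (carrier C) h k)"
      by (rule implicative_comp[OF k.implicative_axioms h.implicative_axioms])
  qed (use le1 le2 in \<open>simp_all add: morphism_le_iff compose_eq\<close>)
qed

lemma preorder_enriched_ArrAlg_cd: "preorder_enriched_category (ArrAlg_cd small)"
  unfolding ArrAlg_cd_def
proof (rule preorder_enriched_wide_subcat[OF preorder_enriched_ArrAlg])
  fix A B C f g
  assume "A \<in> Ob (ArrAlg small)" "B \<in> Ob (ArrAlg small)" "C \<in> Ob (ArrAlg small)"
    "f \<in> carrier (Hom (ArrAlg small) A B)" "g \<in> carrier (Hom (ArrAlg small) B C)"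
    "computationally_dense A B f" "computationally_dense B C g"
  then show "computationally_dense A C (Comp (ArrAlg small) A B C g f)"
    using computationally_dense_comp[OF implicativeI _ implicativeI, of A B f C g] by simp
qed (simp add: computationally_dense_id)

end

section \<open>From morphisms to transformations\<close>

lemma postcomp_apply [simp]:
  "\<lbrakk>small I; \<phi> \<in> I \<rightarrow>\<^sub>E carrier A\<rbrakk> \<Longrightarrow> \<Phi>\<^sup>+ small A B f I \<phi> = compose I f \<phi>"
  by (simp add: postcomp_transformation_def)

context implicative
begin

lemma transformation_postcomp:
  "transformation small (arrow_tripos A) (arrow_tripos B) (\<Phi>\<^sup>+ small A B f)"
  unfolding transformation_def
proof (intro conjI allI impI)
  show "\<Phi>\<^sup>+ small A B f \<in> (\<Pi>\<^sub>E I\<in>Collect small.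
      carrier (fibre (arrow_tripos A) I) \<rightarrow>\<^sub>E carrier (fibre (arrow_tripos B) I))"
    by (simp only: postcomp_transformation_def carrier_arrow_fibre restrict_PiE_iff)
      (intro ballI compose_in_fibre[OF in_PiE])
next
  fix I assume I: "small I"
  show "monotone_map (fibre (arrow_tripos A) I) (fibre (arrow_tripos B) I) (\<Phi>\<^sup>+ small A B f I)"
    unfolding monotone_map_def isotone_def
  proof (intro conjI ballI impI A.weak_partial_order_fibre B.weak_partial_order_fibre)
    show "\<Phi>\<^sup>+ small A B f I \<in> carrier (fibre (arrow_tripos A) I) \<rightarrow> carrier (fibre (arrow_tripos B) I)"
      by (rule funcsetI) (simp add: I compose_in_fibre[OF in_PiE])
    fix \<phi> \<psi> assume *: "\<phi> \<in> carrier (fibre (arrow_tripos A) I)" "\<psi> \<in> carrier (fibre (arrow_tripos A) I)"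
      "\<phi> \<sqsubseteq>\<^bsub>fibre (arrow_tripos A) I\<^esub> \<psi>"
    have "holds B I (\<lambda>i. f (\<phi> i) \<leadsto>\<^bsub>B\<^esub> f (\<psi> i))"
      by (rule map_holds[OF *(3)[unfolded le_arrow_fibre]]) (use * in auto)
    then show "\<Phi>\<^sup>+ small A B f I \<phi> \<sqsubseteq>\<^bsub>fibre (arrow_tripos B) I\<^esub> \<Phi>\<^sup>+ small A B f I \<psi>"
      using * I by (simp add: le_arrow_fibre compose_eq)
  qed
next
  fix I J u \<phi>
  assume "small I \<and> small J \<and> u \<in> I \<rightarrow>\<^sub>E J \<and> \<phi> \<in> carrier (fibre (arrow_tripos A) J)"
  then have *: "small I" "small J" "u \<in> I \<rightarrow>\<^sub>E J" "\<phi> \<in> J \<rightarrow>\<^sub>E carrier A"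
    by simp_all
  have c: "compose I (compose J f \<phi>) u \<in> carrier (fibre (arrow_tripos B) I)"
    using compose_in_fibre[OF compose_in_fibre[OF in_PiE *(4)] *(3)] by simp
  have "compose I f (compose I \<phi> u) = compose I (compose J f \<phi>) u"
    using * by (intro compose_assoc) auto
  then show "\<Phi>\<^sup>+ small A B f I (reindex (arrow_tripos A) I J u \<phi>) .=\<^bsub>fibre (arrow_tripos B) I\<^esub>
      reindex (arrow_tripos B) I J u (\<Phi>\<^sup>+ small A B f J \<phi>)"
    using * compose_in_fibre[OF *(4,3)] weak_partial_order.le_refl[OF B.weak_partial_order_fibre c]
    by (simp add: B.eq_arrow_fibre)
qed

text \<open>
  The top element is preserved because \<open>f\<close> maps the separator into the separator, and binary meets
  because \<open>f\<close>, applied to the true implications \<open>x \<leadsto> y \<leadsto> x \<otimes> y\<close>, gives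
  \<open>f x \<leadsto> f y \<leadsto> f (x \<otimes> y)\<close>.
\<close>

lemma cartesian_postcomp:
  "cartesian_transformation small (arrow_tripos A) (arrow_tripos B) (\<Phi>\<^sup>+ small A B f)"
  unfolding cartesian_transformation_def
proof (intro conjI allI impI transformation_postcomp)
  fix I assume I: "small I"
  interpret FA: heyting_preorder "fibre (arrow_tripos A) I" "\<lambda>i\<in>I. A.tt" "\<lambda>i\<in>I. A.ff"
    "\<lambda>\<phi> \<psi>. \<lambda>i\<in>I. A.conj (\<phi> i) (\<psi> i)" "\<lambda>\<phi> \<psi>. \<lambda>i\<in>I. A.disj (\<phi> i) (\<psi> i)"
    "\<lambda>\<phi> \<psi>. \<lambda>i\<in>I. \<phi> i \<leadsto>\<^bsub>A\<^esub> \<psi> i"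
    by (rule A.heyting_preorder_fibre)
  show "preserves_finite_meets (fibre (arrow_tripos A) I) (fibre (arrow_tripos B) I)
      (\<Phi>\<^sup>+ small A B f I)"
  proof (rule preserves_finite_meetsI[OF transformationD(2)[OF transformation_postcomp I]
        FA.tp_closed _ FA.mt_closed])
    fix \<psi> assume "\<psi> \<in> carrier (fibre (arrow_tripos B) I)"
    then have \<psi>: "\<And>i. i \<in> I \<Longrightarrow> \<psi> i \<in> carrier B"
      by auto
    have "holds B I (\<lambda>i. \<psi> i \<leadsto>\<^bsub>B\<^esub> f A.tt)"
      by (rule B.holds_mp[OF B.holds_K B.holds_sep]) (use \<psi> in \<open>simp_all add: map_sep\<close>)
    then show "\<psi> \<sqsubseteq>\<^bsub>fibre (arrow_tripos B) I\<^esub> \<Phi>\<^sup>+ small A B f I (\<lambda>i\<in>I. A.tt)"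
      using I FA.tp_closed by (simp add: le_arrow_fibre compose_eq)
  next
    fix \<phi> \<phi>' assume "\<phi> \<in> carrier (fibre (arrow_tripos A) I)" "\<phi>' \<in> carrier (fibre (arrow_tripos A) I)"
    then show "(\<lambda>i\<in>I. A.conj (\<phi> i) (\<phi>' i)) \<sqsubseteq>\<^bsub>fibre (arrow_tripos A) I\<^esub> \<phi> \<and>
        (\<lambda>i\<in>I. A.conj (\<phi> i) (\<phi>' i)) \<sqsubseteq>\<^bsub>fibre (arrow_tripos A) I\<^esub> \<phi>'"
      using FA.le_mt_iff[of \<phi> \<phi>' "\<lambda>i\<in>I. A.conj (\<phi> i) (\<phi>' i)"] FA.mt_closed[of \<phi> \<phi>'] FA.le_refl
      by blast
  next
    fix \<phi> \<phi>' \<psi>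
    assume *: "\<phi> \<in> carrier (fibre (arrow_tripos A) I)" "\<phi>' \<in> carrier (fibre (arrow_tripos A) I)"
      "\<psi> \<in> carrier (fibre (arrow_tripos B) I)"
      and le: "\<psi> \<sqsubseteq>\<^bsub>fibre (arrow_tripos B) I\<^esub> \<Phi>\<^sup>+ small A B f I \<phi>"
      "\<psi> \<sqsubseteq>\<^bsub>fibre (arrow_tripos B) I\<^esub> \<Phi>\<^sup>+ small A B f I \<phi>'"
    have c: "\<And>i. i \<in> I \<Longrightarrow> \<phi> i \<in> carrier A" "\<And>i. i \<in> I \<Longrightarrow> \<phi>' i \<in> carrier A"
      "\<And>i. i \<in> I \<Longrightarrow> \<psi> i \<in> carrier B"
      using * by auto
    have "holds B I (\<lambda>i. \<psi> i \<leadsto>\<^bsub>B\<^esub> f (\<phi> i)) \<and> holds B I (\<lambda>i. \<psi> i \<leadsto>\<^bsub>B\<^esub> f (\<phi>' i))"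
      using le * I by (simp add: le_arrow_fibre compose_eq)
    then have "holds B I (\<lambda>i. \<psi> i \<leadsto>\<^bsub>B\<^esub> B.conj (f (\<phi> i)) (f (\<phi>' i)))"
      by (subst B.holds_conj_iff) (use c in simp_all)
    then have "holds B I (\<lambda>i. \<psi> i \<leadsto>\<^bsub>B\<^esub> f (A.conj (\<phi> i) (\<phi>' i)))"
      by (rule B.holds_trans[OF _ map_conj]) (use c in simp_all)
    then show "\<psi> \<sqsubseteq>\<^bsub>fibre (arrow_tripos B) I\<^esub>
        \<Phi>\<^sup>+ small A B f I (\<lambda>i\<in>I. A.conj (\<phi> i) (\<phi>' i))"
      using I FA.mt_closed[OF *(1,2)] by (simp add: le_arrow_fibre compose_eq)
  qed
qed

end

context set_universe
begin

text \<open>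
  The inequalities \<open>f h \<turnstile> id\<close> and \<open>id \<turnstile> h f\<close> are uniform over all elements of the algebras, so they can
  be reindexed along the elements of any fibre, where they become the counit and the unit.
\<close>

lemma adjoint_postcomp:
  assumes "implicative small A B f" "implicative small B A h"
    and fh: "morphism_le B B (compose (carrier B) f h) (\<lambda>b\<in>carrier B. b)"
    and hf: "morphism_le A A (\<lambda>a\<in>carrier A. a) (compose (carrier A) h f)"
    and I: "small I"
  shows "adjoint_maps (fibre (arrow_tripos A) I) (fibre (arrow_tripos B) I)
    (\<Phi>\<^sup>+ small A B f I) (\<Phi>\<^sup>+ small B A h I)"
proof -
  interpret f: implicative small A B f by fact
  interpret h: implicative small B A h by fact
  show ?thesis
  proof (rule adjoint_mapsI[OF f.A.weak_partial_order_fibre f.B.weak_partial_order_fibre])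
    show "\<Phi>\<^sup>+ small A B f I \<in> carrier (fibre (arrow_tripos A) I) \<rightarrow> carrier (fibre (arrow_tripos B) I)"
      "\<Phi>\<^sup>+ small B A h I \<in> carrier (fibre (arrow_tripos B) I) \<rightarrow> carrier (fibre (arrow_tripos A) I)"
      by (rule funcsetI; simp add: I compose_in_fibre[OF f.in_PiE] compose_in_fibre[OF h.in_PiE])+
  next
    fix \<phi> \<psi>
    assume *: "\<phi> \<in> carrier (fibre (arrow_tripos A) I)" "\<psi> \<in> carrier (fibre (arrow_tripos B) I)"
    then have c: "\<And>i. i \<in> I \<Longrightarrow> \<phi> i \<in> carrier A" "\<And>i. i \<in> I \<Longrightarrow> \<psi> i \<in> carrier B"
      by auto
    have fh': "holds B I (\<lambda>i. f (h (\<psi> i)) \<leadsto>\<^bsub>B\<^esub> \<psi> i)"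
    proof -
      have "holds B (carrier B) (\<lambda>b. f (h b) \<leadsto>\<^bsub>B\<^esub> b)"
        using fh by (simp add: morphism_le_iff compose_eq)
      then show ?thesis
        by (rule f.B.holds_reindex) (use c in simp_all)
    qed
    have hf': "holds A I (\<lambda>i. \<phi> i \<leadsto>\<^bsub>A\<^esub> h (f (\<phi> i)))"
    proof -
      have "holds A (carrier A) (\<lambda>a. a \<leadsto>\<^bsub>A\<^esub> h (f a))"
        using hf by (simp add: morphism_le_iff compose_eq)
      then show ?thesis
        by (rule f.A.holds_reindex) (use c in simp_all)
    qed
    have "holds B I (\<lambda>i. f (\<phi> i) \<leadsto>\<^bsub>B\<^esub> \<psi> i) \<longleftrightarrow> holds A I (\<lambda>i. \<phi> i \<leadsto>\<^bsub>A\<^esub> h (\<psi> i))"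
    proof
      assume "holds B I (\<lambda>i. f (\<phi> i) \<leadsto>\<^bsub>B\<^esub> \<psi> i)"
      then have "holds A I (\<lambda>i. h (f (\<phi> i)) \<leadsto>\<^bsub>A\<^esub> h (\<psi> i))"
        by (rule h.map_holds) (use c in simp_all)
      then show "holds A I (\<lambda>i. \<phi> i \<leadsto>\<^bsub>A\<^esub> h (\<psi> i))"
        by (rule f.A.holds_trans[OF hf']) (use c in simp_all)
    next
      assume "holds A I (\<lambda>i. \<phi> i \<leadsto>\<^bsub>A\<^esub> h (\<psi> i))"
      then have "holds B I (\<lambda>i. f (\<phi> i) \<leadsto>\<^bsub>B\<^esub> f (h (\<psi> i)))"
        by (rule f.map_holds) (use c in simp_all)
      then show "holds B I (\<lambda>i. f (\<phi> i) \<leadsto>\<^bsub>B\<^esub> \<psi> i)"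
        by (rule f.B.holds_trans[OF _ fh']) (use c in simp_all)
    qed
    then show "\<Phi>\<^sup>+ small A B f I \<phi> \<sqsubseteq>\<^bsub>fibre (arrow_tripos B) I\<^esub> \<psi> \<longleftrightarrow>
        \<phi> \<sqsubseteq>\<^bsub>fibre (arrow_tripos A) I\<^esub> \<Phi>\<^sup>+ small B A h I \<psi>"
      using * I by (simp add: le_arrow_fibre compose_eq)
  qed
qed

lemma geometric_postcomp:
  assumes "implicative small A B f" "computationally_dense A B f"
  shows "geometric_transformation small (arrow_tripos A) (arrow_tripos B) (\<Phi>\<^sup>+ small A B f)"
proof -
  interpret f: implicative small A B f by fact
  obtain h where h: "implicative_morphism B A h"
      "morphism_le B B (compose (carrier B) f h) (\<lambda>b\<in>carrier B. b)"
      "morphism_le A A (\<lambda>a\<in>carrier A. a) (compose (carrier A) h f)"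
    using assms(2) by (auto simp: computationally_dense_def)
  interpret h: implicative small B A h
    by (rule implicativeI[OF f.B.arrow_algebra_axioms f.A.arrow_algebra_axioms h(1)])
  show ?thesis
    unfolding geometric_transformation_def
    using f.cartesian_postcomp h.transformation_postcomp
      adjoint_postcomp[OF assms(1) h.implicative_axioms h(2,3)]
    by (intro conjI exI[of _ "\<Phi>\<^sup>+ small B A h"]) simp_all
qed

lemma two_functor_postcomp:
  "two_functor (ArrAlg small) (Trip_cart small) arrow_tripos (\<Phi>\<^sup>+ small)"
proof (intro two_functor.intro two_functor_axioms.intro preorder_enriched_ArrAlg
    preorder_enriched_Trip_cart)
  fix A assume A: "A \<in> Ob (ArrAlg small)"
  then interpret A: arrow_logic small A
    by (simp add: arrow_logicI[OF set_universe_axioms])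
  show "arrow_tripos A \<in> Ob (Trip_cart small)"
    using A.tripos_arrow_tripos by simp
  show "\<Phi>\<^sup>+ small A A (Id (ArrAlg small) A) = Id (Trip_cart small) (arrow_tripos A)"
    unfolding postcomp_transformation_def
    by (simp, intro restrict_ext) simp
next
  fix A B assume "A \<in> Ob (ArrAlg small)" "B \<in> Ob (ArrAlg small)"
  then have AB: "arrow_algebra small A" "arrow_algebra small B" by simp_all
  interpret C: preorder_enriched_category "ArrAlg small" by (rule preorder_enriched_ArrAlg)
  interpret D: preorder_enriched_category "Trip_cart small" by (rule preorder_enriched_Trip_cart)
  interpret arrow_logic_pair small A B
    by (intro arrow_logic_pair.intro arrow_logicI[OF set_universe_axioms] AB)
  show "monotone_map (Hom (ArrAlg small) A B) (Hom (Trip_cart small) (arrow_tripos A) (arrow_tripos B))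
      (\<Phi>\<^sup>+ small A B)"
    unfolding monotone_map_def isotone_def
  proof (intro conjI ballI impI)
    show "weak_partial_order (Hom (ArrAlg small) A B)"
      by (rule C.hom_preorder) (simp_all add: AB)
    show "weak_partial_order (Hom (Trip_cart small) (arrow_tripos A) (arrow_tripos B))"
      by (rule D.hom_preorder) (simp_all add: A.tripos_arrow_tripos B.tripos_arrow_tripos)
    show "\<Phi>\<^sup>+ small A B \<in> carrier (Hom (ArrAlg small) A B) \<rightarrow>
        carrier (Hom (Trip_cart small) (arrow_tripos A) (arrow_tripos B))"
      using implicative.cartesian_postcomp[OF implicativeI[OF AB]] by (simp add: Pi_iff)
  next
    fix f g
    assume *: "f \<in> carrier (Hom (ArrAlg small) A B)" "g \<in> carrier (Hom (ArrAlg small) A B)"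
      "f \<sqsubseteq>\<^bsub>Hom (ArrAlg small) A B\<^esub> g"
    interpret f: implicative small A B f
      by (rule implicativeI[OF AB]) (use * in simp)
    interpret g: implicative small A B g
      by (rule implicativeI[OF AB]) (use * in simp)
    have le: "holds B (carrier A) (\<lambda>a. f a \<leadsto>\<^bsub>B\<^esub> g a)"
      using * by (simp add: morphism_le_iff)
    have "transformation_le small (arrow_tripos A) (arrow_tripos B) (\<Phi>\<^sup>+ small A B f)
        (\<Phi>\<^sup>+ small A B g)"
      unfolding transformation_le_def
    proof (intro allI impI ballI)
      fix I \<phi> assume I: "small I" "\<phi> \<in> carrier (fibre (arrow_tripos A) I)"
      have "holds B I (\<lambda>i. f (\<phi> i) \<leadsto>\<^bsub>B\<^esub> g (\<phi> i))"
        by (rule B.holds_reindex[OF le]) (use I in auto)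
      then show "\<Phi>\<^sup>+ small A B f I \<phi> \<sqsubseteq>\<^bsub>fibre (arrow_tripos B) I\<^esub> \<Phi>\<^sup>+ small A B g I \<phi>"
        using I by (simp add: le_arrow_fibre compose_eq)
    qed
    then show "\<Phi>\<^sup>+ small A B f \<sqsubseteq>\<^bsub>Hom (Trip_cart small) (arrow_tripos A) (arrow_tripos B)\<^esub>
        \<Phi>\<^sup>+ small A B g"
      by simp
  qed
next
  fix A B C f g
  assume "f \<in> carrier (Hom (ArrAlg small) A B)"
  then have f: "f \<in> carrier A \<rightarrow>\<^sub>E carrier B"
    by (simp add: implicative_morphism_def)
  show "\<Phi>\<^sup>+ small A C (Comp (ArrAlg small) A B C g f) =
      Comp (Trip_cart small) (arrow_tripos A) (arrow_tripos B) (arrow_tripos C)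
        (\<Phi>\<^sup>+ small B C g) (\<Phi>\<^sup>+ small A B f)"
  proof (rule extensionalityI[of _ "Collect small"])
    fix I assume I: "I \<in> Collect small"
    show "\<Phi>\<^sup>+ small A C (Comp (ArrAlg small) A B C g f) I =
        Comp (Trip_cart small) (arrow_tripos A) (arrow_tripos B) (arrow_tripos C)
          (\<Phi>\<^sup>+ small B C g) (\<Phi>\<^sup>+ small A B f) I"
    proof (rule extensionalityI[of _ "I \<rightarrow>\<^sub>E carrier A"])
      fix \<phi> assume \<phi>: "\<phi> \<in> I \<rightarrow>\<^sub>E carrier A"
      have "compose I (compose (carrier A) g f) \<phi> = compose I g (compose I f \<phi>)"
        using \<phi> by (intro compose_assoc[symmetric]) auto
      then show "\<Phi>\<^sup>+ small A C (Comp (ArrAlg small) A B C g f) I \<phi> =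
          Comp (Trip_cart small) (arrow_tripos A) (arrow_tripos B) (arrow_tripos C)
            (\<Phi>\<^sup>+ small B C g) (\<Phi>\<^sup>+ small A B f) I \<phi>"
        using I \<phi> compose_in_fibre[OF f \<phi>] by (simp add: compose_eq)
    qed (use I in \<open>simp_all add: postcomp_transformation_def\<close>)
  qed (simp_all add: postcomp_transformation_def)
qed

lemma two_functor_postcomp_cd:
  "two_functor (ArrAlg_cd small) (Trip_geom small) arrow_tripos (\<Phi>\<^sup>+ small)"
  unfolding ArrAlg_cd_def Trip_geom_def
proof (rule two_functor_wide_subcat[OF two_functor_postcomp
      preorder_enriched_ArrAlg_cd[unfolded ArrAlg_cd_def]
      preorder_enriched_Trip_geom[unfolded Trip_geom_def]])
  fix A B f
  assume "A \<in> Ob (ArrAlg small)" "B \<in> Ob (ArrAlg small)" "f \<in> carrier (Hom (ArrAlg small) A B)"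
    "computationally_dense A B f"
  then show "geometric_transformation small (arrow_tripos A) (arrow_tripos B) (\<Phi>\<^sup>+ small A B f)"
    using geometric_postcomp[OF implicativeI, of A B f] by simp
qed

end


section \<open>From transformations to morphisms\<close>

text \<open>
  The value of \<open>\<Phi>\<close> at the generic element of \<open>P\<^sub>A\<close>.
\<close>

definition induced_map :: "'u arrow_structure \<Rightarrow> ('u set \<Rightarrow> ('u \<Rightarrow> 'u) \<Rightarrow> 'u \<Rightarrow> 'u) \<Rightarrow> 'u \<Rightarrow> 'u" where
  "induced_map A \<Phi> = \<Phi> (carrier A) (\<lambda>a\<in>carrier A. a)"

context arrow_logic_pair
begin

lemma generic_in_fibre: "(\<lambda>a\<in>carrier A. a) \<in> carrier (fibre (arrow_tripos A) (carrier A))"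
  by simp

lemma induced_map_in_PiE:
  assumes "transformation small (arrow_tripos A) (arrow_tripos B) \<Phi>"
  shows "induced_map A \<Phi> \<in> carrier A \<rightarrow>\<^sub>E carrier B"
  using transformation_closed[OF assms A.carrier_small generic_in_fibre]
  by (simp add: induced_map_def)

text \<open>
  Naturality with respect to \<open>\<phi> : I \<rightarrow> A\<close>, as \<open>\<phi>\<close> is the reindexing of the generic element along
  itself. The two halves say that \<open>\<Phi> I \<phi>\<close> is isomorphic to \<open>f \<circ> \<phi>\<close> for the induced map \<open>f\<close>.
\<close>

lemma transformation_eq_induced:
  assumes \<Phi>: "transformation small (arrow_tripos A) (arrow_tripos B) \<Phi>"
    and I: "small I" and \<phi>: "\<phi> \<in> I \<rightarrow>\<^sub>E carrier A"
  shows "holds B I (\<lambda>i. \<Phi> I \<phi> i \<leadsto>\<^bsub>B\<^esub> induced_map A \<Phi> (\<phi> i))"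
    and "holds B I (\<lambda>i. induced_map A \<Phi> (\<phi> i) \<leadsto>\<^bsub>B\<^esub> \<Phi> I \<phi> i)"
proof -
  have "\<Phi> I (reindex (arrow_tripos A) I (carrier A) \<phi> (\<lambda>a\<in>carrier A. a))
      .=\<^bsub>fibre (arrow_tripos B) I\<^esub>
      reindex (arrow_tripos B) I (carrier A) \<phi> (\<Phi> (carrier A) (\<lambda>a\<in>carrier A. a))"
    by (rule transformationD(3)[OF \<Phi> I A.carrier_small \<phi> generic_in_fibre])
  then show "holds B I (\<lambda>i. \<Phi> I \<phi> i \<leadsto>\<^bsub>B\<^esub> induced_map A \<Phi> (\<phi> i))"
    and "holds B I (\<lambda>i. induced_map A \<Phi> (\<phi> i) \<leadsto>\<^bsub>B\<^esub> \<Phi> I \<phi> i)"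
    using \<phi> by (simp_all add: B.eq_arrow_fibre le_arrow_fibre induced_map_def[symmetric] compose_eq)
qed

lemma induced_map_le:
  assumes \<Phi>: "transformation small (arrow_tripos A) (arrow_tripos B) \<Phi>"
    and I: "small I" and \<phi>: "\<phi> \<in> I \<rightarrow>\<^sub>E carrier A" and \<psi>: "\<psi> \<in> I \<rightarrow>\<^sub>E carrier A"
    and le: "holds A I (\<lambda>i. \<phi> i \<leadsto>\<^bsub>A\<^esub> \<psi> i)"
  shows "holds B I (\<lambda>i. induced_map A \<Phi> (\<phi> i) \<leadsto>\<^bsub>B\<^esub> induced_map A \<Phi> (\<psi> i))"
proof -
  have c: "\<And>i. i \<in> I \<Longrightarrow> induced_map A \<Phi> (\<phi> i) \<in> carrier B"
    "\<And>i. i \<in> I \<Longrightarrow> induced_map A \<Phi> (\<psi> i) \<in> carrier B"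
    using induced_map_in_PiE[OF \<Phi>] \<phi> \<psi> by auto
  have \<phi>': "\<phi> \<in> carrier (fibre (arrow_tripos A) I)" and \<psi>': "\<psi> \<in> carrier (fibre (arrow_tripos A) I)"
    using \<phi> \<psi> by simp_all
  have d: "\<And>i. i \<in> I \<Longrightarrow> \<Phi> I \<phi> i \<in> carrier B" "\<And>i. i \<in> I \<Longrightarrow> \<Phi> I \<psi> i \<in> carrier B"
    using transformation_closed[OF \<Phi> I \<phi>'] transformation_closed[OF \<Phi> I \<psi>'] by auto
  have "\<Phi> I \<phi> \<sqsubseteq>\<^bsub>fibre (arrow_tripos B) I\<^esub> \<Phi> I \<psi>"
    by (rule monotone_mapD(2)[OF transformationD(2)[OF \<Phi> I] \<phi>' \<psi>']) (simp add: le_arrow_fibre le)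
  then have "holds B I (\<lambda>i. \<Phi> I \<phi> i \<leadsto>\<^bsub>B\<^esub> \<Phi> I \<psi> i)"
    by (simp add: le_arrow_fibre)
  then have "holds B I (\<lambda>i. induced_map A \<Phi> (\<phi> i) \<leadsto>\<^bsub>B\<^esub> \<Phi> I \<psi> i)"
    by (rule B.holds_trans[OF transformation_eq_induced(2)[OF \<Phi> I \<phi>]]) (use c d in simp_all)
  then show ?thesis
    by (rule B.holds_trans[OF _ transformation_eq_induced(1)[OF \<Phi> I \<psi>]]) (use c d in simp_all)
qed

lemma cartesian_top:
  assumes \<Phi>: "cartesian_transformation small (arrow_tripos A) (arrow_tripos B) \<Phi>"
    and I: "small I"
  shows "holds B I (\<lambda>i. B.tt \<leadsto>\<^bsub>B\<^esub> \<Phi> I (\<lambda>i\<in>I. A.tt) i)"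
proof -
  interpret FA: heyting_preorder "fibre (arrow_tripos A) I" "\<lambda>i\<in>I. A.tt" "\<lambda>i\<in>I. A.ff"
    "\<lambda>\<phi> \<psi>. \<lambda>i\<in>I. A.conj (\<phi> i) (\<psi> i)" "\<lambda>\<phi> \<psi>. \<lambda>i\<in>I. A.disj (\<phi> i) (\<psi> i)"
    "\<lambda>\<phi> \<psi>. \<lambda>i\<in>I. \<phi> i \<leadsto>\<^bsub>A\<^esub> \<psi> i"
    by (rule A.heyting_preorder_fibre)
  have "is_glb (fibre (arrow_tripos A) I) (\<lambda>i\<in>I. A.tt) {}"
    using FA.le_tp FA.tp_closed by (simp only: Lower_empty greatest_def) blast
  then have "is_glb (fibre (arrow_tripos B) I) (\<Phi> I (\<lambda>i\<in>I. A.tt)) (\<Phi> I ` {})"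
    by (rule preserves_finite_meetsD[OF cartesian_transformationD(2)[OF \<Phi> I] finite.emptyI
          empty_subsetI])
  then have "(\<lambda>i\<in>I. B.tt) \<sqsubseteq>\<^bsub>fibre (arrow_tripos B) I\<^esub> \<Phi> I (\<lambda>i\<in>I. A.tt)"
    by (rule greatest_le) simp
  then show ?thesis
    by (simp add: le_arrow_fibre)
qed

lemma cartesian_conj:
  assumes \<Phi>: "cartesian_transformation small (arrow_tripos A) (arrow_tripos B) \<Phi>"
    and I: "small I" and \<phi>: "\<phi> \<in> I \<rightarrow>\<^sub>E carrier A" and \<psi>: "\<psi> \<in> I \<rightarrow>\<^sub>E carrier A"
  shows "holds B I (\<lambda>i. B.conj (\<Phi> I \<phi> i) (\<Phi> I \<psi> i) \<leadsto>\<^bsub>B\<^esub> \<Phi> I (\<lambda>i\<in>I. A.conj (\<phi> i) (\<psi> i)) i)"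
proof -
  interpret FA: heyting_preorder "fibre (arrow_tripos A) I" "\<lambda>i\<in>I. A.tt" "\<lambda>i\<in>I. A.ff"
    "\<lambda>\<phi> \<psi>. \<lambda>i\<in>I. A.conj (\<phi> i) (\<psi> i)" "\<lambda>\<phi> \<psi>. \<lambda>i\<in>I. A.disj (\<phi> i) (\<psi> i)"
    "\<lambda>\<phi> \<psi>. \<lambda>i\<in>I. \<phi> i \<leadsto>\<^bsub>A\<^esub> \<psi> i"
    by (rule A.heyting_preorder_fibre)
  interpret FB: heyting_preorder "fibre (arrow_tripos B) I" "\<lambda>i\<in>I. B.tt" "\<lambda>i\<in>I. B.ff"
    "\<lambda>\<phi> \<psi>. \<lambda>i\<in>I. B.conj (\<phi> i) (\<psi> i)" "\<lambda>\<phi> \<psi>. \<lambda>i\<in>I. B.disj (\<phi> i) (\<psi> i)"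
    "\<lambda>\<phi> \<psi>. \<lambda>i\<in>I. \<phi> i \<leadsto>\<^bsub>B\<^esub> \<psi> i"
    by (rule B.heyting_preorder_fibre)
  let ?FA = "fibre (arrow_tripos A) I" and ?FB = "fibre (arrow_tripos B) I"
  let ?m = "\<lambda>i\<in>I. A.conj (\<phi> i) (\<psi> i)" and ?n = "\<lambda>i\<in>I. B.conj (\<Phi> I \<phi> i) (\<Phi> I \<psi> i)"
  have t: "transformation small (arrow_tripos A) (arrow_tripos B) \<Phi>"
    using \<Phi> by (simp add: cartesian_transformation_def)
  have \<phi>': "\<phi> \<in> carrier ?FA" and \<psi>': "\<psi> \<in> carrier ?FA"
    using \<phi> \<psi> by simp_all
  have c: "\<Phi> I \<phi> \<in> carrier ?FB" "\<Phi> I \<psi> \<in> carrier ?FB"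
    by (rule transformation_closed[OF t I \<phi>'] transformation_closed[OF t I \<psi>'])+
  have "is_glb ?FA ?m {\<phi>, \<psi>}"
  proof (rule greatest_LowerI)
    have "?m \<sqsubseteq>\<^bsub>?FA\<^esub> \<phi> \<and> ?m \<sqsubseteq>\<^bsub>?FA\<^esub> \<psi>"
      using FA.le_mt_iff[OF \<phi>' \<psi>' FA.mt_closed[OF \<phi>' \<psi>']] FA.le_refl[OF FA.mt_closed[OF \<phi>' \<psi>']]
      by (rule iffD1)
    then show "?m \<sqsubseteq>\<^bsub>?FA\<^esub> x" if "x \<in> {\<phi>, \<psi>}" for x
      using that by (elim insertE emptyE) simp_all
  next
    fix y assume "y \<in> Lower ?FA {\<phi>, \<psi>}"
    then have y: "y \<in> carrier ?FA" and le: "y \<sqsubseteq>\<^bsub>?FA\<^esub> \<phi> \<and> y \<sqsubseteq>\<^bsub>?FA\<^esub> \<psi>"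
      using \<phi>' \<psi>' by (simp_all add: Lower_def)
    show "y \<sqsubseteq>\<^bsub>?FA\<^esub> ?m"
      by (rule iffD2[OF FA.le_mt_iff[OF \<phi>' \<psi>' y] le])
  qed (use \<phi>' \<psi>' FA.mt_closed[OF \<phi>' \<psi>'] in simp_all)
  then have "is_glb ?FB (\<Phi> I ?m) (\<Phi> I ` {\<phi>, \<psi>})"
    by (rule preserves_finite_meetsD[OF cartesian_transformationD(2)[OF \<Phi> I], rotated 2])
      (simp_all add: \<phi> \<psi>)
  then have glb: "is_glb ?FB (\<Phi> I ?m) {\<Phi> I \<phi>, \<Phi> I \<psi>}"
    by (simp only: image_insert image_empty)
  have n: "?n \<sqsubseteq>\<^bsub>?FB\<^esub> \<Phi> I \<phi> \<and> ?n \<sqsubseteq>\<^bsub>?FB\<^esub> \<Phi> I \<psi>"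
    using FB.le_mt_iff[OF c FB.mt_closed[OF c]] FB.le_refl[OF FB.mt_closed[OF c]]
    by (rule iffD1)
  have "?n \<in> Lower ?FB {\<Phi> I \<phi>, \<Phi> I \<psi>}"
  proof (rule Lower_memI[OF _ FB.mt_closed[OF c]])
    show "?n \<sqsubseteq>\<^bsub>?FB\<^esub> y" if "y \<in> {\<Phi> I \<phi>, \<Phi> I \<psi>}" for y
      using that n by (elim insertE emptyE) simp_all
  qed
  then have "?n \<sqsubseteq>\<^bsub>?FB\<^esub> \<Phi> I ?m"
    by (rule greatest_le[OF glb])
  then show ?thesis
    by (simp add: le_arrow_fibre)
qed

text \<open>
  For the separator, the relevant fibre is that over a one-element set, where truth of \<open>a\<close> means that
  \<open>a\<close> is above the top element. For the two conditions that involve pairs, it is the fibre over a small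
  set \<open>W\<close> with a bijection \<open>e\<close> onto the relevant set of pairs; on this set the two projections are
  elements of the fibre.
\<close>

lemma implicative_induced_map:
  assumes \<Phi>: "cartesian_transformation small (arrow_tripos A) (arrow_tripos B) \<Phi>"
  shows "implicative_morphism A B (induced_map A \<Phi>)"
proof (rule implicative_morphismI)
  let ?f = "induced_map A \<Phi>"
  have t: "transformation small (arrow_tripos A) (arrow_tripos B) \<Phi>"
    using \<Phi> by (simp add: cartesian_transformation_def)
  show f: "?f \<in> carrier A \<rightarrow>\<^sub>E carrier B"
    by (rule induced_map_in_PiE[OF t])
  then have fc: "?f a \<in> carrier B" if "a \<in> carrier A" for a
    using that by auto
  show "?f a \<in> sep B" if a: "a \<in> sep A" for a
  proof -
    let ?I = "{a}" and ?\<tau> = "\<lambda>i\<in>{a}. A.tt" and ?\<alpha> = "\<lambda>i\<in>{a}. a"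
    have I: "small ?I"
      using A.small_pair[of a a] by simp
    have \<tau>: "?\<tau> \<in> ?I \<rightarrow>\<^sub>E carrier A" and \<alpha>: "?\<alpha> \<in> ?I \<rightarrow>\<^sub>E carrier A"
      using a by simp_all
    (* The implication, unlike a itself, is what can be transported along the transformation. *)
    have "holds A ?I (\<lambda>i. A.tt \<leadsto>\<^bsub>A\<^esub> a)"
      by (rule A.holds_mp[OF A.holds_K A.holds_sep[OF a]]) (use a in simp_all)
    then have le: "holds A ?I (\<lambda>i. ?\<tau> i \<leadsto>\<^bsub>A\<^esub> ?\<alpha> i)"
      by (simp add: holds_def)
    have \<Phi>\<tau>: "\<Phi> ?I ?\<tau> i \<in> carrier B" if "i \<in> ?I" for i
      using transformation_closed[OF t I, of ?\<tau>] \<tau> that by auto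
    have "holds B ?I (\<lambda>i. B.tt \<leadsto>\<^bsub>B\<^esub> ?f (?\<tau> i))"
      by (rule B.holds_trans[OF cartesian_top[OF \<Phi> I] transformation_eq_induced(1)[OF t I \<tau>]])
        (use \<Phi>\<tau> fc in simp_all)
    then have "holds B ?I (\<lambda>i. B.tt \<leadsto>\<^bsub>B\<^esub> ?f (?\<alpha> i))"
      by (rule B.holds_trans[OF _ induced_map_le[OF t I \<tau> \<alpha> le]]) (use a fc in simp_all)
    then have "B.tt \<leadsto>\<^bsub>B\<^esub> ?f (?\<alpha> a) \<in> sep B"
      by (rule B.holds_member) (use a fc in simp_all)
    then have "B.tt \<leadsto>\<^bsub>B\<^esub> ?f a \<in> sep B"
      by simp
    then show ?thesis
      by (rule B.sep_mp[rotated 2]) (use a fc in simp_all)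
  qed
  show "holds B X (\<lambda>p. ?f (fst p) \<leadsto>\<^bsub>B\<^esub> ?f (snd p))"
    if X: "X \<subseteq> carrier A \<times> carrier A" and h: "holds A X (\<lambda>p. fst p \<leadsto>\<^bsub>A\<^esub> snd p)" for X
  proof -
    obtain W e where W: "small W" and e: "bij_betw e W X"
      using A.small_relation_representable[OF A.carrier_small X] by blast
    have eW: "e ` W = X"
      using e by (simp add: bij_betw_def)
    have ec: "fst (e w) \<in> carrier A" "snd (e w) \<in> carrier A" if "w \<in> W" for w
      using that eW X by auto
    let ?\<phi> = "\<lambda>w\<in>W. fst (e w)" and ?\<psi> = "\<lambda>w\<in>W. snd (e w)"
    have "holds A W (\<lambda>w. fst (e w) \<leadsto>\<^bsub>A\<^esub> snd (e w))"
      using h by (subst holds_image_cong[of _ _ "\<lambda>p. fst p \<leadsto>\<^bsub>A\<^esub> snd p" X])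
        (simp_all add: eW[symmetric] image_image)
    then have "holds B W (\<lambda>w. ?f (?\<phi> w) \<leadsto>\<^bsub>B\<^esub> ?f (?\<psi> w))"
      by (intro induced_map_le[OF t W]) (use ec in auto)
    then have "holds B W (\<lambda>w. ?f (fst (e w)) \<leadsto>\<^bsub>B\<^esub> ?f (snd (e w)))"
      by simp
    then show ?thesis
      by (subst holds_image_cong[of _ _ "\<lambda>w. ?f (fst (e w)) \<leadsto>\<^bsub>B\<^esub> ?f (snd (e w))" W])
        (simp_all add: eW[symmetric] image_image)
  qed
  show "holds B (carrier A \<times> carrier A)
      (\<lambda>p. ?f (fst p \<leadsto>\<^bsub>A\<^esub> snd p) \<leadsto>\<^bsub>B\<^esub> ?f (fst p) \<leadsto>\<^bsub>B\<^esub> ?f (snd p))"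
  proof -
    let ?X = "carrier A \<times> carrier A"
    obtain W e where W: "small W" and e: "bij_betw e W ?X"
      using A.small_relation_representable[OF A.carrier_small subset_refl] by blast
    have eW: "e ` W = ?X"
      using e by (simp add: bij_betw_def)
    have ec: "fst (e w) \<in> carrier A" "snd (e w) \<in> carrier A" if "w \<in> W" for w
      using fst_closed[of "e w"] snd_closed[of "e w"] eW that by blast+
    let ?\<phi> = "\<lambda>w\<in>W. fst (e w) \<leadsto>\<^bsub>A\<^esub> snd (e w)" and ?\<psi> = "\<lambda>w\<in>W. fst (e w)"
      and ?\<chi> = "\<lambda>w\<in>W. snd (e w)"
    let ?\<mu> = "\<lambda>w\<in>W. A.conj (?\<phi> w) (?\<psi> w)"
    have \<phi>: "?\<phi> \<in> W \<rightarrow>\<^sub>E carrier A" and \<psi>: "?\<psi> \<in> W \<rightarrow>\<^sub>E carrier A" and \<chi>: "?\<chi> \<in> W \<rightarrow>\<^sub>E carrier A"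
      and \<mu>: "?\<mu> \<in> W \<rightarrow>\<^sub>E carrier A"
      using ec by (simp_all add: restrict_PiE_iff)
    have \<Phi>c: "\<Phi> W \<xi> w \<in> carrier B" if "\<xi> \<in> W \<rightarrow>\<^sub>E carrier A" "w \<in> W" for \<xi> w
      using transformation_closed[OF t W, of \<xi>] that by auto
    have "holds A W (\<lambda>w. (fst (e w) \<leadsto>\<^bsub>A\<^esub> snd (e w)) \<leadsto>\<^bsub>A\<^esub> fst (e w) \<leadsto>\<^bsub>A\<^esub> snd (e w))"
      by (rule A.holds_I) (use ec in simp)
    then have "holds A W (\<lambda>w. A.conj (fst (e w) \<leadsto>\<^bsub>A\<^esub> snd (e w)) (fst (e w)) \<leadsto>\<^bsub>A\<^esub> snd (e w))"
      by (subst (asm) A.holds_arr_iff) (use ec in simp_all)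
    (* Evaluation: the conjunction of a -> a' and a entails a'. *)
    then have eval: "holds A W (\<lambda>w. ?\<mu> w \<leadsto>\<^bsub>A\<^esub> ?\<chi> w)"
      by simp
    have proj: "holds B W (\<lambda>w. B.conj (?f (?\<phi> w)) (?f (?\<psi> w)) \<leadsto>\<^bsub>B\<^esub> \<Phi> W ?\<phi> w)"
      "holds B W (\<lambda>w. B.conj (?f (?\<phi> w)) (?f (?\<psi> w)) \<leadsto>\<^bsub>B\<^esub> \<Phi> W ?\<psi> w)"
      by (rule B.holds_trans[OF B.holds_fst transformation_eq_induced(2)[OF t W \<phi>]]
          B.holds_trans[OF B.holds_snd transformation_eq_induced(2)[OF t W \<psi>]];
          use ec fc \<Phi>c[OF \<phi>] \<Phi>c[OF \<psi>] in simp)+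
    have "holds B W (\<lambda>w. B.conj (?f (?\<phi> w)) (?f (?\<psi> w)) \<leadsto>\<^bsub>B\<^esub> B.conj (\<Phi> W ?\<phi> w) (\<Phi> W ?\<psi> w))"
      by (subst B.holds_conj_iff) (use proj ec fc \<Phi>c[OF \<phi>] \<Phi>c[OF \<psi>] in simp_all)
    then have "holds B W (\<lambda>w. B.conj (?f (?\<phi> w)) (?f (?\<psi> w)) \<leadsto>\<^bsub>B\<^esub> \<Phi> W ?\<mu> w)"
      by (rule B.holds_trans[OF _ cartesian_conj[OF \<Phi> W \<phi> \<psi>]])
        (use ec fc \<Phi>c[OF \<phi>] \<Phi>c[OF \<psi>] \<Phi>c[OF \<mu>] in simp_all)
    then have "holds B W (\<lambda>w. B.conj (?f (?\<phi> w)) (?f (?\<psi> w)) \<leadsto>\<^bsub>B\<^esub> ?f (?\<mu> w))"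
      by (rule B.holds_trans[OF _ transformation_eq_induced(1)[OF t W \<mu>]])
        (use ec fc \<Phi>c[OF \<mu>] in simp_all)
    then have "holds B W (\<lambda>w. B.conj (?f (?\<phi> w)) (?f (?\<psi> w)) \<leadsto>\<^bsub>B\<^esub> ?f (?\<chi> w))"
      by (rule B.holds_trans[OF _ induced_map_le[OF t W \<mu> \<chi> eval]]) (use ec fc in simp_all)
    then have "holds B W (\<lambda>w. ?f (?\<phi> w) \<leadsto>\<^bsub>B\<^esub> ?f (?\<psi> w) \<leadsto>\<^bsub>B\<^esub> ?f (?\<chi> w))"
      by (subst B.holds_arr_iff) (use ec fc in simp_all)
    then have "holds B W (\<lambda>w. ?f (fst (e w) \<leadsto>\<^bsub>A\<^esub> snd (e w)) \<leadsto>\<^bsub>B\<^esub> ?f (fst (e w)) \<leadsto>\<^bsub>B\<^esub> ?f (snd (e w)))"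
      by simp
    then show ?thesis
      by (subst holds_image_cong[of _ _ "\<lambda>w. ?f (fst (e w) \<leadsto>\<^bsub>A\<^esub> snd (e w)) \<leadsto>\<^bsub>B\<^esub>
            ?f (fst (e w)) \<leadsto>\<^bsub>B\<^esub> ?f (snd (e w))" W])
        (simp_all only: eW[symmetric] image_image)
  qed
qed

lemma postcomp_induced_map:
  assumes \<Phi>: "transformation small (arrow_tripos A) (arrow_tripos B) \<Phi>"
  shows "transformation_le small (arrow_tripos A) (arrow_tripos B)
      (\<Phi>\<^sup>+ small A B (induced_map A \<Phi>)) \<Phi>"
    and "transformation_le small (arrow_tripos A) (arrow_tripos B)
      \<Phi> (\<Phi>\<^sup>+ small A B (induced_map A \<Phi>))"
  unfolding transformation_le_def
  using transformation_eq_induced[OF \<Phi>] by (simp_all add: le_arrow_fibre compose_eq)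

lemma induced_map_mono:
  assumes "transformation_le small (arrow_tripos A) (arrow_tripos B) \<Phi> \<Psi>"
  shows "morphism_le A B (induced_map A \<Phi>) (induced_map A \<Psi>)"
proof -
  have "\<Phi> (carrier A) (\<lambda>a\<in>carrier A. a) \<sqsubseteq>\<^bsub>fibre (arrow_tripos B) (carrier A)\<^esub>
      \<Psi> (carrier A) (\<lambda>a\<in>carrier A. a)"
    using assms A.carrier_small generic_in_fibre unfolding transformation_le_def
    by (elim allE[of _ "carrier A"] impE bspec)
  then show ?thesis
    by (simp add: morphism_le_iff induced_map_def le_arrow_fibre)
qed

end

lemma (in implicative) induced_map_postcomp: "induced_map A (\<Phi>\<^sup>+ small A B f) = f"
  using A.carrier_small compose_PiE_Id[OF in_PiE] by (simp add: induced_map_def)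

context set_universe
begin

text \<open>
  The right adjoint \<open>\<Psi>\<close> of \<open>\<Phi>\<close> is cartesian, because right adjoints preserve meets, so the map that it
  induces is implicative as well. It witnesses density by the counit and the unit at the generic
  elements of \<open>P\<^sub>B\<close> and \<open>P\<^sub>A\<close>.
\<close>

lemma computationally_dense_induced_map:
  assumes AB: "arrow_algebra small A" "arrow_algebra small B"
    and \<Phi>: "geometric_transformation small (arrow_tripos A) (arrow_tripos B) \<Phi>"
  shows "computationally_dense A B (induced_map A \<Phi>)"
proof -
  interpret AB: arrow_logic_pair small A B
    by (intro arrow_logic_pair.intro arrow_logicI[OF set_universe_axioms] AB)
  interpret BA: arrow_logic_pair small B A
    by (intro arrow_logic_pair.intro arrow_logicI[OF set_universe_axioms] AB)
  have t: "transformation small (arrow_tripos A) (arrow_tripos B) \<Phi>"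
    using \<Phi> by (simp add: geometric_transformation_def cartesian_transformation_def)
  obtain \<Psi> where \<Psi>: "transformation small (arrow_tripos B) (arrow_tripos A) \<Psi>"
    and adj: "\<And>I. small I \<Longrightarrow>
      adjoint_maps (fibre (arrow_tripos A) I) (fibre (arrow_tripos B) I) (\<Phi> I) (\<Psi> I)"
    using \<Phi> by (auto simp: geometric_transformation_def)
  let ?f = "induced_map A \<Phi>" and ?h = "induced_map B \<Psi>"
  have "cartesian_transformation small (arrow_tripos B) (arrow_tripos A) \<Psi>"
    using \<Psi> right_adjoint_preserves_finite_meets[OF adj] by (simp add: cartesian_transformation_def)
  then have h: "implicative_morphism B A ?h"
    by (rule BA.implicative_induced_map)
  have f_PiE: "?f \<in> carrier A \<rightarrow>\<^sub>E carrier B" and h_PiE: "?h \<in> carrier B \<rightarrow>\<^sub>E carrier A"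
    by (rule AB.induced_map_in_PiE[OF t] BA.induced_map_in_PiE[OF \<Psi>])+
  have fc: "?f a \<in> carrier B" if "a \<in> carrier A" for a using f_PiE that by auto
  have hc: "?h b \<in> carrier A" if "b \<in> carrier B" for b using h_PiE that by auto
  have fh: "holds B (carrier B) (\<lambda>b. ?f (?h b) \<leadsto>\<^bsub>B\<^esub> b)"
  proof -
    have "?h \<sqsubseteq>\<^bsub>fibre (arrow_tripos A) (carrier B)\<^esub> \<Psi> (carrier B) (\<lambda>b\<in>carrier B. b)"
      unfolding induced_map_def[symmetric]
      by (rule weak_partial_order.le_refl[OF AB.A.weak_partial_order_fibre]) (simp add: h_PiE)
    then have "\<Phi> (carrier B) ?h \<sqsubseteq>\<^bsub>fibre (arrow_tripos B) (carrier B)\<^esub> (\<lambda>b\<in>carrier B. b)"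
      using adj[OF AB.B.carrier_small] h_PiE unfolding adjoint_maps_def by simp
    then have counit: "holds B (carrier B) (\<lambda>b. \<Phi> (carrier B) ?h b \<leadsto>\<^bsub>B\<^esub> b)"
      by (simp add: le_arrow_fibre)
    have c: "\<Phi> (carrier B) ?h b \<in> carrier B" if "b \<in> carrier B" for b
      using transformation_closed[OF t AB.B.carrier_small, of ?h] h_PiE that by auto
    show ?thesis
      by (rule AB.B.holds_trans[OF AB.transformation_eq_induced(2)[OF t AB.B.carrier_small h_PiE]
            counit]) (use c fc hc in simp_all)
  qed
  have hf: "holds A (carrier A) (\<lambda>a. a \<leadsto>\<^bsub>A\<^esub> ?h (?f a))"
  proof -
    have "\<Phi> (carrier A) (\<lambda>a\<in>carrier A. a) \<sqsubseteq>\<^bsub>fibre (arrow_tripos B) (carrier A)\<^esub> ?f"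
      unfolding induced_map_def[symmetric]
      by (rule weak_partial_order.le_refl[OF AB.B.weak_partial_order_fibre]) (simp add: f_PiE)
    then have "(\<lambda>a\<in>carrier A. a) \<sqsubseteq>\<^bsub>fibre (arrow_tripos A) (carrier A)\<^esub> \<Psi> (carrier A) ?f"
      using adj[OF AB.A.carrier_small] f_PiE unfolding adjoint_maps_def by simp
    then have unit: "holds A (carrier A) (\<lambda>a. a \<leadsto>\<^bsub>A\<^esub> \<Psi> (carrier A) ?f a)"
      by (simp add: le_arrow_fibre)
    have c: "\<Psi> (carrier A) ?f a \<in> carrier A" if "a \<in> carrier A" for a
      using transformation_closed[OF \<Psi> AB.A.carrier_small, of ?f] f_PiE that by auto
    show ?thesis
      by (rule AB.A.holds_trans[OF unit
            BA.transformation_eq_induced(1)[OF \<Psi> AB.A.carrier_small f_PiE]])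
        (use c fc hc in simp_all)
  qed
  show ?thesis
    unfolding computationally_dense_def
    by (intro exI[of _ ?h] conjI h) (simp_all add: morphism_le_iff compose_eq fh hf)
qed

lemma hom_equivalence:
  assumes AB: "arrow_algebra small A" "arrow_algebra small B"
  shows "preorder_equivalence (Hom (ArrAlg_cd small) A B)
    (Hom (Trip_geom small) (arrow_tripos A) (arrow_tripos B)) (\<Phi>\<^sup>+ small A B)"
proof -
  interpret AB: arrow_logic_pair small A B
    by (intro arrow_logic_pair.intro arrow_logicI[OF set_universe_axioms] AB)
  interpret F: two_functor "ArrAlg_cd small" "Trip_geom small" arrow_tripos "\<Phi>\<^sup>+ small"
    by (rule two_functor_postcomp_cd)
  let ?L = "Hom (ArrAlg_cd small) A B"
    and ?M = "Hom (Trip_geom small) (arrow_tripos A) (arrow_tripos B)"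
  have "A \<in> Ob (ArrAlg_cd small)" "B \<in> Ob (ArrAlg_cd small)"
    using AB by (simp_all add: ArrAlg_cd_def)
  then have mono: "monotone_map ?L ?M (\<Phi>\<^sup>+ small A B)"
    by (rule F.hom_map)
  have L: "f \<in> carrier ?L \<longleftrightarrow> implicative_morphism A B f \<and> computationally_dense A B f"
    "f \<sqsubseteq>\<^bsub>?L\<^esub> g \<longleftrightarrow> morphism_le A B f g" for f g
    by (simp_all add: ArrAlg_cd_def)
  have M: "\<Phi> \<in> carrier ?M \<longleftrightarrow>
      geometric_transformation small (arrow_tripos A) (arrow_tripos B) \<Phi>"
    "\<Phi> \<sqsubseteq>\<^bsub>?M\<^esub> \<Psi> \<longleftrightarrow> transformation_le small (arrow_tripos A) (arrow_tripos B) \<Phi> \<Psi>"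
    "\<Phi> .=\<^bsub>?M\<^esub> \<Psi> \<longleftrightarrow> transformation_le small (arrow_tripos A) (arrow_tripos B) \<Phi> \<Psi> \<and>
      transformation_le small (arrow_tripos A) (arrow_tripos B) \<Psi> \<Phi>" for \<Phi> \<Psi>
    by (auto simp: Trip_geom_def geometric_transformation_def)
  show ?thesis
    unfolding preorder_equivalence_def
  proof (intro conjI exI[of _ "induced_map A"] ballI mono)
    show "monotone_map ?M ?L (induced_map A)"
      unfolding monotone_map_def isotone_def
    proof (intro conjI ballI impI monotone_mapD(3,4)[OF mono] funcsetI)
      show "induced_map A \<Phi> \<in> carrier ?L" if "\<Phi> \<in> carrier ?M" for \<Phi>
        using that AB.implicative_induced_map[of \<Phi>] computationally_dense_induced_map[OF AB, of \<Phi>]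
        by (simp add: L M geometric_transformation_def)
      show "induced_map A \<Phi> \<sqsubseteq>\<^bsub>?L\<^esub> induced_map A \<Psi>" if "\<Phi> \<sqsubseteq>\<^bsub>?M\<^esub> \<Psi>" for \<Phi> \<Psi>
        using that AB.induced_map_mono by (simp add: L M)
    qed
  next
    fix f assume f: "f \<in> carrier ?L"
    interpret L: weak_partial_order ?L
      by (rule monotone_mapD(3)[OF mono])
    interpret f: implicative small A B f
      by (rule implicativeI[OF AB]) (use f L in simp)
    show "induced_map A (\<Phi>\<^sup>+ small A B f) .=\<^bsub>?L\<^esub> f"
      unfolding f.induced_map_postcomp by (rule L.refl[OF f])
  next
    fix \<Phi> assume "\<Phi> \<in> carrier ?M"
    then have "transformation small (arrow_tripos A) (arrow_tripos B) \<Phi>"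
      by (simp add: M geometric_transformation_def cartesian_transformation_def)
    then show "\<Phi>\<^sup>+ small A B (induced_map A \<Phi>) .=\<^bsub>?M\<^esub> \<Phi>"
      unfolding M using AB.postcomp_induced_map by (intro conjI)
  qed
qed

end

theorem proposition5p9:
  fixes small :: "'u set \<Rightarrow> bool"
  assumes "set_universe small"
  shows "two_functor (ArrAlg small) (Trip_cart small) arrow_tripos (\<Phi>\<^sup>+ small) \<and>
    two_functor (ArrAlg_cd small) (Trip_geom small) arrow_tripos (\<Phi>\<^sup>+ small) \<and>
    two_fully_faithful (ArrAlg_cd small) (Trip_geom small) arrow_tripos (\<Phi>\<^sup>+ small) \<and>
    (\<forall>A B. arrow_algebra small A \<and> arrow_algebra small B \<longrightarrow>
      preorder_equivalence (Hom (ArrAlg_cd small) A B)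
        (Hom (Trip_geom small) (arrow_tripos A) (arrow_tripos B)) (\<Phi>\<^sup>+ small A B))"
proof -
  interpret set_universe small by fact
  have "two_fully_faithful (ArrAlg_cd small) (Trip_geom small) arrow_tripos (\<Phi>\<^sup>+ small)"
    unfolding two_fully_faithful_def by (simp add: ArrAlg_cd_def hom_equivalence[unfolded ArrAlg_cd_def])
  then show ?thesis
    using two_functor_postcomp two_functor_postcomp_cd hom_equivalence by blast
qed

end
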